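(* Let $d,L\in\mathbb{N}$, $A,B_1,\dots,B_L\in\mathbb{R}^{d\times d}$, let $x\in\mathbb{R}^d$ with $x\neq 0$, and let $(X_t(x))_{t\ge 0}$ be the unique strong solution of the Stratonovich SDE $$dX_t(x)=AX_t(x)\,dt+\sum_{j=1}^{L}B_jX_t(x)\circ dW_j(t),\quad t\ge 0,\qquad X_0(x)=x.$$ Assume that the matrix $\Delta:=\widetilde A\otimes I_d+I_d\otimes\widetilde A+\sum_{j=1}^{L}B_j\otimes B_j\in\mathbb{R}^{d^2\times d^2}$, where $\widetilde A:=A+\frac12\sum_{j=1}^{L}B_j^2$, is Hurwitz stable. Let $q>0$ and $\ell\in\{1,\dots,d^2\}$ be the exponents associated with $\Delta$ and $\mathrm{vec}(xx^* )$ as described in the context, and set $$t_\varepsilon:=\frac1q\ln\Big(\frac1\varepsilon\Big)+\frac{\ell-1}{q}\ln\Big(\ln\Big(\frac1\varepsilon\Big)\Big),\qquad \varepsilon\in(0,1).$$ Let $(w_\varepsilon)_{\varepsilon>0}$ be any function of positive numbers such that $w_\varepsilon\to w$ as $\varepsilon\to0$, with $w>0$. Then $$\lim_{r\to\infty}\limsup_{\varepsilon\to0}\frac{\mathbb{E}\big[\|X_{t_\varepsilon+r\cdot w_\varepsilon}(x)\|^2\big]}{\varepsilon}=0\qquad\text{and}\qquad \lim_{r\to-\infty}\liminf_{\varepsilon\to0}\frac{\mathbb{E}\big[\|X_{t_\varepsilon+r\cdot w_\varepsilon}(x)\|^2\big]}{\varepsilon}=\infty.$$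
   Context: $W_1,\dots,W_L$ are independent standard one-dimensional Brownian motions on a filtered complete probability space satisfying the usual conditions, and $\circ$ denotes Stratonovich integration. $\|\cdot\|$ is the Euclidean norm; $\otimes$ is the Kronecker product; a matrix is Hurwitz stable if all its eigenvalues have strictly negative real part; $x^*$ is the transpose of the real column vector $x$; $\mathrm{vec}(V):=(V_{1,1},\dots,V_{1,d},V_{2,1},\dots,V_{2,d},\dots,V_{d,1},\dots,V_{d,d})$ for $V\in\mathbb{R}^{d\times d}$. Exponents: it is known that, since $\Delta$ is Hurwitz stable and $xx^*\ne 0$, there exist $q>0$, $\ell,m\in\{1,\dots,d^2\}$, $\theta_1,\dots,\theta_m\in\mathbb{R}$ and linearly independent vectors $v_1,\dots,v_m\in\mathbb{C}^{d^2}$ (all depending on $x$) such that $$\lim_{t\to\infty}\Big\|\frac{e^{qt}}{t^{\ell-1}}\exp(t\Delta)\,\mathrm{vec}(xx^* )-\sum_{k=1}^{m}e^{\mathsf{i}t\theta_k}v_k\Big\|=0,$$ and there are constants $K_0,K_1>0$ with $K_0\le\liminf_{t\to\infty}\|\sum_{k=1}^m e^{\mathsf{i}t\theta_k}v_k\|\le\limsup_{t\to\infty}\|\sum_{k=1}^m e^{\mathsf{i}t\theta_k}v_k\|\le K_1$. The numbers $q$ and $\ell$ in the claim are those of such a fixed choice. *)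

theory Defs
  imports "HOL-Probability.Probability"
begin

section \<open>Matrices\<close>

text \<open>
  Vectors and matrices of size \<open>d\<^sup>2\<close> are indexed by the type \<open>'n \<times> 'n\<close>; a pair \<open>(i, j)\<close> plays the
  role of the position \<open>(i - 1) d + j\<close>. This is the ordering used both by the row-wise
  vectorization and by the usual block form of the Kronecker product.
\<close>

definition vec_of_matrix :: "real^'n^'n \<Rightarrow> real^('n \<times> 'n)" where
  "vec_of_matrix V = (\<chi> p. V $ fst p $ snd p)"

definition kronecker :: "real^'n^'n \<Rightarrow> real^'n^'n \<Rightarrow> real^('n \<times> 'n)^('n \<times> 'n)" where
  "kronecker A B = (\<chi> p q. A $ fst p $ fst q * B $ snd p $ snd q)"

definition self_outer :: "real^'n \<Rightarrow> real^'n^'n" where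
  "self_outer x = (\<chi> i j. x $ i * x $ j)"

definition matrix_exp :: "real^'k^'k \<Rightarrow> real^'k^'k" where
  "matrix_exp A = (\<Sum>n. (1 / fact n) *\<^sub>R (((**) A ^^ n) (mat 1)))"

definition complex_vec :: "real^'k \<Rightarrow> complex^'k" where
  "complex_vec v = (\<chi> i. complex_of_real (v $ i))"

definition complex_mat :: "real^'k^'k \<Rightarrow> complex^'k^'k" where
  "complex_mat A = (\<chi> i j. complex_of_real (A $ i $ j))"

definition hurwitz_stable :: "real^'k^'k \<Rightarrow> bool" where
  "hurwitz_stable A \<longleftrightarrow>
     (\<forall>\<mu>. (\<exists>v. v \<noteq> 0 \<and> complex_mat A *v v = \<mu> *s v) \<longrightarrow> Re \<mu> < 0)"

definition ito_drift :: "real^'n^'n \<Rightarrow> ('l::finite \<Rightarrow> real^'n^'n) \<Rightarrow> real^'n^'n" where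
  "ito_drift A B = A + (1 / 2) *\<^sub>R (\<Sum>j\<in>UNIV. B j ** B j)"

definition Delta :: "real^'n^'n \<Rightarrow> ('l::finite \<Rightarrow> real^'n^'n) \<Rightarrow> real^('n \<times> 'n)^('n \<times> 'n)" where
  "Delta A B = kronecker (ito_drift A B) (mat 1) + kronecker (mat 1) (ito_drift A B)
             + (\<Sum>j\<in>UNIV. kronecker (B j) (B j))"

text \<open>
  \<open>asymptotic_exponents D y q l\<close>: for some choice of \<open>m\<close>, \<open>\<theta>\<close> and \<open>v\<close>, the numbers \<open>q\<close> and \<open>l\<close>
  describe the decay of \<open>exp (t D) y\<close> up to the oscillating factor \<open>\<Sum>k. exp (\<i> t \<theta>\<^sub>k) v\<^sub>k\<close>.
  Linear independence is over the complex numbers.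
\<close>

definition asymptotic_exponents ::
    "real^'k^'k \<Rightarrow> real^'k \<Rightarrow> real \<Rightarrow> nat \<Rightarrow> bool" where
  "asymptotic_exponents D y q l \<longleftrightarrow> q > 0 \<and> l \<in> {1..CARD('k)} \<and>
     (\<exists>m\<in>{1..CARD('k)}. \<exists>(\<theta> :: nat \<Rightarrow> real) (v :: nat \<Rightarrow> complex^'k).
        inj_on v {1..m} \<and> vec.independent (v ` {1..m}) \<and>
        ((\<lambda>t::real. norm (complex_of_real (exp (q * t) / t ^ (l - 1)) *s
                         complex_vec (matrix_exp (t *\<^sub>R D) *v y)
                       - (\<Sum>k=1..m. exp (\<i> * complex_of_real (t * \<theta> k)) *s v k)))
           \<longlongrightarrow> 0) at_top \<and>
        (\<exists>K0 K1 :: real. K0 > 0 \<and> K1 > 0 \<and>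
           ereal K0 \<le> Liminf at_top (\<lambda>t::real.
             ereal (norm (\<Sum>k=1..m. exp (\<i> * complex_of_real (t * \<theta> k)) *s v k))) \<and>
           Limsup at_top (\<lambda>t::real.
             ereal (norm (\<Sum>k=1..m. exp (\<i> * complex_of_real (t * \<theta> k)) *s v k))) \<le> ereal K1))"

section \<open>Stochastic processes\<close>

text \<open>
  Processes have type \<open>real \<Rightarrow> 'a \<Rightarrow> 'b\<close>, but only their values at times \<open>t \<ge> 0\<close> matter. The library
  locale \<open>filtration\<close> wants the filtration to be defined on the whole index type; a filtration given
  for \<open>t \<ge> 0\<close> is extended by its value at \<open>0\<close>.
\<close>

locale usual_filtered_prob_space =
  prob_space M + complete_measure M + filtration "space M" F
  for M :: "'a measure" and F :: "real \<Rightarrow> 'a measure" +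
  assumes F_subset: "\<And>t. 0 \<le> t \<Longrightarrow> sets (F t) \<subseteq> sets M"
    and null_sets_F: "null_sets M \<subseteq> sets (F 0)"
    and right_continuous: "\<And>t. 0 \<le> t \<Longrightarrow> sets (F t) = (\<Inter>s\<in>{t<..}. sets (F s))"

definition adapted :: "(real \<Rightarrow> 'a measure) \<Rightarrow> (real \<Rightarrow> 'a \<Rightarrow> 'b::topological_space) \<Rightarrow> bool" where
  "adapted F X \<longleftrightarrow> (\<forall>t\<ge>0. X t \<in> borel_measurable (F t))"

definition continuous_paths :: "'a measure \<Rightarrow> (real \<Rightarrow> 'a \<Rightarrow> 'b::topological_space) \<Rightarrow> bool" where
  "continuous_paths M X \<longleftrightarrow> (AE \<omega> in M. continuous_on {0..} (\<lambda>t. X t \<omega>))"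

definition brownian_motion ::
    "'a measure \<Rightarrow> (real \<Rightarrow> 'a measure) \<Rightarrow> (real \<Rightarrow> 'a \<Rightarrow> real) \<Rightarrow> bool" where
  "brownian_motion M F W \<longleftrightarrow>
     adapted F W \<and> continuous_paths M W \<and> (AE \<omega> in M. W 0 \<omega> = 0) \<and>
     (\<forall>s t. 0 \<le> s \<and> s < t \<longrightarrow>
        distributed M lborel (\<lambda>\<omega>. W t \<omega> - W s \<omega>) (normal_density 0 (sqrt (t - s))) \<and>
        prob_space.indep_set M (sets (F s))
          (sets (vimage_algebra (space M) (\<lambda>\<omega>. W t \<omega> - W s \<omega>) borel)))"

definition independent_brownian_motions ::
    "'a measure \<Rightarrow> (real \<Rightarrow> 'a measure) \<Rightarrow> ('l \<Rightarrow> real \<Rightarrow> 'a \<Rightarrow> real) \<Rightarrow> bool" where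
  "independent_brownian_motions M F W \<longleftrightarrow>
     (\<forall>j. brownian_motion M F (W j)) \<and>
     prob_space.indep_vars M (\<lambda>_. \<Pi>\<^sub>M t\<in>{0..}. borel) (\<lambda>j \<omega>. \<lambda>t\<in>{0..}. W j t \<omega>) UNIV"

definition martingale ::
    "'a measure \<Rightarrow> (real \<Rightarrow> 'a measure) \<Rightarrow> (real \<Rightarrow> 'a \<Rightarrow> real) \<Rightarrow> bool" where
  "martingale M F N \<longleftrightarrow> adapted F N \<and> (\<forall>t\<ge>0. integrable M (N t)) \<and>
     (\<forall>s t. 0 \<le> s \<and> s \<le> t \<longrightarrow> (AE \<omega> in M. real_cond_exp M (F s) (N t) \<omega> = N s \<omega>))"

text \<open>
  The localizing stopping times are finite, which is no restriction: replace \<open>\<tau> n\<close> by its minimum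
  with \<open>n\<close>.
\<close>

definition continuous_local_martingale ::
    "'a measure \<Rightarrow> (real \<Rightarrow> 'a measure) \<Rightarrow> (real \<Rightarrow> 'a \<Rightarrow> real) \<Rightarrow> bool" where
  "continuous_local_martingale M F N \<longleftrightarrow>
     adapted F N \<and> continuous_paths M N \<and>
     (\<exists>\<tau> :: nat \<Rightarrow> 'a \<Rightarrow> real.
        (\<forall>n. stopping_time F (\<tau> n) \<and> (\<forall>\<omega>. 0 \<le> \<tau> n \<omega>) \<and>
             martingale M F (\<lambda>t \<omega>. N (min t (\<tau> n \<omega>)) \<omega> - N 0 \<omega>)) \<and>
        (AE \<omega> in M. incseq (\<lambda>n. \<tau> n \<omega>) \<and> filterlim (\<lambda>n. \<tau> n \<omega>) at_top sequentially))"

text \<open>The points \<open>p 0, \<dots>, p n\<close> form a subdivision of \<open>[0, t]\<close>; values beyond \<open>n\<close> are irrelevant.\<close>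

definition subdivision :: "real \<Rightarrow> nat \<Rightarrow> (nat \<Rightarrow> real) \<Rightarrow> bool" where
  "subdivision t n p \<longleftrightarrow> p 0 = 0 \<and> p n = t \<and> (\<forall>i<n. p i \<le> p (Suc i))"

definition continuous_finite_variation ::
    "'a measure \<Rightarrow> (real \<Rightarrow> 'a measure) \<Rightarrow> (real \<Rightarrow> 'a \<Rightarrow> real) \<Rightarrow> bool" where
  "continuous_finite_variation M F V \<longleftrightarrow>
     adapted F V \<and> continuous_paths M V \<and>
     (AE \<omega> in M. \<forall>t\<ge>0. \<exists>K. \<forall>n p. subdivision t n p \<longrightarrow>
        (\<Sum>i<n. \<bar>V (p (Suc i)) \<omega> - V (p i) \<omega>\<bar>) \<le> K)"

definition continuous_semimartingale ::
    "'a measure \<Rightarrow> (real \<Rightarrow> 'a measure) \<Rightarrow> (real \<Rightarrow> 'a \<Rightarrow> real) \<Rightarrow> bool" where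
  "continuous_semimartingale M F Y \<longleftrightarrow>
     (\<exists>N V. continuous_local_martingale M F N \<and> continuous_finite_variation M F V \<and>
        (\<forall>t\<ge>0. AE \<omega> in M. Y t \<omega> = N t \<omega> + V t \<omega>)) \<and>
     adapted F Y \<and> continuous_paths M Y"

section \<open>Stratonovich integral and Stratonovich equation\<close>

definition stratonovich_sum ::
    "(real \<Rightarrow> 'a \<Rightarrow> 'b::real_normed_vector) \<Rightarrow> (real \<Rightarrow> 'a \<Rightarrow> real) \<Rightarrow> nat \<Rightarrow> (nat \<Rightarrow> real) \<Rightarrow> 'a \<Rightarrow> 'b"
where
  "stratonovich_sum Y W n p \<omega> =
     (\<Sum>i<n. (W (p (Suc i)) \<omega> - W (p i) \<omega>) *\<^sub>R ((1 / 2) *\<^sub>R (Y (p i) \<omega> + Y (p (Suc i)) \<omega>)))"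

text \<open>
  The random variable \<open>J\<close> is (a version of) the Fisk--Stratonovich integral of \<open>Y\<close> with respect to
  \<open>W\<close> over \<open>[0, t]\<close>: the limit in probability of the symmetric Riemann sums as the mesh of the
  subdivision tends to \<open>0\<close>. Meant for semimartingales \<open>Y\<close> and \<open>W\<close>.
\<close>

definition has_stratonovich_integral ::
    "'a measure \<Rightarrow> (real \<Rightarrow> 'a \<Rightarrow> 'b::real_normed_vector) \<Rightarrow> (real \<Rightarrow> 'a \<Rightarrow> real) \<Rightarrow> real
       \<Rightarrow> ('a \<Rightarrow> 'b) \<Rightarrow> bool" where
  "has_stratonovich_integral M Y W t J \<longleftrightarrow>
     J \<in> borel_measurable M \<and>
     (\<forall>e>0. \<forall>\<eta>>0. \<exists>\<delta>>0. \<forall>n p.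
        subdivision t n p \<and> (\<forall>i<n. p (Suc i) - p i < \<delta>) \<longrightarrow>
          measure M {\<omega> \<in> space M. norm (stratonovich_sum Y W n p \<omega> - J \<omega>) > e} < \<eta>)"

text \<open>
  \<open>X\<close> solves \<open>dX = A X dt + \<Sum>j. B\<^sub>j X \<circ> dW\<^sub>j\<close>, \<open>X\<^sub>0 = x\<close>, on the given filtered probability space and
  for the given Brownian motions.
\<close>

definition stratonovich_solution ::
    "'a measure \<Rightarrow> (real \<Rightarrow> 'a measure) \<Rightarrow> ('l::finite \<Rightarrow> real \<Rightarrow> 'a \<Rightarrow> real) \<Rightarrow>
     real^'n^'n \<Rightarrow> ('l \<Rightarrow> real^'n^'n) \<Rightarrow> real^'n \<Rightarrow> (real \<Rightarrow> 'a \<Rightarrow> real^'n) \<Rightarrow> bool" where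
  "stratonovich_solution M F W A B x X \<longleftrightarrow>
     adapted F X \<and> continuous_paths M X \<and>
     (\<forall>i. continuous_semimartingale M F (\<lambda>t \<omega>. X t \<omega> $ i)) \<and>
     (AE \<omega> in M. X 0 \<omega> = x) \<and>
     (\<exists>J :: 'l \<Rightarrow> real \<Rightarrow> 'a \<Rightarrow> real^'n.
        (\<forall>j. \<forall>t\<ge>0. has_stratonovich_integral M (\<lambda>s \<omega>. B j *v X s \<omega>) (W j) t (J j t)) \<and>
        (\<forall>t\<ge>0. AE \<omega> in M.
           X t \<omega> = x + integral {0..t} (\<lambda>s. A *v X s \<omega>) + (\<Sum>j\<in>UNIV. J j t \<omega>)))"

definition cutoff_time :: "real \<Rightarrow> nat \<Rightarrow> real \<Rightarrow> real" where
  "cutoff_time q l \<epsilon> = 1 / q * ln (1 / \<epsilon>) + (real l - 1) / q * ln (ln (1 / \<epsilon>))"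

text \<open>
  The second moment is an extended nonnegative number, so that finiteness is not presupposed.
\<close>

definition second_moment :: "'a measure \<Rightarrow> ('a \<Rightarrow> real^'n) \<Rightarrow> ennreal" where
  "second_moment M Z = (\<integral>\<^sup>+\<omega>. ennreal ((norm (Z \<omega>))\<^sup>2) \<partial>M)"

end

theory Submission
  imports Defs "HOL-Real_Asymp.Real_Asymp"
begin

text \<open>
  The matrix \<open>E (X\<^sub>t X\<^sub>t\<^sup>*)\<close> solves a linear equation with generator \<open>Delta A B\<close>, so that its
  vectorization is \<open>exp (t Delta) vec (x x\<^sup>*)\<close>; its trace, the second moment of \<open>X\<^sub>t\<close>, is comparable
  with its norm and hence with \<open>t\<^sup>l\<^sup>-\<^sup>1 exp (- q t)\<close>, and at the cutoff time this profile is of order \<open>\<epsilon>\<close>.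

  The equation for the second moments is obtained on dyadic grids, without a theory of stochastic
  integration. The squared increments of a semimartingale have tight sums, which lets one replace
  the symmetric sums of the Stratonovich integral by left-point sums and a drift correction, with
  an error tending to \<open>0\<close> in probability. Truncation, a Gronwall argument and a Fatou argument then
  bound the second moments of \<open>X\<close> and show that the Euler scheme converges to \<open>X\<close> in mean square.
  The second moments of the Euler scheme are computed exactly and converge to the matrix
  exponential.
\<close>

section \<open>Convergence in probability\<close>

text \<open>The obstacle: the equation for X is an identity between limits in probability, which
  carry no moments, and X is not known to be square integrable. Bounds are therefore proved for
  truncated variables, uniformly in the truncation, and are carried over to the limit by a Fatou
  argument that costs a factor 2; several constants below contain powers of this 2. Dyadic grids are
  nested, so that a coarse Brownian increment is a sum of fine ones. The correction of the drift
  comes from the covariation of W_j and X, whose sums have to be computed from the very equation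
  that X solves, used once more on a finer grid. For distinct i and j the independence of W_i and
  W_j is given for the two processes and not conditionally on the filtration, hence mixed increments
  need an argument of their own. Convergence in probability is expressed by the number E min(1,
  |Z|), which metrizes it; a single number per index is what permits the choice of a refinement
  depth for every level.\<close>

definition null_in_prob :: "'a measure \<Rightarrow> (nat \<Rightarrow> 'a \<Rightarrow> 'b::{second_countable_topology,real_normed_vector}) \<Rightarrow> bool"
where
  "null_in_prob M Z \<longleftrightarrow> (\<forall>n. Z n \<in> borel_measurable M) \<and>
     (\<lambda>n. \<integral>\<omega>. min 1 (norm (Z n \<omega>)) \<partial>M) \<longlonglongrightarrow> 0"

context prob_space
begin

lemma integrable_event_indicator: "E \<in> events \<Longrightarrow> integrable M (indicator E :: 'a \<Rightarrow> real)"
  by (simp add: integrable_real_indicator emeasure_eq_measure)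

lemma integrable_min_norm:
  fixes Z :: "'a \<Rightarrow> 'b::{second_countable_topology,real_normed_vector}"
  assumes "Z \<in> borel_measurable M"
  shows "integrable M (\<lambda>\<omega>. min 1 (norm (Z \<omega>)))"
  by (rule integrable_const_bound[where B=1]) (use assms in auto)

lemma null_in_prob_measurable:
  "null_in_prob M Z \<Longrightarrow> Z n \<in> borel_measurable M"
  by (simp add: null_in_prob_def)

text \<open>Since min 1 |Z| is at most the indicator of E plus U, rare large values are charged to E
  and frequent small ones to U. Both may depend on n as well as on \<open>\<eta>\<close>, so that
  truncation levels can be adapted to \<open>\<eta>\<close>.\<close>

lemma null_in_probI_bad:
  fixes Z :: "nat \<Rightarrow> 'a \<Rightarrow> 'b::{second_countable_topology,real_normed_vector}"
  assumes meas: "\<And>n. Z n \<in> borel_measurable M"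
    and bad: "\<And>\<eta>. \<eta> > 0 \<Longrightarrow> \<forall>\<^sub>F n in sequentially. \<exists>E U. E \<in> events \<and> prob E \<le> \<eta> \<and>
        integrable M U \<and> expectation U \<le> \<eta> \<and> (AE \<omega> in M. 0 \<le> U \<omega>) \<and>
        (AE \<omega> in M. \<omega> \<notin> E \<longrightarrow> norm (Z n \<omega>) \<le> U \<omega>)"
  shows "null_in_prob M Z"
  unfolding null_in_prob_def
proof (intro conjI allI meas)
  show "(\<lambda>n. expectation (\<lambda>\<omega>. min 1 (norm (Z n \<omega>)))) \<longlonglongrightarrow> 0"
  proof (rule LIMSEQ_I)
    fix r :: real assume "r > 0"
    have "\<forall>\<^sub>F n in sequentially. expectation (\<lambda>\<omega>. min 1 (norm (Z n \<omega>))) < r"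
      using bad[of "r / 3"]
    proof (rule eventually_mono)
      show "r / 3 > 0" using \<open>r > 0\<close> by simp
      fix n assume "\<exists>E U. E \<in> events \<and> prob E \<le> r / 3 \<and>
        integrable M U \<and> expectation U \<le> r / 3 \<and> (AE \<omega> in M. 0 \<le> U \<omega>) \<and>
        (AE \<omega> in M. \<omega> \<notin> E \<longrightarrow> norm (Z n \<omega>) \<le> U \<omega>)"
      then obtain E U where *: "E \<in> events" "prob E \<le> r / 3" "integrable M U"
        "expectation U \<le> r / 3" "AE \<omega> in M. 0 \<le> U \<omega>" "AE \<omega> in M. \<omega> \<notin> E \<longrightarrow> norm (Z n \<omega>) \<le> U \<omega>"
        by blast
      have "expectation (\<lambda>\<omega>. min 1 (norm (Z n \<omega>))) \<le> expectation (\<lambda>\<omega>. indicator E \<omega> + U \<omega>)"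
      proof (rule integral_mono_AE)
        show "AE \<omega> in M. min 1 (norm (Z n \<omega>)) \<le> indicator E \<omega> + U \<omega>"
          using *(5,6) by eventually_elim (auto simp: indicator_def)
      qed (use * integrable_min_norm[OF meas] integrable_event_indicator[of E] in auto)
      also have "\<dots> = prob E + expectation U"
        using * integrable_event_indicator[of E] by simp
      also have "\<dots> < r" using * \<open>r > 0\<close> by simp
      finally show "expectation (\<lambda>\<omega>. min 1 (norm (Z n \<omega>))) < r" .
    qed
    then obtain N where "\<And>n. n \<ge> N \<Longrightarrow> expectation (\<lambda>\<omega>. min 1 (norm (Z n \<omega>))) < r"
      by (auto simp: eventually_sequentially)
    moreover have "expectation (\<lambda>\<omega>. min 1 (norm (Z n \<omega>))) \<ge> 0" for n
      by (rule integral_nonneg_AE) auto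
    ultimately show "\<exists>no. \<forall>n\<ge>no. norm (expectation (\<lambda>\<omega>. min 1 (norm (Z n \<omega>))) - 0) < r"
      by (intro exI[of _ N]) (metis abs_of_nonneg diff_zero real_norm_def)
  qed
qed

lemma null_in_prob_dominated:
  fixes Z :: "nat \<Rightarrow> 'a \<Rightarrow> 'b::{second_countable_topology,real_normed_vector}"
    and Y :: "nat \<Rightarrow> 'a \<Rightarrow> 'c::{second_countable_topology,real_normed_vector}"
  assumes meas: "\<And>n. Y n \<in> borel_measurable M" and Z: "null_in_prob M Z"
    and le: "\<And>n. AE \<omega> in M. norm (Y n \<omega>) \<le> C * norm (Z n \<omega>)"
  shows "null_in_prob M Y"
  unfolding null_in_prob_def
proof (intro conjI allI meas)
  \<comment> \<open>The truncation at 1 is compatible only with factors at least 1: the inequality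
    min 1 (C z) <= D min 1 z uses D >= 1 as well as D >= C.\<close>
  define D where "D = max 1 C"
  have D: "D \<ge> 1" "C \<le> D" by (auto simp: D_def)
  have Zm: "Z n \<in> borel_measurable M" for n
    using Z by (auto simp: null_in_prob_def)
  have "(\<lambda>n. D * expectation (\<lambda>\<omega>. min 1 (norm (Z n \<omega>)))) \<longlonglongrightarrow> D * 0"
    using Z by (intro tendsto_intros) (auto simp: null_in_prob_def)
  then have lim: "(\<lambda>n. D * expectation (\<lambda>\<omega>. min 1 (norm (Z n \<omega>)))) \<longlonglongrightarrow> 0" by simp
  show "(\<lambda>n. expectation (\<lambda>\<omega>. min 1 (norm (Y n \<omega>)))) \<longlonglongrightarrow> 0"
  proof (rule tendsto_sandwich[OF _ _ tendsto_const lim])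
    show "\<forall>\<^sub>F n in sequentially. 0 \<le> expectation (\<lambda>\<omega>. min 1 (norm (Y n \<omega>)))"
      by (intro always_eventually allI integral_nonneg_AE) auto
    have "expectation (\<lambda>\<omega>. min 1 (norm (Y n \<omega>))) \<le> D * expectation (\<lambda>\<omega>. min 1 (norm (Z n \<omega>)))" for n
    proof -
      have "expectation (\<lambda>\<omega>. min 1 (norm (Y n \<omega>))) \<le> expectation (\<lambda>\<omega>. D * min 1 (norm (Z n \<omega>)))"
      proof (rule integral_mono_AE)
        show "AE \<omega> in M. min 1 (norm (Y n \<omega>)) \<le> D * min 1 (norm (Z n \<omega>))"
          using le[of n]
        proof eventually_elim
          case (elim \<omega>)
          have "C * norm (Z n \<omega>) \<le> D * norm (Z n \<omega>)" using D by (intro mult_right_mono) auto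
          then show ?case using elim D by (auto simp: min_def)
        qed
      qed (use integrable_min_norm[OF meas] integrable_min_norm[OF Zm] in auto)
      then show ?thesis by simp
    qed
    then show "\<forall>\<^sub>F n in sequentially. expectation (\<lambda>\<omega>. min 1 (norm (Y n \<omega>)))
        \<le> D * expectation (\<lambda>\<omega>. min 1 (norm (Z n \<omega>)))" by simp
  qed
qed

lemma null_in_prob_add:
  fixes Y Z :: "nat \<Rightarrow> 'a \<Rightarrow> 'b::{second_countable_topology,real_normed_vector}"
  assumes Y: "null_in_prob M Y" and Z: "null_in_prob M Z"
  shows "null_in_prob M (\<lambda>n \<omega>. Y n \<omega> + Z n \<omega>)"
  unfolding null_in_prob_def
proof (intro conjI allI)
  have m[measurable]: "Z n \<in> borel_measurable M" "Y n \<in> borel_measurable M" for n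
    using Y Z by (auto simp: null_in_prob_def)
  show m': "(\<lambda>\<omega>. Y n \<omega> + Z n \<omega>) \<in> borel_measurable M" for n by measurable
  have lim: "(\<lambda>n. expectation (\<lambda>\<omega>. min 1 (norm (Y n \<omega>))) + expectation (\<lambda>\<omega>. min 1 (norm (Z n \<omega>)))) \<longlonglongrightarrow> 0"
    using Y Z by (auto simp: null_in_prob_def intro!: tendsto_eq_intros)
  show "(\<lambda>n. expectation (\<lambda>\<omega>. min 1 (norm (Y n \<omega> + Z n \<omega>)))) \<longlonglongrightarrow> 0"
  proof (rule tendsto_sandwich[OF _ _ tendsto_const lim])
    show "\<forall>\<^sub>F n in sequentially. 0 \<le> expectation (\<lambda>\<omega>. min 1 (norm (Y n \<omega> + Z n \<omega>)))"
      by (intro always_eventually allI integral_nonneg_AE) auto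
    have "expectation (\<lambda>\<omega>. min 1 (norm (Y n \<omega> + Z n \<omega>))) \<le>
       expectation (\<lambda>\<omega>. min 1 (norm (Y n \<omega>))) + expectation (\<lambda>\<omega>. min 1 (norm (Z n \<omega>)))" for n
      unfolding Bochner_Integration.integral_add[OF integrable_min_norm[OF m(2)] integrable_min_norm[OF m(1)], symmetric]
    proof (rule integral_mono)
      show "min 1 (norm (Y n \<omega> + Z n \<omega>)) \<le> min 1 (norm (Y n \<omega>)) + min 1 (norm (Z n \<omega>))" for \<omega>
        using norm_triangle_ineq[of "Y n \<omega>" "Z n \<omega>"] norm_ge_zero[of "Y n \<omega>"] norm_ge_zero[of "Z n \<omega>"]
        by (simp add: min_def del: norm_ge_zero)
    qed (intro Bochner_Integration.integrable_add integrable_min_norm m m')+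
    then show "\<forall>\<^sub>F n in sequentially. expectation (\<lambda>\<omega>. min 1 (norm (Y n \<omega> + Z n \<omega>))) \<le>
       expectation (\<lambda>\<omega>. min 1 (norm (Y n \<omega>))) + expectation (\<lambda>\<omega>. min 1 (norm (Z n \<omega>)))" by simp
  qed
qed

lemma null_in_prob_0: "null_in_prob M (\<lambda>n \<omega>. 0)"
  by (simp add: null_in_prob_def)

lemma null_in_prob_sum:
  fixes Z :: "'i \<Rightarrow> nat \<Rightarrow> 'a \<Rightarrow> 'b::{second_countable_topology,real_normed_vector}"
  assumes "\<And>i. i \<in> I \<Longrightarrow> null_in_prob M (Z i)"
  shows "null_in_prob M (\<lambda>n \<omega>. \<Sum>i\<in>I. Z i n \<omega>)"
  using assms
proof (induction I rule: infinite_finite_induct)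
  case (insert i I)
  then show ?case using null_in_prob_add[of "Z i"] by simp
qed (simp_all add: null_in_prob_0)

lemma null_in_prob_bounded_linear:
  fixes Z :: "nat \<Rightarrow> 'a \<Rightarrow> 'b::{second_countable_topology,real_normed_vector}"
    and f :: "'b \<Rightarrow> 'c::{second_countable_topology,real_normed_vector}"
  assumes Z: "null_in_prob M Z" and f: "bounded_linear f"
  shows "null_in_prob M (\<lambda>n \<omega>. f (Z n \<omega>))"
proof -
  obtain K where K: "\<And>x. norm (f x) \<le> norm x * K"
    using bounded_linear.bounded[OF f] by blast
  have [measurable]: "f \<in> borel_measurable borel"
    by (intro borel_measurable_continuous_onI linear_continuous_on f)
  have [measurable]: "Z n \<in> borel_measurable M" for n
    using Z by (auto simp: null_in_prob_def)
  show ?thesis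
    by (rule null_in_prob_dominated[OF _ Z, where C=K]) (use K in \<open>auto simp: mult.commute\<close>)
qed

lemma null_in_prob_diff:
  fixes Y Z :: "nat \<Rightarrow> 'a \<Rightarrow> 'b::{second_countable_topology,real_normed_vector}"
  assumes Y: "null_in_prob M Y" and Z: "null_in_prob M Z"
  shows "null_in_prob M (\<lambda>n \<omega>. Y n \<omega> - Z n \<omega>)"
  using null_in_prob_add[OF Y null_in_prob_bounded_linear[OF Z bounded_linear_minus[OF bounded_linear_ident]]]
  by simp

lemma null_in_prob_subseq:
  assumes "null_in_prob M Z" and "filterlim f sequentially sequentially"
  shows "null_in_prob M (\<lambda>n. Z (f n))"
  using assms by (auto simp: null_in_prob_def intro: filterlim_compose)

lemma null_in_prob_AE:
  fixes Z :: "nat \<Rightarrow> 'a \<Rightarrow> 'b::{second_countable_topology,real_normed_vector}"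
  assumes meas: "\<And>n. Z n \<in> borel_measurable M"
    and lim: "AE \<omega> in M. (\<lambda>n. Z n \<omega>) \<longlonglongrightarrow> 0"
  shows "null_in_prob M Z"
  unfolding null_in_prob_def
proof (intro conjI allI meas)
  note [measurable] = meas
  have "(\<lambda>n. expectation (\<lambda>\<omega>. min 1 (norm (Z n \<omega>)))) \<longlonglongrightarrow> expectation (\<lambda>\<omega>. 0)"
  proof (rule integral_dominated_convergence[where w="\<lambda>_. 1"])
    show "AE \<omega> in M. (\<lambda>n. min 1 (norm (Z n \<omega>))) \<longlonglongrightarrow> 0"
      using lim
    proof eventually_elim
      case (elim \<omega>)
      then have "(\<lambda>n. min 1 (norm (Z n \<omega>))) \<longlonglongrightarrow> min 1 (norm (0::'b))"
        by (intro tendsto_intros)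
      then show ?case by simp
    qed
  qed auto
  then show "(\<lambda>n. expectation (\<lambda>\<omega>. min 1 (norm (Z n \<omega>)))) \<longlonglongrightarrow> 0" by simp
qed

lemma null_in_prob_L2:
  fixes Z :: "nat \<Rightarrow> 'a \<Rightarrow> 'b::{second_countable_topology,real_normed_vector}"
  assumes meas: "\<And>n. Z n \<in> borel_measurable M"
    and int: "\<And>n. integrable M (\<lambda>\<omega>. (norm (Z n \<omega>))\<^sup>2)"
    and le: "\<And>n. expectation (\<lambda>\<omega>. (norm (Z n \<omega>))\<^sup>2) \<le> b n" and b: "b \<longlonglongrightarrow> 0"
  shows "null_in_prob M Z"
proof (rule null_in_probI_bad[OF meas])
  fix \<eta> :: real assume "\<eta> > 0"
  have "\<forall>\<^sub>F n in sequentially. b n < \<eta>\<^sup>2"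
    using b \<open>\<eta> > 0\<close> by (intro order_tendstoD(2)[OF b]) auto
  then show "\<forall>\<^sub>F n in sequentially. \<exists>E U. E \<in> events \<and> prob E \<le> \<eta> \<and> integrable M U \<and>
     expectation U \<le> \<eta> \<and> (AE \<omega> in M. 0 \<le> U \<omega>) \<and> (AE \<omega> in M. \<omega> \<notin> E \<longrightarrow> norm (Z n \<omega>) \<le> U \<omega>)"
  proof eventually_elim
    case (elim n)
    \<comment> \<open>The inequality of arithmetic and geometric means, z <= (\<eta> + z^2 / \<eta>)
      / 2, replaces Chebyshev: the mean of this bound is at most \<eta> as soon as the second moment
      is below the square of \<eta>, and the bad event can be empty.\<close>
    let ?U = "\<lambda>\<omega>. (\<eta> + (norm (Z n \<omega>))\<^sup>2 / \<eta>) / 2"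
    have "expectation ?U = (\<eta> + expectation (\<lambda>\<omega>. (norm (Z n \<omega>))\<^sup>2) / \<eta>) / 2"
      using int[of n] by (simp add: prob_space)
    also have "\<dots> \<le> \<eta>"
    proof -
      have "expectation (\<lambda>\<omega>. (norm (Z n \<omega>))\<^sup>2) / \<eta> \<le> \<eta>\<^sup>2 / \<eta>"
        using elim le[of n] \<open>\<eta> > 0\<close> by (intro divide_right_mono) auto
      then show ?thesis using \<open>\<eta> > 0\<close> by (simp add: power2_eq_square)
    qed
    finally have 1: "expectation ?U \<le> \<eta>" .
    have 2: "z \<le> (\<eta> + z\<^sup>2 / \<eta>) / 2" for z :: real
    proof -
      have "0 \<le> (z - \<eta>)\<^sup>2" by simp
      then have "2 * z * \<eta> \<le> \<eta>\<^sup>2 + z\<^sup>2" by (simp add: power2_diff)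
      then show ?thesis using \<open>\<eta> > 0\<close> by (simp add: field_simps power2_eq_square)
    qed
    show ?case
      by (rule exI[of _ "{}"], rule exI[of _ ?U]) (use 1 2 int[of n] \<open>\<eta> > 0\<close> in auto)
  qed
qed


lemma null_in_prob_tail:
  fixes Z :: "nat \<Rightarrow> 'a \<Rightarrow> 'b::{second_countable_topology,real_normed_vector}"
  assumes Z: "null_in_prob M Z" and e: "e > 0"
  shows "(\<lambda>n. prob {\<omega>\<in>space M. e < norm (Z n \<omega>)}) \<longlonglongrightarrow> 0"
proof -
  have [measurable]: "Z n \<in> borel_measurable M" for n
    using Z by (auto simp: null_in_prob_def)
  \<comment> \<open>Markov's inequality is applied at a level at most 1, because the truncated norm
    never exceeds 1.\<close>
  define d where "d = min 1 e"
  have d: "d > 0" "d \<le> 1" "d \<le> e" using e by (auto simp: d_def)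
  have "(\<lambda>n. expectation (\<lambda>\<omega>. min 1 (norm (Z n \<omega>))) / d) \<longlonglongrightarrow> 0 / d"
    using Z d by (intro tendsto_intros) (auto simp: null_in_prob_def)
  then have lim: "(\<lambda>n. expectation (\<lambda>\<omega>. min 1 (norm (Z n \<omega>))) / d) \<longlonglongrightarrow> 0" by simp
  show ?thesis
  proof (rule tendsto_sandwich[OF _ _ tendsto_const lim])
    have "prob {\<omega>\<in>space M. e < norm (Z n \<omega>)} \<le> expectation (\<lambda>\<omega>. min 1 (norm (Z n \<omega>))) / d" for n
    proof -
      have "expectation (\<lambda>\<omega>. d * indicator {\<omega>\<in>space M. e < norm (Z n \<omega>)} \<omega>) \<le> expectation (\<lambda>\<omega>. min 1 (norm (Z n \<omega>)))"
        by (intro integral_mono integrable_min_norm integrable_mult_right integrable_real_indicator)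
           (use d in \<open>auto simp: indicator_def emeasure_eq_measure\<close>)
      then show ?thesis using d by (simp add: field_simps)
    qed
    then show "\<forall>\<^sub>F n in sequentially. prob {\<omega>\<in>space M. e < norm (Z n \<omega>)}
        \<le> expectation (\<lambda>\<omega>. min 1 (norm (Z n \<omega>))) / d" by simp
  qed simp
qed

lemma null_in_probI_tail:
  fixes Z :: "nat \<Rightarrow> 'a \<Rightarrow> 'b::{second_countable_topology,real_normed_vector}"
  assumes meas: "\<And>n. Z n \<in> borel_measurable M"
    and lim: "\<And>e. e > 0 \<Longrightarrow> (\<lambda>n. prob {\<omega>\<in>space M. e < norm (Z n \<omega>)}) \<longlonglongrightarrow> 0"
  shows "null_in_prob M Z"
proof (rule null_in_probI_bad[OF meas])
  note [measurable] = meas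
  fix \<eta> :: real assume "\<eta> > 0"
  from order_tendstoD(2)[OF lim[OF this] this]
  show "\<forall>\<^sub>F n in sequentially. \<exists>E U. E \<in> events \<and> prob E \<le> \<eta> \<and> integrable M U \<and>
     expectation U \<le> \<eta> \<and> (AE \<omega> in M. 0 \<le> U \<omega>) \<and> (AE \<omega> in M. \<omega> \<notin> E \<longrightarrow> norm (Z n \<omega>) \<le> U \<omega>)"
  proof eventually_elim
    case (elim n)
    show ?case
      by (rule exI[of _ "{\<omega>\<in>space M. \<eta> < norm (Z n \<omega>)}"], rule exI[of _ "\<lambda>_. \<eta>"])
        (use elim \<open>\<eta> > 0\<close> in \<open>auto simp: prob_space\<close>)
  qed
qed

section \<open>Sequences bounded in probability\<close>

definition tight_seq :: "(nat \<Rightarrow> 'a \<Rightarrow> real) \<Rightarrow> bool" where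
  "tight_seq Y \<longleftrightarrow> (\<forall>n. Y n \<in> borel_measurable M) \<and>
     (\<forall>\<eta>>0. \<exists>c. \<forall>n. prob {\<omega>\<in>space M. c < \<bar>Y n \<omega>\<bar>} \<le> \<eta>)"

lemma tight_seqD:
  assumes "tight_seq Y" "\<eta> > 0"
  obtains c where "c > 0" "\<And>n. prob {\<omega>\<in>space M. c < \<bar>Y n \<omega>\<bar>} \<le> \<eta>"
proof -
  have [measurable]: "Y n \<in> borel_measurable M" for n
    using assms by (auto simp: tight_seq_def)
  obtain c where c: "\<And>n. prob {\<omega>\<in>space M. c < \<bar>Y n \<omega>\<bar>} \<le> \<eta>"
    using assms unfolding tight_seq_def by blast
  have "prob {\<omega>\<in>space M. max c 1 < \<bar>Y n \<omega>\<bar>} \<le> prob {\<omega>\<in>space M. c < \<bar>Y n \<omega>\<bar>}" for n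
    by (rule finite_measure_mono) auto
  with c have "\<And>n. prob {\<omega>\<in>space M. max c 1 < \<bar>Y n \<omega>\<bar>} \<le> \<eta>" by (meson order_trans)
  then show ?thesis by (intro that[of "max c 1"]) auto
qed

lemma prob_abs_gt_tendsto_0:
  assumes [measurable]: "Y \<in> borel_measurable M"
  shows "(\<lambda>c. prob {\<omega>\<in>space M. \<bar>Y \<omega>\<bar> > real c}) \<longlonglongrightarrow> 0"
proof -
  have Ylim: "(\<lambda>c. prob {\<omega>\<in>space M. \<bar>Y \<omega>\<bar> > real c}) \<longlonglongrightarrow> prob (\<Inter>c. {\<omega>\<in>space M. \<bar>Y \<omega>\<bar> > real c})"
    by (intro finite_Lim_measure_decseq) (auto simp: decseq_def)
  have "(\<Inter>c. {\<omega>\<in>space M. \<bar>Y \<omega>\<bar> > real c}) = {}"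
    by (auto simp: set_eq_iff not_less real_arch_simple)
  with Ylim show ?thesis by simp
qed

text \<open>Markov's inequality for U outside the event E. Unlike in
  \<open>null_in_probI_bad\<close>, the event is the same for all n, and only the dominating
  variable U varies with n.\<close>

lemma tight_seqI_bad:
  assumes meas: "\<And>n. Y n \<in> borel_measurable M"
    and bad: "\<And>\<eta>. \<eta> > 0 \<Longrightarrow> \<exists>E K. E \<in> events \<and> prob E \<le> \<eta> \<and>
        (\<forall>n. \<exists>U. integrable M U \<and> expectation U \<le> K \<and> (AE \<omega> in M. 0 \<le> U \<omega>) \<and>
        (AE \<omega> in M. \<omega> \<notin> E \<longrightarrow> \<bar>Y n \<omega>\<bar> \<le> U \<omega>))"
  shows "tight_seq Y"
  unfolding tight_seq_def
proof (intro conjI allI meas impI)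
  note [measurable] = meas
  fix \<eta> :: real assume "\<eta> > 0"
  then have "\<eta> / 2 > 0" by simp
  from bad[OF this] obtain E K where EK: "E \<in> events" "prob E \<le> \<eta> / 2"
    "\<And>n. \<exists>U. integrable M U \<and> expectation U \<le> K \<and> (AE \<omega> in M. 0 \<le> U \<omega>) \<and>
        (AE \<omega> in M. \<omega> \<notin> E \<longrightarrow> \<bar>Y n \<omega>\<bar> \<le> U \<omega>)" by blast
  \<comment> \<open>Markov bounds the probability of U > c by K / c, which is at most \<eta> / 2 for
    this c; the maximum with 1 keeps c positive.\<close>
  define c where "c = 2 * max K 1 / \<eta>"
  have c: "c > 0" using \<open>\<eta> > 0\<close> by (auto simp: c_def)
  have "prob {\<omega>\<in>space M. c < \<bar>Y n \<omega>\<bar>} \<le> \<eta>" for n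
  proof -
    obtain U where U: "integrable M U" "expectation U \<le> K" "AE \<omega> in M. 0 \<le> U \<omega>"
        "AE \<omega> in M. \<omega> \<notin> E \<longrightarrow> \<bar>Y n \<omega>\<bar> \<le> U \<omega>" using EK(3) by blast
    have "c * prob {\<omega>\<in>space M. c < \<bar>Y n \<omega>\<bar>} = expectation (\<lambda>\<omega>. c * indicator {\<omega>\<in>space M. c < \<bar>Y n \<omega>\<bar>} \<omega>)"
      by simp
    also have "\<dots> \<le> expectation (\<lambda>\<omega>. c * indicator E \<omega> + U \<omega>)"
    proof (rule integral_mono_AE)
      show "AE \<omega> in M. c * indicator {\<omega>\<in>space M. c < \<bar>Y n \<omega>\<bar>} \<omega> \<le> c * indicator E \<omega> + U \<omega>"
        using U(3,4) by eventually_elim (use c in \<open>auto simp: indicator_def\<close>)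
    qed (use U EK in \<open>auto simp: emeasure_eq_measure\<close>)
    also have "\<dots> = c * prob E + expectation U"
      using U EK by (subst Bochner_Integration.integral_add) (auto simp: emeasure_eq_measure)
    also have "\<dots> \<le> c * (\<eta> / 2) + c * (\<eta> / 2)"
    proof (rule add_mono)
      show "c * prob E \<le> c * (\<eta> / 2)" using c EK by (intro mult_left_mono) auto
      have "c * (\<eta> / 2) = max K 1" using \<open>\<eta> > 0\<close> by (simp add: c_def)
      then show "expectation U \<le> c * (\<eta> / 2)" using U by linarith
    qed
    finally have "c * prob {\<omega>\<in>space M. c < \<bar>Y n \<omega>\<bar>} \<le> c * \<eta>" by (simp add: algebra_simps)
    then show ?thesis using c by simp
  qed
  then show "\<exists>c. \<forall>n. prob {\<omega>\<in>space M. c < \<bar>Y n \<omega>\<bar>} \<le> \<eta>" by blast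
qed

lemma tight_seq_const:
  assumes [measurable]: "Y \<in> borel_measurable M"
  shows "tight_seq (\<lambda>_. Y)"
  unfolding tight_seq_def
proof (intro conjI allI impI)
  fix \<eta> :: real assume "\<eta> > 0"
  from order_tendstoD(2)[OF prob_abs_gt_tendsto_0[OF assms] this] obtain c :: nat where
    "prob {\<omega>\<in>space M. real c < \<bar>Y \<omega>\<bar>} < \<eta>" by (auto simp: eventually_sequentially)
  then show "\<exists>c. \<forall>n::nat. prob {\<omega>\<in>space M. c < \<bar>Y \<omega>\<bar>} \<le> \<eta>" by (auto intro!: exI[of _ "real c"])
qed simp

lemma tight_seq_dominated:
  assumes meas: "\<And>n. Y n \<in> borel_measurable M" and Z: "tight_seq Z"
    and le: "\<And>n. AE \<omega> in M. \<bar>Y n \<omega>\<bar> \<le> \<bar>Z n \<omega>\<bar>"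
  shows "tight_seq Y"
  unfolding tight_seq_def
proof (intro conjI allI meas impI)
  note [measurable] = meas
  have [measurable]: "Z n \<in> borel_measurable M" for n
    using Z by (auto simp: tight_seq_def)
  fix \<eta> :: real assume "\<eta> > 0"
  from tight_seqD[OF Z this] obtain c where c: "\<And>n. prob {\<omega>\<in>space M. c < \<bar>Z n \<omega>\<bar>} \<le> \<eta>" by metis
  have "prob {\<omega>\<in>space M. c < \<bar>Y n \<omega>\<bar>} \<le> prob {\<omega>\<in>space M. c < \<bar>Z n \<omega>\<bar>}" for n
    by (rule finite_measure_mono_AE) (use le[of n] in \<open>auto elim!: eventually_mono\<close>)
  with c show "\<exists>c. \<forall>n. prob {\<omega>\<in>space M. c < \<bar>Y n \<omega>\<bar>} \<le> \<eta>" by (meson order_trans)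
qed

lemma tight_seq_add:
  assumes Y: "tight_seq Y" and Z: "tight_seq Z"
  shows "tight_seq (\<lambda>n \<omega>. Y n \<omega> + Z n \<omega>)"
  unfolding tight_seq_def
proof (intro conjI allI impI)
  have [measurable]: "Z n \<in> borel_measurable M" "Y n \<in> borel_measurable M" for n
    using Y Z by (auto simp: tight_seq_def)
  show "(\<lambda>\<omega>. Y n \<omega> + Z n \<omega>) \<in> borel_measurable M" for n by measurable
  fix \<eta> :: real assume "\<eta> > 0"
  then have \<eta>: "\<eta> / 2 > 0" by simp
  from tight_seqD[OF Y \<eta>] obtain c where c: "\<And>n. prob {\<omega>\<in>space M. c < \<bar>Y n \<omega>\<bar>} \<le> \<eta> / 2" by metis
  from tight_seqD[OF Z \<eta>] obtain d where d: "\<And>n. prob {\<omega>\<in>space M. d < \<bar>Z n \<omega>\<bar>} \<le> \<eta> / 2" by metis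
  have "prob {\<omega>\<in>space M. c + d < \<bar>Y n \<omega> + Z n \<omega>\<bar>} \<le> \<eta>" for n
  proof -
    have "prob {\<omega>\<in>space M. c + d < \<bar>Y n \<omega> + Z n \<omega>\<bar>}
       \<le> prob ({\<omega>\<in>space M. c < \<bar>Y n \<omega>\<bar>} \<union> {\<omega>\<in>space M. d < \<bar>Z n \<omega>\<bar>})"
      by (rule finite_measure_mono) auto
    also have "\<dots> \<le> prob {\<omega>\<in>space M. c < \<bar>Y n \<omega>\<bar>} + prob {\<omega>\<in>space M. d < \<bar>Z n \<omega>\<bar>}"
      by (rule measure_Un_le) auto
    also have "\<dots> \<le> \<eta>" using c[of n] d[of n] by simp
    finally show ?thesis .
  qed
  then show "\<exists>c. \<forall>n. prob {\<omega>\<in>space M. c < \<bar>Y n \<omega> + Z n \<omega>\<bar>} \<le> \<eta>" by blast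
qed

lemma tight_seq_cmult:
  assumes Y: "tight_seq Y"
  shows "tight_seq (\<lambda>n \<omega>. a * Y n \<omega>)"
  unfolding tight_seq_def
proof (intro conjI allI impI)
  have [measurable]: "Y n \<in> borel_measurable M" for n
    using Y by (auto simp: tight_seq_def)
  show "(\<lambda>\<omega>. a * Y n \<omega>) \<in> borel_measurable M" for n by measurable
  fix \<eta> :: real assume "\<eta> > 0"
  from tight_seqD[OF Y this] obtain c where c: "c > 0" "\<And>n. prob {\<omega>\<in>space M. c < \<bar>Y n \<omega>\<bar>} \<le> \<eta>" by metis
  have "prob {\<omega>\<in>space M. \<bar>a\<bar> * c < \<bar>a * Y n \<omega>\<bar>} \<le> prob {\<omega>\<in>space M. c < \<bar>Y n \<omega>\<bar>}" for n
    by (rule finite_measure_mono) (auto simp: abs_mult mult_less_cancel_left)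
  with c(2) show "\<exists>c. \<forall>n. prob {\<omega>\<in>space M. c < \<bar>a * Y n \<omega>\<bar>} \<le> \<eta>" by (meson order_trans)
qed

lemma tight_seq_sum:
  assumes "\<And>i. i \<in> I \<Longrightarrow> tight_seq (Y i)"
  shows "tight_seq (\<lambda>n \<omega>. \<Sum>i\<in>I. Y i n \<omega>)"
  using assms
proof (induction I rule: infinite_finite_induct)
  case (insert i I)
  then show ?case using tight_seq_add[of "Y i"] by simp
qed (simp_all add: tight_seq_const)

text \<open>Outside an event of small probability the two factors are at most c and \<eta> / c, so
  the product is at most \<eta>.\<close>

lemma null_in_prob_mult_tight:
  fixes Z :: "nat \<Rightarrow> 'a \<Rightarrow> 'b::{second_countable_topology,real_normed_vector}"
  assumes Z: "null_in_prob M Z" and Y: "tight_seq Y"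
  shows "null_in_prob M (\<lambda>n \<omega>. Y n \<omega> *\<^sub>R Z n \<omega>)"
proof -
  have [measurable]: "Z n \<in> borel_measurable M" "Y n \<in> borel_measurable M" for n
    using Z Y by (auto simp: null_in_prob_def tight_seq_def)
  have meas: "(\<lambda>\<omega>. Y n \<omega> *\<^sub>R Z n \<omega>) \<in> borel_measurable M" for n by measurable
  show ?thesis
  proof (rule null_in_probI_bad[OF meas])
    fix \<eta> :: real assume "\<eta> > 0"
    then have \<eta>2: "\<eta> / 2 > 0" by simp
    from tight_seqD[OF Y this] obtain c where c: "c > 0"
      "\<And>n. prob {\<omega>\<in>space M. c < \<bar>Y n \<omega>\<bar>} \<le> \<eta> / 2" by metis
    have "\<eta> / c > 0" using \<open>\<eta> > 0\<close> c by simp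
    from order_tendstoD(2)[OF null_in_prob_tail[OF Z this] \<eta>2]
    show "\<forall>\<^sub>F n in sequentially. \<exists>E U. E \<in> events \<and> prob E \<le> \<eta> \<and> integrable M U \<and>
       expectation U \<le> \<eta> \<and> (AE \<omega> in M. 0 \<le> U \<omega>) \<and> (AE \<omega> in M. \<omega> \<notin> E \<longrightarrow> norm (Y n \<omega> *\<^sub>R Z n \<omega>) \<le> U \<omega>)"
    proof eventually_elim
      case (elim n)
      define E where "E = {\<omega>\<in>space M. c < \<bar>Y n \<omega>\<bar>} \<union> {\<omega>\<in>space M. \<eta> / c < norm (Z n \<omega>)}"
      have [measurable]: "E \<in> events" unfolding E_def by measurable
      have "prob E \<le> prob {\<omega>\<in>space M. c < \<bar>Y n \<omega>\<bar>} + prob {\<omega>\<in>space M. \<eta> / c < norm (Z n \<omega>)}"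
        unfolding E_def by (rule measure_Un_le) auto
      also have "\<dots> \<le> \<eta>" using elim c(2)[of n] by simp
      finally have 1: "prob E \<le> \<eta>" .
      have 2: "norm (Y n \<omega> *\<^sub>R Z n \<omega>) \<le> \<eta>" if "\<omega> \<in> space M" "\<omega> \<notin> E" for \<omega>
      proof -
        have "\<bar>Y n \<omega>\<bar> * norm (Z n \<omega>) \<le> c * (\<eta> / c)"
          using that c by (intro mult_mono) (auto simp: E_def)
        then show ?thesis using c by simp
      qed
      show ?case
        by (rule exI[of _ E], rule exI[of _ "\<lambda>_. \<eta>"]) (use 1 2 \<open>\<eta> > 0\<close> in \<open>auto simp: prob_space\<close>)
    qed
  qed
qed

text \<open>Fatou's lemma for convergence in probability. The square of R is cut at a level c, where
  convergence in probability suffices to pass to the limit in n; monotone convergence then removes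
  c. The factor 2 is the price of splitting R into \<open>Z n\<close> and the difference inside a
  square.\<close>

lemma null_in_prob_second_moment_le:
  fixes R :: "'a \<Rightarrow> 'b::{second_countable_topology,real_normed_vector}"
  assumes [measurable]: "R \<in> borel_measurable M" "\<And>n. Z n \<in> borel_measurable M"
    and null: "null_in_prob M (\<lambda>n \<omega>. R \<omega> - Z n \<omega>)"
    and Z: "\<And>n. integrable M (\<lambda>\<omega>. (norm (Z n \<omega>))\<^sup>2)"
    and b: "\<forall>\<^sub>F n in sequentially. expectation (\<lambda>\<omega>. (norm (Z n \<omega>))\<^sup>2) \<le> b"
  shows "integrable M (\<lambda>\<omega>. (norm (R \<omega>))\<^sup>2)" and "expectation (\<lambda>\<omega>. (norm (R \<omega>))\<^sup>2) \<le> 2 * b"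
proof -
  define f where "f c \<omega> = min (real c) ((norm (R \<omega>))\<^sup>2)" for c \<omega>
  have [measurable]: "f c \<in> borel_measurable M" for c unfolding f_def by measurable
  have fint: "integrable M (f c)" for c
    by (rule integrable_const_bound[where B="real c"]) (auto simp: f_def)
  have fle: "expectation (f c) \<le> 2 * b" for c
  proof -
    have lim: "(\<lambda>n. 2 * b + (real c + 2) * expectation (\<lambda>\<omega>. min 1 (norm (R \<omega> - Z n \<omega>)))) \<longlonglongrightarrow> 2 * b + (real c + 2) * 0"
      using null by (intro tendsto_intros) (auto simp: null_in_prob_def)
    have "\<forall>\<^sub>F n in sequentially. expectation (f c) \<le> 2 * b + (real c + 2) * expectation (\<lambda>\<omega>. min 1 (norm (R \<omega> - Z n \<omega>)))"
      using b
    proof eventually_elim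
      case (elim n)
      have int: "integrable M (\<lambda>\<omega>. min 1 (norm (R \<omega> - Z n \<omega>)))"
        by (rule integrable_min_norm) measurable
      \<comment> \<open>Where the difference of R and \<open>Z n\<close> has norm at most 1, its
        square is at most itself, so the coefficient 2 is enough; elsewhere the truncated distance
        equals 1 and the coefficient c alone bounds the cut square.\<close>
      have "f c \<omega> \<le> 2 * (norm (Z n \<omega>))\<^sup>2 + (real c + 2) * min 1 (norm (R \<omega> - Z n \<omega>))" for \<omega>
      proof (cases "norm (R \<omega> - Z n \<omega>) \<le> 1")
        case True
        define u v where "u = norm (Z n \<omega>)" and "v = norm (R \<omega> - Z n \<omega>)"
        have uv: "0 \<le> u" "0 \<le> v" "v \<le> 1" using True by (auto simp: u_def v_def)
        have "norm (R \<omega>) \<le> u + v"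
          unfolding u_def v_def using norm_triangle_ineq[of "Z n \<omega>" "R \<omega> - Z n \<omega>"] by simp
        then have "(norm (R \<omega>))\<^sup>2 \<le> (u + v)\<^sup>2" by (intro power_mono) auto
        also have "\<dots> \<le> 2 * u\<^sup>2 + 2 * v\<^sup>2"
          using sum_squares_bound[of u v] by (simp add: power2_sum)
        also have "v\<^sup>2 \<le> v" using uv by (simp add: power2_eq_square mult_left_le)
        also have "2 * u\<^sup>2 + 2 * v \<le> 2 * u\<^sup>2 + (real c + 2) * v"
          using uv by (simp add: algebra_simps)
        finally show ?thesis using uv by (simp add: f_def u_def v_def min_def)
      next
        case False
        then show ?thesis by (simp add: f_def min_def add_nonneg_nonneg add_increasing)
      qed
      then have "expectation (f c) \<le> expectation (\<lambda>\<omega>. 2 * (norm (Z n \<omega>))\<^sup>2 + (real c + 2) * min 1 (norm (R \<omega> - Z n \<omega>)))"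
        by (intro integral_mono fint) (use Z[of n] int in auto)
      also have "\<dots> = 2 * expectation (\<lambda>\<omega>. (norm (Z n \<omega>))\<^sup>2) + (real c + 2) * expectation (\<lambda>\<omega>. min 1 (norm (R \<omega> - Z n \<omega>)))"
        using Z[of n] int by simp
      finally show ?case using elim by simp
    qed
    from tendsto_lowerbound[OF lim this] show ?thesis by simp
  qed
  have mono: "AE \<omega> in M. mono (\<lambda>c. f c \<omega>)" by (auto simp: f_def mono_def)
  have flim: "(\<lambda>c. f c \<omega>) \<longlonglongrightarrow> (norm (R \<omega>))\<^sup>2" for \<omega>
  proof (rule tendsto_eventually)
    obtain N :: nat where "(norm (R \<omega>))\<^sup>2 \<le> real N" using real_arch_simple by blast
    then show "\<forall>\<^sub>F c in sequentially. f c \<omega> = (norm (R \<omega>))\<^sup>2"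
      by (auto simp: eventually_sequentially f_def min_def intro!: exI[of _ N])
  qed
  have conv: "convergent (\<lambda>c. expectation (f c))"
  proof (rule Bseq_monoseq_convergent)
    have mono': "incseq (\<lambda>c. expectation (f c))"
      by (rule incseq_SucI, rule integral_mono[OF fint fint]) (auto simp: f_def min_def)
    then show "monoseq (\<lambda>c. expectation (f c))" by (simp add: incseq_imp_monoseq)
    have "0 \<le> expectation (f c)" for c by (rule integral_nonneg_AE) (auto simp: f_def)
    then show "Bseq (\<lambda>c. expectation (f c))" using fle by (intro BseqI'[of _ "2 * b"]) auto
  qed
  then obtain L where L: "(\<lambda>c. expectation (f c)) \<longlonglongrightarrow> L" by (auto simp: convergent_def)
  have mc: "has_bochner_integral M (\<lambda>\<omega>. (norm (R \<omega>))\<^sup>2) L"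
    by (rule has_bochner_integral_monotone_convergence[OF fint mono _ L]) (use flim in auto)
  then show "integrable M (\<lambda>\<omega>. (norm (R \<omega>))\<^sup>2)" by (rule integrable.intros)
  have "L \<le> 2 * b" by (rule LIMSEQ_le_const2[OF L]) (use fle in auto)
  then show "expectation (\<lambda>\<omega>. (norm (R \<omega>))\<^sup>2) \<le> 2 * b"
    using has_bochner_integral_integral_eq[OF mc] by simp
qed

end

section \<open>Brownian increments\<close>

lemma abs_mult_le_squares: "\<bar>a * b\<bar> \<le> a\<^sup>2 + b\<^sup>2" for a b :: real
proof -
  have "2 * (\<bar>a\<bar> * \<bar>b\<bar>) \<le> a\<^sup>2 + b\<^sup>2"
    using sum_squares_bound[of "\<bar>a\<bar>" "\<bar>b\<bar>"] by (simp add: mult.assoc)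
  moreover have "0 \<le> \<bar>a\<bar> * \<bar>b\<bar>" by simp
  ultimately show ?thesis unfolding abs_mult by linarith
qed

context usual_filtered_prob_space
begin

lemma F_measurable_M:
  "0 \<le> s \<Longrightarrow> f \<in> measurable (F s) N \<Longrightarrow> f \<in> measurable M N"
  using F_subset[of s] space_F[of s] by (auto simp: measurable_def)

lemma F_measurable_mono:
  "s \<le> t \<Longrightarrow> f \<in> measurable (F s) N \<Longrightarrow> f \<in> measurable (F t) N"
  using sets_F_mono[of s t] space_F[of s] space_F[of t] by (auto simp: measurable_def)

end

locale brownian_setting = usual_filtered_prob_space M F
  for M :: "'a measure" and F :: "real \<Rightarrow> 'a measure" +
  fixes W :: "'l::finite \<Rightarrow> real \<Rightarrow> 'a \<Rightarrow> real"
  assumes BM: "independent_brownian_motions M F W"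
begin

lemma W_adapted: "0 \<le> t \<Longrightarrow> W j t \<in> borel_measurable (F t)"
  using BM by (auto simp: independent_brownian_motions_def brownian_motion_def adapted_def)

lemma W_measurable[measurable]: "0 \<le> t \<Longrightarrow> W j t \<in> borel_measurable M"
  using W_adapted F_measurable_M by blast

lemma W_increment_distr:
  "0 \<le> s \<Longrightarrow> s < t \<Longrightarrow> distributed M lborel (\<lambda>\<omega>. W j t \<omega> - W j s \<omega>) (normal_density 0 (sqrt (t - s)))"
  using BM by (auto simp: independent_brownian_motions_def brownian_motion_def)

text \<open>Passes from independence of sigma-algebras to independence of random variables: the
  sigma-algebra generated by U is contained in \<open>F s\<close>.\<close>

lemma W_increment_indep:
  assumes st: "0 \<le> s" "s < t" and U: "U \<in> borel_measurable (F s)"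
  shows "indep_var borel U borel (\<lambda>\<omega>. W j t \<omega> - W j s \<omega>)"
  unfolding indep_var_eq
proof (intro conjI)
  let ?D = "\<lambda>\<omega>. W j t \<omega> - W j s \<omega>"
  show "random_variable borel U" using U st F_measurable_M by blast
  show D: "random_variable borel ?D" using st by (auto intro!: borel_measurable_diff W_measurable)
  have ind: "indep_set (sets (F s)) (sets (vimage_algebra (space M) ?D borel))"
    using BM st by (auto simp: independent_brownian_motions_def brownian_motion_def)
  have 1: "sigma_sets (space M) {U -` A \<inter> space M |A. A \<in> sets borel} \<subseteq> sets (F s)"
  proof -
    have "{U -` A \<inter> space M |A. A \<in> sets borel} \<subseteq> sets (F s)"
      using measurable_sets[OF U] space_F[of s] by auto
    then show ?thesis using sets.sigma_sets_subset[of _ "F s"] space_F[of s] by auto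
  qed
  have 2: "sigma_sets (space M) {?D -` A \<inter> space M |A. A \<in> sets borel} \<subseteq> sets (vimage_algebra (space M) ?D borel)"
    unfolding sets_vimage_algebra by (rule sigma_sets_mono') auto
  show "indep_set (sigma_sets (space M) {U -` A \<inter> space M |A. A \<in> sets borel})
     (sigma_sets (space M) {?D -` A \<inter> space M |A. A \<in> sets borel})"
    using ind 1 2 unfolding indep_set_def
    by (elim indep_sets_mono_sets) (auto split: bool.split)
qed

section \<open>Moments of Brownian increments\<close>

lemma W_increment_integrable_power:
  assumes st: "0 \<le> s" "s < t"
  shows "integrable M (\<lambda>\<omega>. (W j t \<omega> - W j s \<omega>) ^ k)"
proof -
  have "0 < sqrt (t - s)" using st by simp
  from integrable_normal_moment[OF this, of 0 k]
  have "integrable lborel (\<lambda>x. normal_density 0 (sqrt (t - s)) x * x ^ k)" by simp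
  then show ?thesis
    by (subst distributed_integrable[OF W_increment_distr[OF st], symmetric]) auto
qed

lemma W_increment_expectation_power:
  assumes st: "0 \<le> s" "s < t"
  shows "expectation (\<lambda>\<omega>. (W j t \<omega> - W j s \<omega>) ^ k) = (\<integral>x. normal_density 0 (sqrt (t - s)) x * x ^ k \<partial>lborel)"
  by (subst distributed_integral[OF W_increment_distr[OF st], symmetric]) auto

lemma W_increment_moments:
  assumes st: "0 \<le> s" "s < t"
  shows "expectation (\<lambda>\<omega>. W j t \<omega> - W j s \<omega>) = 0"
    and "expectation (\<lambda>\<omega>. (W j t \<omega> - W j s \<omega>)\<^sup>2) = t - s"
    and "expectation (\<lambda>\<omega>. (W j t \<omega> - W j s \<omega>) ^ 4) = 3 * (t - s)\<^sup>2"
proof -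
  have \<sigma>: "0 < sqrt (t - s)" using st by simp
  show "expectation (\<lambda>\<omega>. W j t \<omega> - W j s \<omega>) = 0"
    using W_increment_expectation_power[OF st, of j 1] integral_normal_moment_odd[OF \<sigma>, of 0 0] by simp
  show "expectation (\<lambda>\<omega>. (W j t \<omega> - W j s \<omega>)\<^sup>2) = t - s"
    using W_increment_expectation_power[OF st, of j 2] integral_normal_moment_even[OF \<sigma>, of 0 1] st
    by (simp add: fact_numeral)
  show "expectation (\<lambda>\<omega>. (W j t \<omega> - W j s \<omega>) ^ 4) = 3 * (t - s)\<^sup>2"
    using W_increment_expectation_power[OF st, of j 4] integral_normal_moment_even[OF \<sigma>, of 0 2] st
    by (simp add: fact_numeral power_divide field_simps)
qed

lemma W_increment_mult:
  assumes st: "0 \<le> s" "s < t" and U: "U \<in> borel_measurable (F s)" and int: "integrable M U"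
  shows "integrable M (\<lambda>\<omega>. U \<omega> * (W j t \<omega> - W j s \<omega>) ^ k)"
    and "expectation (\<lambda>\<omega>. U \<omega> * (W j t \<omega> - W j s \<omega>) ^ k) = expectation U * expectation (\<lambda>\<omega>. (W j t \<omega> - W j s \<omega>) ^ k)"
proof -
  have "indep_var borel (id \<circ> U) borel ((\<lambda>x. x ^ k) \<circ> (\<lambda>\<omega>. W j t \<omega> - W j s \<omega>))"
    by (rule indep_var_compose[OF W_increment_indep[OF st U]]) auto
  then have ind: "indep_var borel U borel (\<lambda>\<omega>. (W j t \<omega> - W j s \<omega>) ^ k)"
    by (simp add: comp_def)
  show "integrable M (\<lambda>\<omega>. U \<omega> * (W j t \<omega> - W j s \<omega>) ^ k)"
    by (rule indep_var_integrable[OF ind int W_increment_integrable_power[OF st]])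
  show "expectation (\<lambda>\<omega>. U \<omega> * (W j t \<omega> - W j s \<omega>) ^ k) = expectation U * expectation (\<lambda>\<omega>. (W j t \<omega> - W j s \<omega>) ^ k)"
    by (rule indep_var_lebesgue_integral[OF ind int W_increment_integrable_power[OF st]])
qed

lemma W_increment_mult1:
  assumes st: "0 \<le> s" "s < t" and U: "U \<in> borel_measurable (F s)" and int: "integrable M U"
  shows "integrable M (\<lambda>\<omega>. U \<omega> * (W j t \<omega> - W j s \<omega>))"
    and "expectation (\<lambda>\<omega>. U \<omega> * (W j t \<omega> - W j s \<omega>)) = 0"
  using W_increment_mult[OF assms, of j 1] W_increment_moments[OF st] by auto

lemma W_increment_mult2:
  assumes st: "0 \<le> s" "s < t" and U: "U \<in> borel_measurable (F s)" and int: "integrable M U"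
  shows "integrable M (\<lambda>\<omega>. U \<omega> * (W j t \<omega> - W j s \<omega>)\<^sup>2)"
    and "expectation (\<lambda>\<omega>. U \<omega> * (W j t \<omega> - W j s \<omega>)\<^sup>2) = expectation U * (t - s)"
  using W_increment_mult[OF assms, of j 2] W_increment_moments[OF st] by auto

text \<open>Independence is given between whole paths as elements of a product space. Hence anything
  that involves several increments of one Brownian motion is written as one measurable functional
  \<open>\<phi>\<close> of its path.\<close>

lemma W_indep_product:
  assumes ij: "i \<noteq> j" and \<phi>: "\<phi> \<in> borel_measurable (\<Pi>\<^sub>M t\<in>{0..}. borel)"
    and int: "\<And>k. integrable M (\<lambda>\<omega>. \<phi> (\<lambda>t\<in>{0..}. W k t \<omega>))"
  shows "integrable M (\<lambda>\<omega>. (\<phi> (\<lambda>t\<in>{0..}. W i t \<omega>) * \<phi> (\<lambda>t\<in>{0..}. W j t \<omega>) :: real))"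
    and "expectation (\<lambda>\<omega>. \<phi> (\<lambda>t\<in>{0..}. W i t \<omega>) * \<phi> (\<lambda>t\<in>{0..}. W j t \<omega>)) =
      expectation (\<lambda>\<omega>. \<phi> (\<lambda>t\<in>{0..}. W i t \<omega>)) * expectation (\<lambda>\<omega>. \<phi> (\<lambda>t\<in>{0..}. W j t \<omega>))"
proof -
  have "indep_vars (\<lambda>_. \<Pi>\<^sub>M t\<in>{0..}. borel) (\<lambda>j \<omega>. \<lambda>t\<in>{0..}. W j t \<omega>) UNIV"
    using BM by (simp add: independent_brownian_motions_def)
  from indep_vars_compose2[OF this, of "\<lambda>_. \<phi>" "\<lambda>_. borel"] \<phi>
  have "indep_vars (\<lambda>_. borel) (\<lambda>k \<omega>. \<phi> (\<lambda>t\<in>{0..}. W k t \<omega>)) UNIV" by auto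
  then have ind: "indep_vars (\<lambda>_. borel) (\<lambda>k \<omega>. \<phi> (\<lambda>t\<in>{0..}. W k t \<omega>)) {i, j}"
    by (rule indep_vars_subset) auto
  show "integrable M (\<lambda>\<omega>. (\<phi> (\<lambda>t\<in>{0..}. W i t \<omega>) * \<phi> (\<lambda>t\<in>{0..}. W j t \<omega>) :: real))"
    using indep_vars_integrable[OF _ ind int] ij by simp
  show "expectation (\<lambda>\<omega>. \<phi> (\<lambda>t\<in>{0..}. W i t \<omega>) * \<phi> (\<lambda>t\<in>{0..}. W j t \<omega>)) =
      expectation (\<lambda>\<omega>. \<phi> (\<lambda>t\<in>{0..}. W i t \<omega>)) * expectation (\<lambda>\<omega>. \<phi> (\<lambda>t\<in>{0..}. W j t \<omega>))"
    using indep_vars_lebesgue_integral[OF _ ind int] ij by simp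
qed

text \<open>For a single Brownian motion the product of two disjoint increments already has mean
  zero, and independence of the two motions gives the product of these two zero means. Only the
  grouping of the four factors changes.\<close>

lemma W_cross_increments:
  assumes ij: "i \<noteq> j" and r: "0 \<le> r0" "r0 < r1" "r1 \<le> r2" "r2 < r3"
  shows "integrable M (\<lambda>\<omega>. ((W i r1 \<omega> - W i r0 \<omega>) * (W j r1 \<omega> - W j r0 \<omega>)) *
            ((W i r3 \<omega> - W i r2 \<omega>) * (W j r3 \<omega> - W j r2 \<omega>)))"
    and "expectation (\<lambda>\<omega>. ((W i r1 \<omega> - W i r0 \<omega>) * (W j r1 \<omega> - W j r0 \<omega>)) *
            ((W i r3 \<omega> - W i r2 \<omega>) * (W j r3 \<omega> - W j r2 \<omega>))) = 0"
proof -
  define \<phi> where "\<phi> w = (w r1 - w r0) * (w r3 - w r2)" for w :: "real \<Rightarrow> real"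
  have \<phi>m: "\<phi> \<in> borel_measurable (\<Pi>\<^sub>M t\<in>{0..}. borel)"
    unfolding \<phi>_def using r by (auto intro!: borel_measurable_diff borel_measurable_times borel_measurable_power measurable_component_singleton)
  have \<phi>W: "\<phi> (\<lambda>t\<in>{0..}. W k t \<omega>) = (W k r1 \<omega> - W k r0 \<omega>) * (W k r3 \<omega> - W k r2 \<omega>)" for k \<omega>
    using r by (simp add: \<phi>_def)
  have m: "(\<lambda>\<omega>. W k r1 \<omega> - W k r0 \<omega>) \<in> borel_measurable (F r2)" for k
  proof -
    have [measurable]: "W k r1 \<in> borel_measurable (F r2)" "W k r0 \<in> borel_measurable (F r2)"
      using r by (auto intro!: F_measurable_mono[OF _ W_adapted])
    show ?thesis by measurable
  qed
  have i1: "integrable M (\<lambda>\<omega>. W k r1 \<omega> - W k r0 \<omega>)" for k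
    using W_increment_integrable_power[of r0 r1 k 1] r by simp
  have int: "integrable M (\<lambda>\<omega>. (W k r1 \<omega> - W k r0 \<omega>) * (W k r3 \<omega> - W k r2 \<omega>))"
    and E0: "expectation (\<lambda>\<omega>. (W k r1 \<omega> - W k r0 \<omega>) * (W k r3 \<omega> - W k r2 \<omega>)) = 0" for k
    using W_increment_mult1[OF _ r(4) m i1] r by auto
  have int': "integrable M (\<lambda>\<omega>. \<phi> (\<lambda>t\<in>{0..}. W k t \<omega>))" for k
    unfolding \<phi>W by (rule int)
  show "integrable M (\<lambda>\<omega>. ((W i r1 \<omega> - W i r0 \<omega>) * (W j r1 \<omega> - W j r0 \<omega>)) *
            ((W i r3 \<omega> - W i r2 \<omega>) * (W j r3 \<omega> - W j r2 \<omega>)))"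
    using W_indep_product(1)[OF ij \<phi>m int'] unfolding \<phi>W by (simp add: mult_ac)
  show "expectation (\<lambda>\<omega>. ((W i r1 \<omega> - W i r0 \<omega>) * (W j r1 \<omega> - W j r0 \<omega>)) *
            ((W i r3 \<omega> - W i r2 \<omega>) * (W j r3 \<omega> - W j r2 \<omega>))) = 0"
    using W_indep_product(2)[OF ij \<phi>m int'] unfolding \<phi>W E0 by (simp add: mult_ac)
qed

lemma W_increments_square_product:
  assumes ij: "i \<noteq> j" and r: "0 \<le> s" "s < t"
  shows "integrable M (\<lambda>\<omega>. ((W i t \<omega> - W i s \<omega>) * (W j t \<omega> - W j s \<omega>))\<^sup>2)"
    and "expectation (\<lambda>\<omega>. ((W i t \<omega> - W i s \<omega>) * (W j t \<omega> - W j s \<omega>))\<^sup>2) = (t - s)\<^sup>2"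
proof -
  define \<phi> where "\<phi> w = (w t - w s)\<^sup>2" for w :: "real \<Rightarrow> real"
  have \<phi>m: "\<phi> \<in> borel_measurable (\<Pi>\<^sub>M t\<in>{0..}. borel)"
    unfolding \<phi>_def using r by (auto intro!: borel_measurable_diff borel_measurable_times borel_measurable_power measurable_component_singleton)
  have \<phi>W: "\<phi> (\<lambda>t\<in>{0..}. W k t \<omega>) = (W k t \<omega> - W k s \<omega>)\<^sup>2" for k \<omega>
    using r by (simp add: \<phi>_def)
  have int': "integrable M (\<lambda>\<omega>. \<phi> (\<lambda>t\<in>{0..}. W k t \<omega>))" for k
    unfolding \<phi>W using W_increment_integrable_power[OF r] .
  show "integrable M (\<lambda>\<omega>. ((W i t \<omega> - W i s \<omega>) * (W j t \<omega> - W j s \<omega>))\<^sup>2)"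
    using W_indep_product(1)[OF ij \<phi>m int'] unfolding \<phi>W by (simp add: power_mult_distrib)
  show "expectation (\<lambda>\<omega>. ((W i t \<omega> - W i s \<omega>) * (W j t \<omega> - W j s \<omega>))\<^sup>2) = (t - s)\<^sup>2"
    using W_indep_product(2)[OF ij \<phi>m int'] unfolding \<phi>W W_increment_moments(2)[OF r]
    by (simp add: power_mult_distrib power2_eq_square[of "t - s"])
qed

lemma integrable_W_increment_prod:
  assumes st: "0 \<le> s" "s < t" and U: "U \<in> borel_measurable (F s)" and int: "integrable M U"
  shows "integrable M (\<lambda>\<omega>. U \<omega> * ((W i t \<omega> - W i s \<omega>) * (W j t \<omega> - W j s \<omega>)))"
proof -
  have [measurable]: "U \<in> borel_measurable M" using int by auto
  have [measurable]: "W k s \<in> borel_measurable M" "W k t \<in> borel_measurable M" for k using st by auto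
  have "integrable M (\<lambda>\<omega>. U \<omega> * (W i t \<omega> - W i s \<omega>)\<^sup>2 + U \<omega> * (W j t \<omega> - W j s \<omega>)\<^sup>2)"
    using W_increment_mult2(1)[OF assms] by auto
  then show ?thesis
  proof (rule Bochner_Integration.integrable_bound)
    have "\<bar>U \<omega>\<bar> * \<bar>(W i t \<omega> - W i s \<omega>) * (W j t \<omega> - W j s \<omega>)\<bar> \<le> \<bar>U \<omega>\<bar> * ((W i t \<omega> - W i s \<omega>)\<^sup>2 + (W j t \<omega> - W j s \<omega>)\<^sup>2)" for \<omega>
      by (intro mult_left_mono abs_mult_le_squares) auto
    moreover have "\<bar>U \<omega> * (W i t \<omega> - W i s \<omega>)\<^sup>2 + U \<omega> * (W j t \<omega> - W j s \<omega>)\<^sup>2\<bar> =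
       \<bar>U \<omega>\<bar> * ((W i t \<omega> - W i s \<omega>)\<^sup>2 + (W j t \<omega> - W j s \<omega>)\<^sup>2)" for \<omega>
      by (simp add: distrib_left[symmetric] abs_mult)
    ultimately show "AE \<omega> in M. norm (U \<omega> * ((W i t \<omega> - W i s \<omega>) * (W j t \<omega> - W j s \<omega>)))
       \<le> norm (U \<omega> * (W i t \<omega> - W i s \<omega>)\<^sup>2 + U \<omega> * (W j t \<omega> - W j s \<omega>)\<^sup>2)"
      by (auto simp: abs_mult)
  qed measurable
qed

text \<open>\<open>U\<close> is independent of the increment of either motion, but its independence
  of the pair of increments is not among the assumptions. The interval is therefore split into N
  pieces. In the telescoped product the mixed terms vanish, because a single increment is orthogonal
  to the past, and what remains are the products of increments over the same piece. Those are
  orthogonal to each other, with total second moment (t - s)^2 / N, so the expectation is O(1 / sqrt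
  N) for every N and hence zero.\<close>

lemma W_increment_cross_bounded:
  assumes ij: "i \<noteq> j" and st: "0 \<le> s" "s < t" and U: "U \<in> borel_measurable (F s)"
    and bd: "\<And>\<omega>. \<bar>U \<omega>\<bar> \<le> c"
  shows "expectation (\<lambda>\<omega>. U \<omega> * ((W i t \<omega> - W i s \<omega>) * (W j t \<omega> - W j s \<omega>))) = 0"
proof -
  define e where "e = expectation (\<lambda>\<omega>. U \<omega> * ((W i t \<omega> - W i s \<omega>) * (W j t \<omega> - W j s \<omega>)))"
  have Um[measurable]: "U \<in> borel_measurable M" using U F_measurable_M st by blast
  have c: "c \<ge> 0" using bd[of undefined] by linarith
  have main: "\<bar>e\<bar> \<le> c * (1 + (t - s)\<^sup>2) / sqrt (real N)" if N: "N > 0" for N :: nat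
  proof -
    define r where "r l = s + (t - s) * real l / real N" for l
    have r0: "r 0 = s" and rN: "r N = t" using N by (auto simp: r_def)
    have rS: "r (Suc l) - r l = (t - s) / real N" for l
      using N by (simp add: r_def field_simps)
    have rlt: "r l < r (Suc l)" for l
      proof -
      have "(t - s) / real N > 0" using st N by simp
      then show ?thesis using rS[of l] by linarith
    qed
    have rmono: "r l \<le> r k" if "l \<le> k" for l k
      using that rlt by (simp add: lift_Suc_mono_le less_imp_le)
    have rge: "s \<le> r l" for l using rmono[of 0 l] r0 by simp
    have rpos: "0 \<le> r l" for l using rge[of l] st by simp
    define da where "da k l \<omega> = W k (r (Suc l)) \<omega> - W k (r l) \<omega>" for k l \<omega>
    have dam[measurable]: "da k l \<in> borel_measurable M" for k l
      unfolding da_def using rpos by measurable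
    define S where "S k \<omega> = (\<Sum>l<k. da i l \<omega> * da j l \<omega>)" for k \<omega>
    have Sm[measurable]: "S k \<in> borel_measurable M" for k unfolding S_def by measurable
    have dd: "integrable M (\<lambda>\<omega>. (da i l \<omega> * da j l \<omega>)\<^sup>2)"
      "expectation (\<lambda>\<omega>. (da i l \<omega> * da j l \<omega>)\<^sup>2) = ((t - s) / real N)\<^sup>2" for l
      unfolding da_def using W_increments_square_product[OF ij rpos rlt, of l] by (auto simp: rS)
    have Sint: "integrable M (\<lambda>\<omega>. (S k \<omega>)\<^sup>2) \<and> expectation (\<lambda>\<omega>. (S k \<omega>)\<^sup>2) = real k * ((t - s) / real N)\<^sup>2" for k
    proof (induction k)
      case 0 then show ?case by (simp add: S_def)
    next
      case (Suc k)
      have x: "integrable M (\<lambda>\<omega>. S k \<omega> * (da i k \<omega> * da j k \<omega>))"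
        "expectation (\<lambda>\<omega>. S k \<omega> * (da i k \<omega> * da j k \<omega>)) = 0"
      proof -
        have z: "integrable M (\<lambda>\<omega>. da i l \<omega> * da j l \<omega> * (da i k \<omega> * da j k \<omega>))"
          "expectation (\<lambda>\<omega>. da i l \<omega> * da j l \<omega> * (da i k \<omega> * da j k \<omega>)) = 0" if "l < k" for l
          unfolding da_def using W_cross_increments[OF ij rpos rlt rmono rlt, of l k] that by auto
        show "integrable M (\<lambda>\<omega>. S k \<omega> * (da i k \<omega> * da j k \<omega>))"
          unfolding S_def sum_distrib_right by (intro Bochner_Integration.integrable_sum z) auto
        show "expectation (\<lambda>\<omega>. S k \<omega> * (da i k \<omega> * da j k \<omega>)) = 0"
          unfolding S_def sum_distrib_right
          by (subst Bochner_Integration.integral_sum) (auto intro: z simp: z)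
      qed
      have eq: "(S (Suc k) \<omega>)\<^sup>2 = (S k \<omega>)\<^sup>2 + 2 * (S k \<omega> * (da i k \<omega> * da j k \<omega>)) + (da i k \<omega> * da j k \<omega>)\<^sup>2" for \<omega>
        by (simp add: S_def power2_sum)
      show ?case
        unfolding eq using Suc x dd[of k] by (simp add: algebra_simps)
    qed
    have SN: "expectation (\<lambda>\<omega>. \<bar>S N \<omega>\<bar>) \<le> (1 + (t - s)\<^sup>2) / sqrt (real N)"
    proof -
      have sq: "sqrt (real N) > 0" using N by simp
      have "expectation (\<lambda>\<omega>. \<bar>S N \<omega>\<bar>) \<le> expectation (\<lambda>\<omega>. 1 / sqrt (real N) + sqrt (real N) * (S N \<omega>)\<^sup>2)"
      proof (rule integral_mono_AE)
        \<comment> \<open>The weight sqrt N balances the two summands, since the second moment of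
          \<open>S N\<close> is of order 1 / N.\<close>
        have "\<bar>z\<bar> \<le> 1 / sqrt (real N) + sqrt (real N) * z\<^sup>2" for z
        proof -
          define q where "q = sqrt (real N)"
          have "q > 0" using sq by (simp add: q_def)
          have "2 * (q * \<bar>z\<bar>) \<le> 1 + (q * \<bar>z\<bar>)\<^sup>2" using sum_squares_bound[of 1 "q * \<bar>z\<bar>"] by simp
          moreover have "0 \<le> q * \<bar>z\<bar>" using \<open>q > 0\<close> by simp
          ultimately have "q * \<bar>z\<bar> \<le> 1 + (q * \<bar>z\<bar>)\<^sup>2" by linarith
          then have "\<bar>z\<bar> \<le> 1 / q + q * z\<^sup>2" using \<open>q > 0\<close>
            by (simp add: field_simps power2_eq_square)
          then show ?thesis by (simp add: q_def)
        qed
        then show "AE \<omega> in M. \<bar>S N \<omega>\<bar> \<le> 1 / sqrt (real N) + sqrt (real N) * (S N \<omega>)\<^sup>2" by simp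
        show "integrable M (\<lambda>\<omega>. \<bar>S N \<omega>\<bar>)"
          using Sint[of N] square_integrable_imp_integrable[OF Sm, of N] by auto
      qed (use Sint[of N] in auto)
      also have "\<dots> = 1 / sqrt (real N) + sqrt (real N) * (real N * ((t - s) / real N)\<^sup>2)"
        using Sint[of N] by (simp add: prob_space)
      also have "\<dots> = (1 + (t - s)\<^sup>2) / sqrt (real N)"
      proof -
        have "sqrt (real N) * sqrt (real N) = real N" by simp
        then show ?thesis using N sq by (simp add: field_simps power2_eq_square)
      qed
      finally show ?thesis .
    qed
    have Wm: "W k (r l) \<in> borel_measurable (F (r l'))" if "l \<le> l'" for k l l'
      using F_measurable_mono[OF rmono[OF that] W_adapted[OF rpos]] .
    \<comment> \<open>Discrete product rule: the increments from s to \<open>r k\<close> are known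
      at time \<open>r k\<close>, so the two mixed terms of each step have mean zero.\<close>
    have tel: "integrable M (\<lambda>\<omega>. U \<omega> * ((W i (r k) \<omega> - W i s \<omega>) * (W j (r k) \<omega> - W j s \<omega>)))
      \<and> integrable M (\<lambda>\<omega>. U \<omega> * S k \<omega>) \<and>
      expectation (\<lambda>\<omega>. U \<omega> * ((W i (r k) \<omega> - W i s \<omega>) * (W j (r k) \<omega> - W j s \<omega>)))
      = expectation (\<lambda>\<omega>. U \<omega> * S k \<omega>)" for k
    proof (induction k)
      case 0 then show ?case by (simp add: r0 S_def)
    next
      case (Suc k)
      have UF: "U \<in> borel_measurable (F (r k))" using F_measurable_mono[OF rge U] .
      have m: "(\<lambda>\<omega>. U \<omega> * (W k' (r k) \<omega> - W k' s \<omega>)) \<in> borel_measurable (F (r k))" for k'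
      proof -
        note [measurable] = UF
        have [measurable]: "W k' (r k) \<in> borel_measurable (F (r k))" "W k' s \<in> borel_measurable (F (r k))"
          using Wm[of k k] Wm[of 0 k] r0 by auto
        show ?thesis by measurable
      qed
      \<comment> \<open>The case k = 0 is separate, because the orthogonality relation requires a
        nonempty interval from s to \<open>r k\<close>.\<close>
      have mi: "integrable M (\<lambda>\<omega>. U \<omega> * (W k' (r k) \<omega> - W k' s \<omega>))" for k'
      proof (cases "k = 0")
        case True then show ?thesis by (simp add: r0)
      next
        case False
        then have "s < r k" using st N by (simp add: r_def)
        have "integrable M U" by (rule integrable_const_bound[where B=c]) (use bd in auto)
        from W_increment_mult1(1)[OF st(1) \<open>s < r k\<close> U this] show ?thesis .
      qed
      note z1 = W_increment_mult1[OF rpos rlt m mi, of i j]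
      note z2 = W_increment_mult1[OF rpos rlt m mi, of j i]
      have Uint: "integrable M U" by (rule integrable_const_bound[where B=c]) (use bd in auto)
      have z3: "integrable M (\<lambda>\<omega>. U \<omega> * (da i k \<omega> * da j k \<omega>))"
        unfolding da_def by (rule integrable_W_increment_prod[OF rpos rlt UF Uint])
      have eq: "U \<omega> * ((W i (r (Suc k)) \<omega> - W i s \<omega>) * (W j (r (Suc k)) \<omega> - W j s \<omega>)) =
        U \<omega> * ((W i (r k) \<omega> - W i s \<omega>) * (W j (r k) \<omega> - W j s \<omega>)) +
        U \<omega> * (W i (r k) \<omega> - W i s \<omega>) * (W j (r (Suc k)) \<omega> - W j (r k) \<omega>) +
        U \<omega> * (W j (r k) \<omega> - W j s \<omega>) * (W i (r (Suc k)) \<omega> - W i (r k) \<omega>) +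
        U \<omega> * (da i k \<omega> * da j k \<omega>)" for \<omega>
        by (simp add: da_def algebra_simps)
      have eqS: "U \<omega> * S (Suc k) \<omega> = U \<omega> * S k \<omega> + U \<omega> * (da i k \<omega> * da j k \<omega>)" for \<omega>
        by (simp add: S_def algebra_simps)
      show ?case
        unfolding eq eqS using Suc z1 z2 z3 by simp
    qed
    have "\<bar>e\<bar> = \<bar>expectation (\<lambda>\<omega>. U \<omega> * S N \<omega>)\<bar>"
      unfolding e_def using tel[of N] rN by simp
    also have "\<dots> \<le> expectation (\<lambda>\<omega>. \<bar>U \<omega> * S N \<omega>\<bar>)" by (rule integral_abs_bound)
    also have "\<dots> \<le> expectation (\<lambda>\<omega>. c * \<bar>S N \<omega>\<bar>)"
    proof (rule integral_mono)
      show "integrable M (\<lambda>\<omega>. \<bar>U \<omega> * S N \<omega>\<bar>)" using tel[of N] by simp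
      show "integrable M (\<lambda>\<omega>. c * \<bar>S N \<omega>\<bar>)"
        using Sint[of N] square_integrable_imp_integrable[OF Sm, of N] by auto
      show "\<bar>U \<omega> * S N \<omega>\<bar> \<le> c * \<bar>S N \<omega>\<bar>" for \<omega>
        using bd[of \<omega>] by (simp add: abs_mult mult_right_mono)
    qed
    also have "\<dots> = c * expectation (\<lambda>\<omega>. \<bar>S N \<omega>\<bar>)" by simp
    also have "\<dots> \<le> c * ((1 + (t - s)\<^sup>2) / sqrt (real N))" using SN c by (rule mult_left_mono)
    finally show ?thesis by simp
  qed
  have "(\<lambda>N. c * (1 + (t - s)\<^sup>2) / sqrt (real N)) \<longlonglongrightarrow> 0"
    by real_asymp
  then have "\<bar>e\<bar> \<le> 0"
    by (rule tendsto_lowerbound) (use main in \<open>auto simp: eventually_sequentially intro!: exI[of _ 1]\<close>)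
  then show ?thesis by (simp add: e_def)
qed

text \<open>The bounded case is applied to \<open>U\<close> cut at level c; the cut products are
  dominated by the integrable one with \<open>U\<close> itself.\<close>

lemma W_increment_cross:
  assumes ij: "i \<noteq> j" and st: "0 \<le> s" "s < t" and U: "U \<in> borel_measurable (F s)"
    and int: "integrable M U"
  shows "expectation (\<lambda>\<omega>. U \<omega> * ((W i t \<omega> - W i s \<omega>) * (W j t \<omega> - W j s \<omega>))) = 0"
proof -
  have [measurable]: "U \<in> borel_measurable M" using int by auto
  have [measurable]: "W k s \<in> borel_measurable M" "W k t \<in> borel_measurable M" for k using st by auto
  define Uc where "Uc c \<omega> = (if \<bar>U \<omega>\<bar> \<le> real c then U \<omega> else 0)" for c \<omega>
  have [measurable]: "Uc c \<in> borel_measurable M" for c unfolding Uc_def by measurable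
  have UcF: "Uc c \<in> borel_measurable (F s)" for c unfolding Uc_def using U by measurable
  let ?D = "\<lambda>\<omega>. (W i t \<omega> - W i s \<omega>) * (W j t \<omega> - W j s \<omega>)"
  have "(\<lambda>c. expectation (\<lambda>\<omega>. Uc c \<omega> * ?D \<omega>)) \<longlonglongrightarrow> expectation (\<lambda>\<omega>. U \<omega> * ?D \<omega>)"
  proof (rule integral_dominated_convergence[where w="\<lambda>\<omega>. \<bar>U \<omega> * ?D \<omega>\<bar>"])
    show "integrable M (\<lambda>\<omega>. \<bar>U \<omega> * ?D \<omega>\<bar>)"
      using integrable_W_increment_prod[OF st U int] by auto
    have "(\<lambda>c. Uc c \<omega> * ?D \<omega>) \<longlonglongrightarrow> U \<omega> * ?D \<omega>" for \<omega>
    proof (rule tendsto_eventually)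
      obtain N :: nat where "\<bar>U \<omega>\<bar> \<le> real N" using real_arch_simple by blast
      then show "\<forall>\<^sub>F c in sequentially. Uc c \<omega> * ?D \<omega> = U \<omega> * ?D \<omega>"
        by (auto simp: eventually_sequentially Uc_def intro!: exI[of _ N])
    qed
    then show "AE \<omega> in M. (\<lambda>c. Uc c \<omega> * ?D \<omega>) \<longlonglongrightarrow> U \<omega> * ?D \<omega>" by simp
    show "AE \<omega> in M. norm (Uc c \<omega> * ?D \<omega>) \<le> \<bar>U \<omega> * ?D \<omega>\<bar>" for c by (auto simp: Uc_def)
  qed measurable
  moreover have "expectation (\<lambda>\<omega>. Uc c \<omega> * ?D \<omega>) = 0" for c
    by (rule W_increment_cross_bounded[OF ij st UcF, where c="real c"]) (auto simp: Uc_def)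
  ultimately show ?thesis using LIMSEQ_unique[OF tendsto_const] by fastforce
qed

end

section \<open>Quadratic variation of semimartingales along subdivisions\<close>

context prob_space
begin

lemma prob_tendsto_0_AE:
  assumes E: "\<And>n. E n \<in> events" and AE: "AE \<omega> in M. \<forall>\<^sub>F n in sequentially. \<omega> \<notin> E n"
  shows "(\<lambda>n::nat. prob (E n)) \<longlonglongrightarrow> 0"
proof -
  have "(\<lambda>n. expectation (indicator (E n) :: 'a \<Rightarrow> real)) \<longlonglongrightarrow> expectation (\<lambda>_. 0)"
  proof (rule integral_dominated_convergence[where w="\<lambda>_. 1"])
    show "AE \<omega> in M. (\<lambda>n. indicator (E n) \<omega> :: real) \<longlonglongrightarrow> 0"
      using AE by eventually_elim (auto intro!: tendsto_eventually elim: eventually_mono)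
  qed (use E in auto)
  then show ?thesis using E by simp
qed

text \<open>Turns a bound that depends on the path into one constant outside a small event. The
  index type is countable, which keeps the event measurable; in the applications to paths it
  consists of pairs of a level and a position on the grid.\<close>

lemma AE_bounded_event:
  fixes Y :: "'i::countable \<Rightarrow> 'a \<Rightarrow> real"
  assumes meas[measurable]: "\<And>i. Y i \<in> borel_measurable M" and bd: "AE \<omega> in M. \<exists>K. \<forall>i. \<bar>Y i \<omega>\<bar> \<le> K" and \<eta>: "\<eta> > 0"
  obtains c where "c > 0" "{\<omega>\<in>space M. \<exists>i. c < \<bar>Y i \<omega>\<bar>} \<in> events" "prob {\<omega>\<in>space M. \<exists>i. c < \<bar>Y i \<omega>\<bar>} \<le> \<eta>"
proof -
  define E where "E n = {\<omega>\<in>space M. \<exists>i. real n < \<bar>Y i \<omega>\<bar>}" for n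
  have Em: "E n \<in> events" for n unfolding E_def by measurable
  have "(\<lambda>n. prob (E n)) \<longlonglongrightarrow> 0"
  proof (rule prob_tendsto_0_AE[OF Em])
    show "AE \<omega> in M. \<forall>\<^sub>F n in sequentially. \<omega> \<notin> E n"
      using bd
    proof eventually_elim
      case (elim \<omega>)
      then obtain K where K: "\<And>i. \<bar>Y i \<omega>\<bar> \<le> K" by blast
      obtain N :: nat where N: "K \<le> real N" using real_arch_simple by blast
      have "\<omega> \<notin> E n" if "n \<ge> N" for n
      proof -
        have "\<bar>Y i \<omega>\<bar> \<le> real n" for i using K[of i] N that by linarith
        then show ?thesis by (auto simp: E_def not_less)
      qed
      then show ?case unfolding eventually_sequentially by blast
    qed
  qed
  from order_tendstoD(2)[OF this \<eta>] obtain N where N: "\<And>n. n \<ge> N \<Longrightarrow> prob (E n) < \<eta>"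
    by (auto simp: eventually_sequentially)
  show ?thesis
  proof (rule that[of "real (Suc N)"])
    show "{\<omega>\<in>space M. \<exists>i. real (Suc N) < \<bar>Y i \<omega>\<bar>} \<in> events" using Em[of "Suc N"] by (simp add: E_def)
    show "prob {\<omega>\<in>space M. \<exists>i. real (Suc N) < \<bar>Y i \<omega>\<bar>} \<le> \<eta>" using N[of "Suc N"] by (simp add: E_def)
  qed simp
qed

lemma tight_seq_AE_bounded:
  assumes meas: "\<And>n. Y n \<in> borel_measurable M" and bd: "AE \<omega> in M. \<exists>K. \<forall>n. \<bar>Y n \<omega>\<bar> \<le> K"
  shows "tight_seq Y"
  unfolding tight_seq_def
proof (intro conjI allI meas impI)
  note [measurable] = meas
  fix \<eta> :: real assume "\<eta> > 0"
  from AE_bounded_event[OF meas bd this] obtain c where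
    c: "c > 0" "{\<omega>\<in>space M. \<exists>n. c < \<bar>Y n \<omega>\<bar>} \<in> events" "prob {\<omega>\<in>space M. \<exists>n. c < \<bar>Y n \<omega>\<bar>} \<le> \<eta>" .
  have "prob {\<omega>\<in>space M. c < \<bar>Y n \<omega>\<bar>} \<le> prob {\<omega>\<in>space M. \<exists>n. c < \<bar>Y n \<omega>\<bar>}" for n
    by (rule finite_measure_mono[OF _ c(2)]) blast
  with c(3) show "\<exists>c. \<forall>n. prob {\<omega>\<in>space M. c < \<bar>Y n \<omega>\<bar>} \<le> \<eta>" by (meson order_trans)
qed

end

text \<open>The growth of the Huber function is linear, so that first moments of a martingale suffice to
  control its squared increments as long as it stays in \<open>[-c, c]\<close>.\<close>

definition clamp_abs :: "real \<Rightarrow> real \<Rightarrow> real" where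
  "clamp_abs c y = max (- c) (min c y)"

definition huber :: "real \<Rightarrow> real \<Rightarrow> real" where
  "huber c y = 2 * clamp_abs c y * y - (clamp_abs c y)\<^sup>2"

text \<open>The Huber function is the largest of the affine functions 2 s b - s^2 of b with |s| <=
  c, attained when s is the clamped value z of b: the gap factors as (z - s) (2 b - z - s). Taken at
  s = \<open>clamp_abs c a\<close> this is the convexity inequality \<open>huber_convex\<close>,
  with twice that value as the slope at a.\<close>

lemma huber_ge: "\<bar>s\<bar> \<le> c \<Longrightarrow> 2 * s * b - s\<^sup>2 \<le> huber c b"
proof -
  assume s: "\<bar>s\<bar> \<le> c"
  define z where "z = clamp_abs c b"
  have "0 \<le> (z - s) * (2 * b - z - s)"
  proof (cases "b > c")
    case True
    then have "z = c" using s by (auto simp: z_def clamp_abs_def)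
    then show ?thesis using s True by (intro mult_nonneg_nonneg) auto
  next
    case F: False
    show ?thesis
    proof (cases "b < - c")
      case True
      then have "z = - c" using s by (auto simp: z_def clamp_abs_def)
      then show ?thesis using s True by (intro mult_nonpos_nonpos) auto
    next
      case False
      then have "z = b" using F by (auto simp: z_def clamp_abs_def)
      then show ?thesis by simp
    qed
  qed
  then show ?thesis by (simp add: huber_def z_def[symmetric] algebra_simps power2_eq_square)
qed

lemma clamp_abs_bound: "c \<ge> 0 \<Longrightarrow> \<bar>clamp_abs c y\<bar> \<le> c"
  by (auto simp: clamp_abs_def)

lemma huber_convex: "c \<ge> 0 \<Longrightarrow> 0 \<le> huber c b - huber c a - 2 * clamp_abs c a * (b - a)"
  using huber_ge[OF clamp_abs_bound[of c a], of b] by (simp add: huber_def[of c a] algebra_simps)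

lemma huber_quadratic:
  assumes "\<bar>a\<bar> \<le> c" "\<bar>b\<bar> \<le> c"
  shows "huber c b - huber c a - 2 * clamp_abs c a * (b - a) = (b - a)\<^sup>2"
proof -
  have "clamp_abs c a = a" "clamp_abs c b = b" using assms by (auto simp: clamp_abs_def)
  then show ?thesis by (simp add: huber_def power2_eq_square algebra_simps)
qed

lemma huber_nonneg: "c \<ge> 0 \<Longrightarrow> 0 \<le> huber c b"
  using huber_ge[of 0 c b] by simp

lemma huber_le: "c \<ge> 0 \<Longrightarrow> huber c b \<le> 2 * c * \<bar>b\<bar>"
proof -
  assume c: "c \<ge> 0"
  have "\<bar>clamp_abs c b\<bar> * \<bar>b\<bar> \<le> c * \<bar>b\<bar>"
    by (intro mult_right_mono clamp_abs_bound c) simp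
  then have "clamp_abs c b * b \<le> c * \<bar>b\<bar>"
    using abs_ge_self[of "clamp_abs c b * b"] by (simp add: abs_mult)
  moreover have "0 \<le> (clamp_abs c b)\<^sup>2" by simp
  ultimately show ?thesis unfolding huber_def by linarith
qed

section \<open>Tightness of sums of squared increments\<close>

context usual_filtered_prob_space
begin

text \<open>Boundedness of \<open>U\<close> makes the product integrable although the martingale has
  only first moments; then \<open>U\<close> may be moved into the conditional expectation.\<close>

lemma martingale_increment_orthogonal:
  assumes N: "martingale M F N" and st: "0 \<le> s" "s \<le> t" and U: "U \<in> borel_measurable (F s)"
    and bd: "\<And>\<omega>. \<bar>U \<omega>\<bar> \<le> c"
  shows "integrable M (\<lambda>\<omega>. U \<omega> * (N t \<omega> - N s \<omega>))" "expectation (\<lambda>\<omega>. U \<omega> * (N t \<omega> - N s \<omega>)) = 0"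
proof -
  have sub: "subalgebra M (F s)" using F_subset[OF st(1)] space_F[of s] by (simp add: subalgebra_def)
  then have "sigma_finite_subalgebra M (F s)"
    by (intro finite_measure_subalgebra_is_sigma_finite) (simp add: finite_measure_subalgebra_def finite_measure_axioms finite_measure_subalgebra_axioms_def)
  then interpret S: sigma_finite_subalgebra M "F s" .
  have [measurable]: "U \<in> borel_measurable M" using U F_measurable_M st by blast
  have Nint: "integrable M (N r)" if "0 \<le> r" for r using N that by (auto simp: martingale_def)
  have UN: "integrable M (\<lambda>\<omega>. U \<omega> * N r \<omega>)" if "0 \<le> r" for r
  proof (rule Bochner_Integration.integrable_bound[where f="\<lambda>\<omega>. c * N r \<omega>"])
    have "norm (U \<omega> * N r \<omega>) \<le> norm (c * N r \<omega>)" for \<omega>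
    proof -
      have "\<bar>U \<omega>\<bar> \<le> \<bar>c\<bar>" using bd[of \<omega>] by simp
      then show ?thesis by (simp add: abs_mult mult_right_mono)
    qed
    then show "AE \<omega> in M. norm (U \<omega> * N r \<omega>) \<le> norm (c * N r \<omega>)" by simp
  qed (use Nint[OF that] in auto)
  have t0: "0 \<le> t" using st by simp
  have "expectation (\<lambda>\<omega>. U \<omega> * N t \<omega>) = expectation (\<lambda>\<omega>. U \<omega> * real_cond_exp M (F s) (N t) \<omega>)"
    by (rule S.real_cond_exp_intg(2)[symmetric]) (use UN[OF t0] U Nint[OF t0] in auto)
  also have "\<dots> = expectation (\<lambda>\<omega>. U \<omega> * N s \<omega>)"
  proof (rule integral_cong_AE)
    have "AE \<omega> in M. real_cond_exp M (F s) (N t) \<omega> = N s \<omega>"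
      using N st by (auto simp: martingale_def)
    then show "AE \<omega> in M. U \<omega> * real_cond_exp M (F s) (N t) \<omega> = U \<omega> * N s \<omega>"
      by eventually_elim simp
    show "(\<lambda>\<omega>. U \<omega> * real_cond_exp M (F s) (N t) \<omega>) \<in> borel_measurable M"
      using F_measurable_M[OF st(1) borel_measurable_cond_exp] by measurable
    show "(\<lambda>\<omega>. U \<omega> * N s \<omega>) \<in> borel_measurable M" using Nint[OF st(1)] by measurable
  qed
  finally have eq: "expectation (\<lambda>\<omega>. U \<omega> * N t \<omega>) = expectation (\<lambda>\<omega>. U \<omega> * N s \<omega>)" .
  show "integrable M (\<lambda>\<omega>. U \<omega> * (N t \<omega> - N s \<omega>))" "expectation (\<lambda>\<omega>. U \<omega> * (N t \<omega> - N s \<omega>)) = 0"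
    using UN[OF t0] UN[OF st(1)] eq by (auto simp: right_diff_distrib)
qed

lemma subdivision_bounds:
  assumes "subdivision T n p" "l \<le> n"
  shows "0 \<le> p l" "p l \<le> T"
proof -
  have inc: "p l \<le> p k" if "l \<le> k" "k \<le> n" for l k
    using that
  proof (induction k)
    case (Suc k)
    then show ?case using assms(1) by (cases "l = Suc k") (auto simp: subdivision_def intro: order_trans)
  qed auto
  show "0 \<le> p l" "p l \<le> T" using inc[of 0 l] inc[of l n] assms by (auto simp: subdivision_def)
qed

lemma subdivision_step: "subdivision T n p \<Longrightarrow> l < n \<Longrightarrow> p l \<le> p (Suc l)"
  by (simp add: subdivision_def)

text \<open>Each summand of \<open>S\<close> is the excess of the Huber function over its tangent at
  the left end point, thus nonnegative, and equals the squared increment while Y stays in [-c, c].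
  In the mean the tangent terms vanish by orthogonality and the rest telescopes, so that a first
  moment at time T bounds the sum for every subdivision.\<close>

lemma martingale_clamped_square_sum:
  assumes Y: "martingale M F Y" and p: "subdivision T n p" and c: "c \<ge> 0"
  defines "S \<equiv> \<lambda>\<omega>. \<Sum>l<n. huber c (Y (p (Suc l)) \<omega>) - huber c (Y (p l) \<omega>)
      - 2 * clamp_abs c (Y (p l) \<omega>) * (Y (p (Suc l)) \<omega> - Y (p l) \<omega>)"
  shows "integrable M S" "expectation S \<le> 2 * c * expectation (\<lambda>\<omega>. \<bar>Y T \<omega>\<bar>)"
proof -
  note pb = subdivision_bounds[OF p]
  have Yint: "integrable M (Y r)" and YF: "Y r \<in> borel_measurable (F r)" if "0 \<le> r" for r
    using Y that by (auto simp: martingale_def adapted_def)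
  have [measurable]: "(\<lambda>y. clamp_abs c y) \<in> borel_measurable borel" "(\<lambda>y. huber c y) \<in> borel_measurable borel"
    unfolding clamp_abs_def[abs_def] huber_def[abs_def] by measurable
  have hint: "integrable M (\<lambda>\<omega>. huber c (Y r \<omega>))" if "0 \<le> r" for r
  proof (rule Bochner_Integration.integrable_bound[where f="\<lambda>\<omega>. 2 * c * \<bar>Y r \<omega>\<bar>"])
    show "(\<lambda>\<omega>. huber c (Y r \<omega>)) \<in> borel_measurable M" using Yint[OF that] by measurable
    have "norm (huber c b) \<le> norm (2 * c * \<bar>b\<bar>)" for b
      using huber_nonneg[OF c, of b] huber_le[OF c, of b] unfolding real_norm_def by linarith
    then show "AE \<omega> in M. norm (huber c (Y r \<omega>)) \<le> norm (2 * c * \<bar>Y r \<omega>\<bar>)" by simp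
  qed (use Yint[OF that] in auto)
  have T: "0 \<le> T" using pb[of 0] p by (auto simp: subdivision_def)
  have orth: "integrable M (\<lambda>\<omega>. 2 * clamp_abs c (Y (p l) \<omega>) * (Y (p (Suc l)) \<omega> - Y (p l) \<omega>))"
    "expectation (\<lambda>\<omega>. 2 * clamp_abs c (Y (p l) \<omega>) * (Y (p (Suc l)) \<omega> - Y (p l) \<omega>)) = 0" if "l < n" for l
  proof -
    have r: "0 \<le> p l" "p l \<le> p (Suc l)" using that pb[of l] subdivision_step[OF p] by auto
    have "(\<lambda>\<omega>. 2 * clamp_abs c (Y (p l) \<omega>)) \<in> borel_measurable (F (p l))"
      using YF[OF r(1)] by measurable
    moreover have "\<bar>2 * clamp_abs c (Y (p l) \<omega>)\<bar> \<le> 2 * c" for \<omega>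
      using clamp_abs_bound[OF c, of "Y (p l) \<omega>"] by simp
    ultimately show "integrable M (\<lambda>\<omega>. 2 * clamp_abs c (Y (p l) \<omega>) * (Y (p (Suc l)) \<omega> - Y (p l) \<omega>))"
    "expectation (\<lambda>\<omega>. 2 * clamp_abs c (Y (p l) \<omega>) * (Y (p (Suc l)) \<omega> - Y (p l) \<omega>)) = 0"
      using martingale_increment_orthogonal[OF Y r] by blast+
  qed
  have pos: "0 \<le> p l" "0 \<le> p (Suc l)" if "l < n" for l using pb[of l] pb[of "Suc l"] that by auto
  show "integrable M S"
    unfolding S_def using hint orth pos by (intro Bochner_Integration.integrable_sum Bochner_Integration.integrable_diff) auto
  have "expectation S = (\<Sum>l<n. expectation (\<lambda>\<omega>. huber c (Y (p (Suc l)) \<omega>)) - expectation (\<lambda>\<omega>. huber c (Y (p l) \<omega>)))"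
    unfolding S_def
  proof (subst Bochner_Integration.integral_sum)
    show "(\<Sum>l<n. expectation (\<lambda>\<omega>. huber c (Y (p (Suc l)) \<omega>) - huber c (Y (p l) \<omega>)
      - 2 * clamp_abs c (Y (p l) \<omega>) * (Y (p (Suc l)) \<omega> - Y (p l) \<omega>))) =
      (\<Sum>l<n. expectation (\<lambda>\<omega>. huber c (Y (p (Suc l)) \<omega>)) - expectation (\<lambda>\<omega>. huber c (Y (p l) \<omega>)))"
      by (intro sum.cong refl) (use hint orth pos in \<open>simp add: Bochner_Integration.integral_diff\<close>)
  qed (use hint orth pos in \<open>intro Bochner_Integration.integrable_diff, auto\<close>)
  also have "\<dots> = expectation (\<lambda>\<omega>. huber c (Y (p n) \<omega>)) - expectation (\<lambda>\<omega>. huber c (Y (p 0) \<omega>))"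
    by (rule sum_lessThan_telescope)
  also have "\<dots> \<le> expectation (\<lambda>\<omega>. huber c (Y T \<omega>))"
  proof -
    have "0 \<le> expectation (\<lambda>\<omega>. huber c (Y (p 0) \<omega>))"
      by (rule integral_nonneg_AE) (simp add: huber_nonneg[OF c])
    then show ?thesis using p by (simp add: subdivision_def)
  qed
  also have "\<dots> \<le> expectation (\<lambda>\<omega>. 2 * c * \<bar>Y T \<omega>\<bar>)"
    by (intro integral_mono hint T huber_le c) (use Yint[OF T] in auto)
  finally show "expectation S \<le> 2 * c * expectation (\<lambda>\<omega>. \<bar>Y T \<omega>\<bar>)" by simp
qed

text \<open>Outside one event of small probability the localizing time \<open>\<tau> k\<close> lies
  beyond T, and the path, sampled at all subdivision points of all m, stays within distance c of its
  start. There the sum of squares coincides with the Huber sum of the stopped martingale, whose mean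
  is bounded independently of m.\<close>

lemma tight_quadratic_sum_local_martingale:
  assumes N: "continuous_local_martingale M F N" and p: "\<And>m. subdivision T (n m) (p m)"
  shows "tight_seq (\<lambda>m \<omega>. \<Sum>l<n m. (N (p m (Suc l)) \<omega> - N (p m l) \<omega>)\<^sup>2)"
proof -
  obtain \<tau> :: "nat \<Rightarrow> 'a \<Rightarrow> real" where \<tau>: "\<And>k. stopping_time F (\<tau> k)"
    and mart: "\<And>k. martingale M F (\<lambda>t \<omega>. N (min t (\<tau> k \<omega>)) \<omega> - N 0 \<omega>)"
    and lim: "AE \<omega> in M. filterlim (\<lambda>k. \<tau> k \<omega>) at_top sequentially"
    using N unfolding continuous_local_martingale_def by (auto elim: eventually_mono)
  note pb = subdivision_bounds[OF p]
  have T: "0 \<le> T" using pb(1,2)[of 0 0] by linarith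
  have NF: "N r \<in> borel_measurable M" if "0 \<le> r" for r
    using N that F_measurable_M[OF that] by (auto simp: continuous_local_martingale_def adapted_def)
  have Nm: "N (p m l) \<in> borel_measurable M" if "l \<le> n m" for m l using NF pb[OF that] by auto
  have meas: "(\<lambda>\<omega>. \<Sum>l<n m. (N (p m (Suc l)) \<omega> - N (p m l) \<omega>)\<^sup>2) \<in> borel_measurable M" for m
    by (intro borel_measurable_sum borel_measurable_power borel_measurable_diff Nm) auto
  show ?thesis
  proof (rule tight_seqI_bad[OF meas])
    fix \<eta> :: real assume "\<eta> > 0"
    then have \<eta>2: "\<eta> / 2 > 0" by simp
    define E1 where "E1 k = {\<omega>\<in>space M. \<tau> k \<omega> \<le> T}" for k
    have E1m: "E1 k \<in> events" for k
    proof -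
      have "{\<omega>\<in>space (F T). \<tau> k \<omega> \<le> T} \<in> sets (F T)"
        using stopping_timeD[OF \<tau>[of k], of T] by (simp add: pred_def)
      then show ?thesis using F_subset[OF T] space_F[of T] by (auto simp: E1_def)
    qed
    have "(\<lambda>k. prob (E1 k)) \<longlonglongrightarrow> 0"
    proof (rule prob_tendsto_0_AE[OF E1m])
      show "AE \<omega> in M. \<forall>\<^sub>F k in sequentially. \<omega> \<notin> E1 k"
        using lim
      proof eventually_elim
        case (elim \<omega>)
        then have "\<forall>\<^sub>F k in sequentially. T < \<tau> k \<omega>" by (simp add: filterlim_at_top_dense)
        then show ?case by eventually_elim (auto simp: E1_def)
      qed
    qed
    from order_tendstoD(2)[OF this \<eta>2] obtain k where k: "prob (E1 k) < \<eta> / 2"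
      by (auto simp: eventually_sequentially)
    \<comment> \<open>The sampled values over all m form one countable family, so that the constant
      c serves every subdivision; positions beyond \<open>n m\<close> get the value 0.\<close>
    define B where "B ml \<omega> = (if snd ml \<le> n (fst ml) then N (p (fst ml) (snd ml)) \<omega> - N 0 \<omega> else 0)" for ml \<omega>
    have Bm: "B ml \<in> borel_measurable M" for ml
      by (cases "snd ml \<le> n (fst ml)") (auto simp: B_def[abs_def] intro!: borel_measurable_diff Nm NF pb)
    have "AE \<omega> in M. \<exists>K. \<forall>ml. \<bar>B ml \<omega>\<bar> \<le> K"
    proof -
      have "AE \<omega> in M. continuous_on {0..} (\<lambda>t. N t \<omega>)"
        using N by (simp add: continuous_local_martingale_def continuous_paths_def)
      then show ?thesis
      proof eventually_elim
        case (elim \<omega>)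
        then have "continuous_on {0..T} (\<lambda>t. N t \<omega>)" by (rule continuous_on_subset) auto
        then have "bounded ((\<lambda>t. N t \<omega>) ` {0..T})" by (intro compact_imp_bounded compact_continuous_image) auto
        then obtain K where K0: "\<forall>t\<in>{0..T}. \<bar>N t \<omega>\<bar> \<le> K" by (auto simp: bounded_iff)
        then have K: "\<bar>N t \<omega>\<bar> \<le> K" if "0 \<le> t" "t \<le> T" for t using that by simp
        have "\<bar>B ml \<omega>\<bar> \<le> 2 * K" for ml
        proof (cases "snd ml \<le> n (fst ml)")
          case True
          then show ?thesis using K[OF pb[OF True]] K[of 0] T by (auto simp: B_def)
        next
          case False then show ?thesis using K[of 0] T by (auto simp: B_def)
        qed
        then show ?case by blast
      qed
    qed
    from AE_bounded_event[OF Bm this \<eta>2] obtain c where c: "c > 0"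
      "{\<omega>\<in>space M. \<exists>ml. c < \<bar>B ml \<omega>\<bar>} \<in> events" "prob {\<omega>\<in>space M. \<exists>ml. c < \<bar>B ml \<omega>\<bar>} \<le> \<eta> / 2" .
    define E where "E = E1 k \<union> {\<omega>\<in>space M. \<exists>ml. c < \<bar>B ml \<omega>\<bar>}"
    have Em: "E \<in> events" using c(2) E1m[of k] unfolding E_def by (rule sets.Un[rotated])
    have "prob E \<le> prob (E1 k) + prob {\<omega>\<in>space M. \<exists>ml. c < \<bar>B ml \<omega>\<bar>}"
      unfolding E_def by (rule measure_Un_le[OF E1m c(2)])
    then have PE: "prob E \<le> \<eta>" using k c by simp
    define Y where "Y t \<omega> = N (min t (\<tau> k \<omega>)) \<omega> - N 0 \<omega>" for t \<omega>
    have Y: "martingale M F Y" unfolding Y_def using mart[of k] by simp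
    define K where "K = 2 * c * expectation (\<lambda>\<omega>. \<bar>Y T \<omega>\<bar>)"
    define U where "U m \<omega> = (\<Sum>l<n m. huber c (Y (p m (Suc l)) \<omega>) - huber c (Y (p m l) \<omega>)
      - 2 * clamp_abs c (Y (p m l) \<omega>) * (Y (p m (Suc l)) \<omega> - Y (p m l) \<omega>))" for m \<omega>
    have U: "integrable M (U m)" "expectation (U m) \<le> K" for m
      using martingale_clamped_square_sum[OF Y p, of c] c unfolding K_def U_def[abs_def] by auto
    have U0: "0 \<le> U m \<omega>" for m \<omega>
      unfolding U_def by (intro sum_nonneg huber_convex) (use c in auto)
    have bound: "\<bar>\<Sum>l<n m. (N (p m (Suc l)) \<omega> - N (p m l) \<omega>)\<^sup>2\<bar> \<le> U m \<omega>" if "\<omega> \<in> space M" "\<omega> \<notin> E" for m \<omega>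
    proof -
      have \<tau>T: "T < \<tau> k \<omega>" using that by (auto simp: E_def E1_def)
      have Bc: "\<bar>B ml \<omega>\<bar> \<le> c" for ml using that by (cases ml) (auto simp: E_def not_less)
      have Yeq: "Y (p m l) \<omega> = N (p m l) \<omega> - N 0 \<omega>" if "l \<le> n m" for l
        using \<tau>T pb[OF that] by (auto simp: Y_def min_def)
      have Yc: "\<bar>Y (p m l) \<omega>\<bar> \<le> c" if "l \<le> n m" for l
        using Bc[of "(m, l)"] that Yeq[OF that] by (simp add: B_def)
      have "U m \<omega> = (\<Sum>l<n m. (N (p m (Suc l)) \<omega> - N (p m l) \<omega>)\<^sup>2)"
        unfolding U_def
      proof (intro sum.cong refl)
        fix l assume l: "l \<in> {..<n m}"
        then have "huber c (Y (p m (Suc l)) \<omega>) - huber c (Y (p m l) \<omega>) -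
            2 * clamp_abs c (Y (p m l) \<omega>) * (Y (p m (Suc l)) \<omega> - Y (p m l) \<omega>) = (Y (p m (Suc l)) \<omega> - Y (p m l) \<omega>)\<^sup>2"
          by (intro huber_quadratic Yc) auto
        then show "huber c (Y (p m (Suc l)) \<omega>) - huber c (Y (p m l) \<omega>) -
            2 * clamp_abs c (Y (p m l) \<omega>) * (Y (p m (Suc l)) \<omega> - Y (p m l) \<omega>) = (N (p m (Suc l)) \<omega> - N (p m l) \<omega>)\<^sup>2"
          using l by (simp add: Yeq)
      qed
      then show ?thesis using sum_nonneg[of "{..<n m}" "\<lambda>l. (N (p m (Suc l)) \<omega> - N (p m l) \<omega>)\<^sup>2"] by simp
    qed
    show "\<exists>E K. E \<in> events \<and> prob E \<le> \<eta> \<and>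
        (\<forall>m. \<exists>U. integrable M U \<and> expectation U \<le> K \<and> (AE \<omega> in M. 0 \<le> U \<omega>) \<and>
        (AE \<omega> in M. \<omega> \<notin> E \<longrightarrow> \<bar>\<Sum>l<n m. (N (p m (Suc l)) \<omega> - N (p m l) \<omega>)\<^sup>2\<bar> \<le> U \<omega>))"
    proof (rule exI[of _ E], rule exI[of _ K], intro conjI allI Em PE)
      fix m
      show "\<exists>U. integrable M U \<and> expectation U \<le> K \<and> (AE \<omega> in M. 0 \<le> U \<omega>) \<and>
        (AE \<omega> in M. \<omega> \<notin> E \<longrightarrow> \<bar>\<Sum>l<n m. (N (p m (Suc l)) \<omega> - N (p m l) \<omega>)\<^sup>2\<bar> \<le> U \<omega>)"
        by (rule exI[of _ "U m"]) (use U U0 bound in auto)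
    qed
  qed
qed

text \<open>Every increment is at most a bound K of the variation of the path on [0, T], so the sum
  of squares is at most K^2 along the path.\<close>

lemma tight_quadratic_sum_finite_variation:
  assumes V: "continuous_finite_variation M F V" and p: "\<And>m. subdivision T (n m) (p m)"
  shows "tight_seq (\<lambda>m \<omega>. \<Sum>l<n m. (V (p m (Suc l)) \<omega> - V (p m l) \<omega>)\<^sup>2)"
proof (rule tight_seq_AE_bounded)
  note pb = subdivision_bounds[OF p]
  have T: "0 \<le> T" using pb(1,2)[of 0 0] by linarith
  have Vm: "V (p m l) \<in> borel_measurable M" if "l \<le> n m" for m l
    using V F_measurable_M[OF pb(1)[OF that]] pb[OF that] by (auto simp: continuous_finite_variation_def adapted_def)
  show "(\<lambda>\<omega>. \<Sum>l<n m. (V (p m (Suc l)) \<omega> - V (p m l) \<omega>)\<^sup>2) \<in> borel_measurable M" for m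
    by (intro borel_measurable_sum borel_measurable_power borel_measurable_diff Vm) auto
  have "AE \<omega> in M. \<forall>t\<ge>0. \<exists>K. \<forall>n p. subdivision t n p \<longrightarrow> (\<Sum>i<n. \<bar>V (p (Suc i)) \<omega> - V (p i) \<omega>\<bar>) \<le> K"
    using V by (simp add: continuous_finite_variation_def)
  then show "AE \<omega> in M. \<exists>K. \<forall>m. \<bar>\<Sum>l<n m. (V (p m (Suc l)) \<omega> - V (p m l) \<omega>)\<^sup>2\<bar> \<le> K"
  proof eventually_elim
    case (elim \<omega>)
    then obtain K where K: "\<And>n p. subdivision T n p \<Longrightarrow> (\<Sum>i<n. \<bar>V (p (Suc i)) \<omega> - V (p i) \<omega>\<bar>) \<le> K" using T by blast
    have "\<bar>\<Sum>l<n m. (V (p m (Suc l)) \<omega> - V (p m l) \<omega>)\<^sup>2\<bar> \<le> K\<^sup>2" for m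
    proof -
      have "(\<Sum>l<n m. (V (p m (Suc l)) \<omega> - V (p m l) \<omega>)\<^sup>2) \<le> (\<Sum>l<n m. \<bar>V (p m (Suc l)) \<omega> - V (p m l) \<omega>\<bar> * K)"
      proof (rule sum_mono)
        fix l assume l: "l \<in> {..<n m}"
        have "\<bar>V (p m (Suc l)) \<omega> - V (p m l) \<omega>\<bar> \<le> (\<Sum>i<n m. \<bar>V (p m (Suc i)) \<omega> - V (p m i) \<omega>\<bar>)"
          by (rule member_le_sum[OF l]) auto
        also have "\<dots> \<le> K" by (rule K[OF p])
        finally have "\<bar>V (p m (Suc l)) \<omega> - V (p m l) \<omega>\<bar> * \<bar>V (p m (Suc l)) \<omega> - V (p m l) \<omega>\<bar>
           \<le> \<bar>V (p m (Suc l)) \<omega> - V (p m l) \<omega>\<bar> * K" by (intro mult_left_mono) auto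
        then show "(V (p m (Suc l)) \<omega> - V (p m l) \<omega>)\<^sup>2 \<le> \<bar>V (p m (Suc l)) \<omega> - V (p m l) \<omega>\<bar> * K"
          by (simp add: power2_eq_square)
      qed
      also have "\<dots> = (\<Sum>l<n m. \<bar>V (p m (Suc l)) \<omega> - V (p m l) \<omega>\<bar>) * K" by (simp add: sum_distrib_right)
      also have "\<dots> \<le> K * K"
      proof (rule mult_right_mono[OF K[OF p]])
        have "0 \<le> (\<Sum>l<n m. \<bar>V (p m (Suc l)) \<omega> - V (p m l) \<omega>\<bar>)" by (intro sum_nonneg) auto
        then show "0 \<le> K" using K[OF p[of m]] by linarith
      qed
      finally show ?thesis
        using sum_nonneg[of "{..<n m}" "\<lambda>l. (V (p m (Suc l)) \<omega> - V (p m l) \<omega>)\<^sup>2"] by (simp add: power2_eq_square)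
    qed
    then show ?case by blast
  qed
qed

lemma tight_quadratic_sum_semimartingale:
  assumes Y: "continuous_semimartingale M F Y" and p: "\<And>m. subdivision T (n m) (p m)"
  shows "tight_seq (\<lambda>m \<omega>. \<Sum>l<n m. (Y (p m (Suc l)) \<omega> - Y (p m l) \<omega>)\<^sup>2)"
proof -
  obtain N V where N: "continuous_local_martingale M F N" and V: "continuous_finite_variation M F V"
    and NV: "\<And>t. 0 \<le> t \<Longrightarrow> AE \<omega> in M. Y t \<omega> = N t \<omega> + V t \<omega>" and ad: "adapted F Y"
    using Y unfolding continuous_semimartingale_def by blast
  note pb = subdivision_bounds[OF p]
  have Ym: "Y (p m l) \<in> borel_measurable M" if "l \<le> n m" for m l
    using ad F_measurable_M[OF pb(1)[OF that]] pb[OF that] by (auto simp: adapted_def)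
  show ?thesis
  proof (rule tight_seq_dominated)
    show "(\<lambda>\<omega>. \<Sum>l<n m. (Y (p m (Suc l)) \<omega> - Y (p m l) \<omega>)\<^sup>2) \<in> borel_measurable M" for m
      by (intro borel_measurable_sum borel_measurable_power borel_measurable_diff Ym) auto
    show "tight_seq (\<lambda>m \<omega>. 2 * (\<Sum>l<n m. (N (p m (Suc l)) \<omega> - N (p m l) \<omega>)\<^sup>2)
        + 2 * (\<Sum>l<n m. (V (p m (Suc l)) \<omega> - V (p m l) \<omega>)\<^sup>2))"
      by (intro tight_seq_add tight_seq_cmult tight_quadratic_sum_local_martingale[OF N p]
        tight_quadratic_sum_finite_variation[OF V p])
    fix m
    \<comment> \<open>The decomposition holds almost surely at each fixed time, with an exceptional
      set that depends on the time; one subdivision involves finitely many times.\<close>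
    have "AE \<omega> in M. \<forall>l\<in>{..n m}. Y (p m l) \<omega> = N (p m l) \<omega> + V (p m l) \<omega>"
      using NV pb(1)[of _ m] by (intro AE_finite_allI) auto
    then show "AE \<omega> in M. \<bar>\<Sum>l<n m. (Y (p m (Suc l)) \<omega> - Y (p m l) \<omega>)\<^sup>2\<bar>
      \<le> \<bar>2 * (\<Sum>l<n m. (N (p m (Suc l)) \<omega> - N (p m l) \<omega>)\<^sup>2) + 2 * (\<Sum>l<n m. (V (p m (Suc l)) \<omega> - V (p m l) \<omega>)\<^sup>2)\<bar>"
    proof eventually_elim
      case (elim \<omega>)
      have "(\<Sum>l<n m. (Y (p m (Suc l)) \<omega> - Y (p m l) \<omega>)\<^sup>2) \<le>
        (\<Sum>l<n m. 2 * (N (p m (Suc l)) \<omega> - N (p m l) \<omega>)\<^sup>2 + 2 * (V (p m (Suc l)) \<omega> - V (p m l) \<omega>)\<^sup>2)"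
      proof (rule sum_mono)
        fix l assume l: "l \<in> {..<n m}"
        define a b where "a = N (p m (Suc l)) \<omega> - N (p m l) \<omega>" and "b = V (p m (Suc l)) \<omega> - V (p m l) \<omega>"
        have "Y (p m (Suc l)) \<omega> - Y (p m l) \<omega> = a + b" using elim l by (auto simp: a_def b_def)
        moreover have "(a + b)\<^sup>2 \<le> 2 * a\<^sup>2 + 2 * b\<^sup>2" using sum_squares_bound[of a b] by (simp add: power2_sum)
        ultimately show "(Y (p m (Suc l)) \<omega> - Y (p m l) \<omega>)\<^sup>2 \<le> 2 * (N (p m (Suc l)) \<omega> - N (p m l) \<omega>)\<^sup>2 + 2 * (V (p m (Suc l)) \<omega> - V (p m l) \<omega>)\<^sup>2"
          by (simp add: a_def b_def)
      qed
      also have "\<dots> = 2 * (\<Sum>l<n m. (N (p m (Suc l)) \<omega> - N (p m l) \<omega>)\<^sup>2) + 2 * (\<Sum>l<n m. (V (p m (Suc l)) \<omega> - V (p m l) \<omega>)\<^sup>2)"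
        by (simp add: sum.distrib sum_distrib_left)
      finally show ?case
        using sum_nonneg[of "{..<n m}" "\<lambda>l. (Y (p m (Suc l)) \<omega> - Y (p m l) \<omega>)\<^sup>2"] by simp
    qed
  qed
qed

end

section \<open>The dyadic grid\<close>

lemma sum_lessThan_add: "sum f {..<a + b} = sum f {..<a} + (\<Sum>l<b. f (a + l))"
  for f :: "nat \<Rightarrow> 'b::comm_monoid_add"
  by (induction b) (simp_all add: add_ac)

lemma sum_lessThan_mult: "sum f {..<k * r} = (\<Sum>i<k. \<Sum>l<r. f (i * r + l))"
  for f :: "nat \<Rightarrow> 'b::comm_monoid_add"
proof (induction k)
  case (Suc k)
  then show ?case using sum_lessThan_add[of f "k * r" r] by (simp add: add.commute)
qed simp

lemma matvec_measurable[measurable (raw)]: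
  fixes A :: "real^'n^'m" and f :: "'a \<Rightarrow> real^'n"
  assumes "f \<in> borel_measurable N" shows "(\<lambda>\<omega>. A *v f \<omega>) \<in> borel_measurable N"
  by (rule measurable_compose[OF assms borel_measurable_continuous_onI])
     (intro linear_continuous_on matrix_vector_mul_bounded_linear)

lemma stratonovich_integral_ex:
  assumes J: "has_stratonovich_integral M Y W t J" and "e > 0" "\<eta> > 0"
  shows "\<exists>\<delta>>0. \<forall>n p. subdivision t n p \<and> (\<forall>i<n. p (Suc i) - p i < \<delta>) \<longrightarrow>
    measure M {\<omega> \<in> space M. norm (stratonovich_sum Y W n p \<omega> - J \<omega>) > e} < \<eta>"
  by (rule J[unfolded has_stratonovich_integral_def, THEN conjunct2, THEN spec, THEN mp, OF assms(2), THEN spec, THEN mp, OF assms(3)])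

lemma riemann_sum_error:
  fixes f :: "real \<Rightarrow> 'b::euclidean_space"
  assumes f: "continuous_on {0..real K * h} f" and h: "h \<ge> 0"
    and close: "\<And>k t. k < K \<Longrightarrow> real k * h \<le> t \<Longrightarrow> t \<le> real (Suc k) * h \<Longrightarrow> norm (f t - f (real k * h)) \<le> \<epsilon>"
  shows "norm (integral {0..real K * h} f - (\<Sum>k<K. h *\<^sub>R f (real k * h))) \<le> \<epsilon> * (real K * h)"
  using f close
proof (induction K)
  case (Suc K)
  let ?a = "real K * h" and ?b = "real (Suc K) * h"
  have ab: "0 \<le> ?a" "?a \<le> ?b" using h by (auto simp: algebra_simps)
  have c1: "continuous_on {0..?a} f" by (rule continuous_on_subset[OF Suc.prems(1)]) (use ab in auto)
  have c2: "continuous_on {?a..?b} f" by (rule continuous_on_subset[OF Suc.prems(1)]) (use ab in auto)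
  have IH: "norm (integral {0..?a} f - (\<Sum>k<K. h *\<^sub>R f (real k * h))) \<le> \<epsilon> * ?a"
    using Suc.IH[OF c1] Suc.prems(2) by simp
  have i2: "norm (integral {?a..?b} (\<lambda>t. f t - f ?a)) \<le> \<epsilon> * (?b - ?a)"
    by (rule integral_bound[OF ab(2)]) (use c2 Suc.prems(2)[of K] in \<open>auto intro!: continuous_intros\<close>)
  have ba: "?b - ?a = h" by (simp add: algebra_simps)
  have i2eq: "integral {?a..?b} (\<lambda>t. f t - f ?a) = integral {?a..?b} f - (?b - ?a) *\<^sub>R f ?a"
    using c2 ab by (subst integral_diff) (auto intro: integrable_continuous_real)
  have i2': "norm (integral {?a..?b} f - h *\<^sub>R f ?a) \<le> \<epsilon> * h"
    using i2 unfolding i2eq ba .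
  have "integral {0..?b} f = integral {0..?a} f + integral {?a..?b} f"
    by (rule Henstock_Kurzweil_Integration.integral_combine[symmetric]) (use ab Suc.prems(1) in \<open>auto intro: integrable_continuous_real\<close>)
  then have "integral {0..?b} f - (\<Sum>k<Suc K. h *\<^sub>R f (real k * h)) =
     (integral {0..?a} f - (\<Sum>k<K. h *\<^sub>R f (real k * h))) + (integral {?a..?b} f - h *\<^sub>R f ?a)"
    by simp
  also have "norm \<dots> \<le> \<epsilon> * ?a + \<epsilon> * h" by (rule order_trans[OF norm_triangle_ineq add_mono[OF IH i2']])
  also have "\<dots> = \<epsilon> * ?b" by (simp add: algebra_simps)
  finally show ?case .
qed simp

text \<open>The horizon \<open>T\<close> is the time at which the second moment is wanted. The final
  theorem interprets the locale separately for every positive time t, which is then the end point of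
  its own dyadic grid.\<close>

locale stratonovich_setting = brownian_setting M F W
  for M :: "'a measure" and F :: "real \<Rightarrow> 'a measure" and W :: "'l::finite \<Rightarrow> real \<Rightarrow> 'a \<Rightarrow> real" +
  fixes A :: "real^'n^'n" and B :: "'l \<Rightarrow> real^'n^'n" and x :: "real^'n"
    and X :: "real \<Rightarrow> 'a \<Rightarrow> real^'n" and T :: real
  assumes sol: "stratonovich_solution M F W A B x X" and T_pos: "T > 0"
begin

definition mesh :: "nat \<Rightarrow> real" where "mesh m = T / 2 ^ m"
definition g :: "nat \<Rightarrow> nat \<Rightarrow> real" where "g m l = real l * mesh m"
definition dW :: "'l \<Rightarrow> nat \<Rightarrow> nat \<Rightarrow> 'a \<Rightarrow> real" where
  "dW j m l \<omega> = W j (g m (Suc l)) \<omega> - W j (g m l) \<omega>"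
definition strat_step :: "nat \<Rightarrow> nat \<Rightarrow> 'a \<Rightarrow> real^'n" where
  "strat_step m l \<omega> = mesh m *\<^sub>R (A *v X (g m l) \<omega>) +
     (\<Sum>j\<in>UNIV. dW j m l \<omega> *\<^sub>R (B j *v ((1/2) *\<^sub>R (X (g m l) \<omega> + X (g m (Suc l)) \<omega>))))"

lemma mesh_pos: "mesh m > 0" using T_pos by (simp add: mesh_def)

lemma mesh_tendsto: "mesh \<longlonglongrightarrow> 0"
  unfolding mesh_def[abs_def] by (real_asymp)

lemma mesh_refine: "2 ^ r * mesh (n + r) = mesh n" by (simp add: mesh_def power_add)

lemma mesh_total: "2 ^ n * mesh n = T" by (simp add: mesh_def)

lemma g_nonneg[simp]: "0 \<le> g m l" using mesh_pos[of m] by (simp add: g_def)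

lemma g_0[simp]: "g m 0 = 0" by (simp add: g_def)

lemma g_Suc: "g m (Suc l) = g m l + mesh m" by (simp add: g_def algebra_simps)

lemma g_less: "g m l < g m (Suc l)" using mesh_pos[of m] by (simp add: g_Suc)

lemma g_mono: "l \<le> k \<Longrightarrow> g m l \<le> g m k" using mesh_pos[of m] by (simp add: g_def mult_right_mono)

lemma g_refine: "g (n + r) (k * 2 ^ r) = g n k"
  using mesh_refine[of r n] by (simp add: g_def mult.assoc[symmetric] mult.commute[of "mesh n"])

lemma g_top: "g n (2 ^ n) = T" by (simp add: g_def mesh_def)

lemma g_le_T: "l \<le> 2 ^ n \<Longrightarrow> g n l \<le> T" using g_mono[of l "2 ^ n" n] by (simp add: g_top)

lemma subdivision_g: "subdivision (g m K) K (g m)"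
  by (auto simp: subdivision_def g_less less_imp_le)

lemma X_adapted: "0 \<le> t \<Longrightarrow> X t \<in> borel_measurable (F t)"
  using sol by (auto simp: stratonovich_solution_def adapted_def)

lemma X_measurable[measurable]: "0 \<le> t \<Longrightarrow> X t \<in> borel_measurable M"
  using X_adapted F_measurable_M by blast

lemma Xg_measurable[measurable]: "X (g m l) \<in> borel_measurable M" by (rule X_measurable) simp

lemma Wg_measurable[measurable]: "W j (g m l) \<in> borel_measurable M" by (rule W_measurable) simp

lemma dW_measurable[measurable]: "dW j m l \<in> borel_measurable M" unfolding dW_def by measurable

lemma strat_step_measurable[measurable]: "strat_step m l \<in> borel_measurable M" unfolding strat_step_def by measurable

lemma X_continuous: "AE \<omega> in M. continuous_on {0..} (\<lambda>t. X t \<omega>)"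
  using sol by (simp add: stratonovich_solution_def continuous_paths_def)

lemma W_continuous: "AE \<omega> in M. continuous_on {0..} (\<lambda>t. W j t \<omega>)"
  using BM by (simp add: independent_brownian_motions_def brownian_motion_def continuous_paths_def)

lemma uniform_modulus:
  fixes f :: "real \<Rightarrow> 'b::metric_space"
  assumes "continuous_on {0..} f" "\<epsilon> > 0" "0 \<le> S"
  obtains \<delta> where "\<delta> > 0" "\<And>s t. 0 \<le> s \<Longrightarrow> s \<le> S \<Longrightarrow> 0 \<le> t \<Longrightarrow> t \<le> S \<Longrightarrow> \<bar>s - t\<bar> < \<delta> \<Longrightarrow> dist (f s) (f t) < \<epsilon>"
proof -
  have "continuous_on {0..S} f" by (rule continuous_on_subset[OF assms(1)]) auto
  then have "uniformly_continuous_on {0..S} f" by (intro compact_uniformly_continuous) auto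
  from this[unfolded uniformly_continuous_on_def, rule_format, OF assms(2)] obtain \<delta> where
    "\<delta> > 0" "\<forall>x\<in>{0..S}. \<forall>x'\<in>{0..S}. dist x' x < \<delta> \<longrightarrow> dist (f x') (f x) < \<epsilon>" by blast
  then show ?thesis by (intro that[of \<delta>]) (auto simp: dist_real_def)
qed

lemma riemann_sum_tendsto:
  fixes f :: "real \<Rightarrow> 'b::euclidean_space"
  assumes f: "continuous_on {0..} f"
  shows "(\<lambda>r. integral {0..g n k} f - (\<Sum>l<k * 2 ^ r. mesh (n + r) *\<^sub>R f (g (n + r) l))) \<longlonglongrightarrow> 0"
proof (rule LIMSEQ_I)
  fix e :: real assume "e > 0"
  \<comment> \<open>The added 1 avoids a division by zero for k = 0, and the factor 2 makes the
    final bound strict.\<close>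
  define \<epsilon> where "\<epsilon> = e / (g n k + 1) / 2"
  have gp: "g n k + 1 > 0" using g_nonneg[of n k] by linarith
  have \<epsilon>: "\<epsilon> > 0" using \<open>e > 0\<close> gp by (simp add: \<epsilon>_def)
  from uniform_modulus[OF f this g_nonneg[of n k]] obtain \<delta> where \<delta>: "\<delta> > 0"
    "\<And>s t. 0 \<le> s \<Longrightarrow> s \<le> g n k \<Longrightarrow> 0 \<le> t \<Longrightarrow> t \<le> g n k \<Longrightarrow> \<bar>s - t\<bar> < \<delta> \<Longrightarrow> dist (f s) (f t) < \<epsilon>" by blast
  have "(\<lambda>r. mesh (n + r)) \<longlonglongrightarrow> 0" using LIMSEQ_ignore_initial_segment[OF mesh_tendsto, of n] by (simp add: add.commute)
  from order_tendstoD(2)[OF this \<delta>(1)] obtain R where R: "\<And>r. r \<ge> R \<Longrightarrow> mesh (n + r) < \<delta>"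
    by (auto simp: eventually_sequentially)
  have "norm (integral {0..g n k} f - (\<Sum>l<k * 2 ^ r. mesh (n + r) *\<^sub>R f (g (n + r) l))) < e" if "r \<ge> R" for r
  proof -
    let ?m = "n + r" and ?K = "k * 2 ^ r"
    have top: "real ?K * mesh ?m = g n k" using g_refine[of n r k] by (simp add: g_def)
    have "norm (integral {0..real ?K * mesh ?m} f - (\<Sum>l<?K. mesh ?m *\<^sub>R f (real l * mesh ?m))) \<le> \<epsilon> * (real ?K * mesh ?m)"
    proof (rule riemann_sum_error)
      show "continuous_on {0..real ?K * mesh ?m} f" by (rule continuous_on_subset[OF f]) auto
      show "0 \<le> mesh ?m" using mesh_pos[of ?m] by simp
      fix l t assume l: "l < ?K" and t: "real l * mesh ?m \<le> t" "t \<le> real (Suc l) * mesh ?m"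
      have 1: "0 \<le> real l * mesh ?m" using mesh_pos[of ?m] by simp
      have "real (Suc l) \<le> real ?K" using l by (intro of_nat_mono) simp
      then have "real (Suc l) * mesh ?m \<le> real ?K * mesh ?m"
        using mesh_pos[of ?m] by (intro mult_right_mono) auto
      then have 2: "t \<le> g n k" using t top by linarith
      have "real (Suc l) * mesh ?m = real l * mesh ?m + mesh ?m" by (simp add: algebra_simps)
      then have "\<bar>t - real l * mesh ?m\<bar> < \<delta> \<or> t - real l * mesh ?m = mesh ?m" using t R[OF that] by linarith
      then have "\<bar>t - real l * mesh ?m\<bar> < \<delta>" using R[OF that] mesh_pos[of ?m] by auto
      then have "dist (f t) (f (real l * mesh ?m)) < \<epsilon>"
        using 1 2 t by (intro \<delta>(2)) auto
      then show "norm (f t - f (real l * mesh ?m)) \<le> \<epsilon>" by (simp add: dist_norm)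
    qed
    then have "norm (integral {0..g n k} f - (\<Sum>l<?K. mesh ?m *\<^sub>R f (g ?m l))) \<le> \<epsilon> * g n k"
      unfolding top by (simp add: g_def)
    also have "\<dots> < e"
    proof -
      have "\<epsilon> * g n k \<le> \<epsilon> * (g n k + 1)" using \<epsilon> by simp
      also have "\<dots> = e / 2"
        unfolding \<epsilon>_def using gp by (metis (no_types, lifting) divide_divide_eq_left mult.commute nonzero_eq_divide_eq order_less_irrefl times_divide_eq_right)
      finally show ?thesis using \<open>e > 0\<close> by simp
    qed
    finally show ?thesis .
  qed
  then show "\<exists>no. \<forall>r\<ge>no. norm (integral {0..g n k} f - (\<Sum>l<k * 2 ^ r. mesh (n + r) *\<^sub>R f (g (n + r) l)) - 0) < e"
    by auto
qed

section \<open>Expansion of the solution in symmetric steps\<close>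

lemma stratonovich_sum_null:
  assumes J: "has_stratonovich_integral M Y (W j) (g n k) J"
    and Y[measurable]: "\<And>m l. Y (g m l) \<in> borel_measurable M"
  shows "null_in_prob M (\<lambda>r \<omega>. J \<omega> - (\<Sum>l<k * 2 ^ r. dW j (n + r) l \<omega> *\<^sub>R ((1/2) *\<^sub>R (Y (g (n + r) l) \<omega> + Y (g (n + r) (Suc l)) \<omega> :: real^'n))))"
proof (rule null_in_probI_tail)
  have [measurable]: "J \<in> borel_measurable M" using J by (simp add: has_stratonovich_integral_def)
  have eq: "stratonovich_sum Y (W j) (k * 2 ^ r) (g (n + r)) \<omega>
    = (\<Sum>l<k * 2 ^ r. dW j (n + r) l \<omega> *\<^sub>R ((1/2) *\<^sub>R (Y (g (n + r) l) \<omega> + Y (g (n + r) (Suc l)) \<omega>)))" for r \<omega>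
    by (simp add: stratonovich_sum_def dW_def)
  show "(\<lambda>\<omega>. J \<omega> - (\<Sum>l<k * 2 ^ r. dW j (n + r) l \<omega> *\<^sub>R ((1/2) *\<^sub>R (Y (g (n + r) l) \<omega> + Y (g (n + r) (Suc l)) \<omega>)))) \<in> borel_measurable M" for r
    by measurable
  fix e :: real assume e: "e > 0"
  show "(\<lambda>r. prob {\<omega>\<in>space M. e < norm (J \<omega> - (\<Sum>l<k * 2 ^ r. dW j (n + r) l \<omega> *\<^sub>R ((1/2) *\<^sub>R (Y (g (n + r) l) \<omega> + Y (g (n + r) (Suc l)) \<omega>))))}) \<longlonglongrightarrow> 0"
  proof (rule LIMSEQ_I)
    fix \<eta> :: real assume \<eta>: "\<eta> > 0"
    obtain \<delta> where \<delta>: "\<delta> > 0" and \<delta>2: "\<forall>N p. subdivision (g n k) N p \<and> (\<forall>i<N. p (Suc i) - p i < \<delta>) \<longrightarrow>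
          prob {\<omega> \<in> space M. norm (stratonovich_sum Y (W j) N p \<omega> - J \<omega>) > e} < \<eta>"
      using stratonovich_integral_ex[OF J e \<eta>] by (elim exE conjE)
    have "(\<lambda>r. mesh (n + r)) \<longlonglongrightarrow> 0" using LIMSEQ_ignore_initial_segment[OF mesh_tendsto, of n] by (simp add: add.commute)
    from order_tendstoD(2)[OF this \<delta>] obtain R where R: "\<And>r. r \<ge> R \<Longrightarrow> mesh (n + r) < \<delta>"
      by (auto simp: eventually_sequentially)
    have "prob {\<omega> \<in> space M. norm (stratonovich_sum Y (W j) (k * 2 ^ r) (g (n + r)) \<omega> - J \<omega>) > e} < \<eta>" if "r \<ge> R" for r
    proof (rule \<delta>2[THEN spec, THEN spec, THEN mp], intro conjI)
      show "subdivision (g n k) (k * 2 ^ r) (g (n + r))"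
        using subdivision_g[of "n + r" "k * 2 ^ r"] by (simp only: g_refine)
      show "\<forall>i<k * 2 ^ r. g (n + r) (Suc i) - g (n + r) i < \<delta>" using R[OF that] by (simp add: g_Suc)
    qed
    then show "\<exists>no. \<forall>r\<ge>no. norm (prob {\<omega>\<in>space M. e < norm (J \<omega> - (\<Sum>l<k * 2 ^ r. dW j (n + r) l \<omega> *\<^sub>R ((1/2) *\<^sub>R (Y (g (n + r) l) \<omega> + Y (g (n + r) (Suc l)) \<omega>))))} - 0) < \<eta>"
      by (auto simp: eq norm_minus_commute)
  qed
qed

lemma strat_expansion:
  "null_in_prob M (\<lambda>r \<omega>. X (g n k) \<omega> - x - (\<Sum>l<k * 2 ^ r. strat_step (n + r) l \<omega>))"
proof -
  have "\<exists>J :: 'l \<Rightarrow> real \<Rightarrow> 'a \<Rightarrow> real^'n.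
        (\<forall>j. \<forall>t\<ge>0. has_stratonovich_integral M (\<lambda>s \<omega>. B j *v X s \<omega>) (W j) t (J j t)) \<and>
        (\<forall>t\<ge>0. AE \<omega> in M. X t \<omega> = x + integral {0..t} (\<lambda>s. A *v X s \<omega>) + (\<Sum>j\<in>UNIV. J j t \<omega>))"
    using sol unfolding stratonovich_solution_def by (elim conjE)
  then obtain J :: "'l \<Rightarrow> real \<Rightarrow> 'a \<Rightarrow> real^'n" where
    J0: "\<forall>j. \<forall>t\<ge>0. has_stratonovich_integral M (\<lambda>s \<omega>. B j *v X s \<omega>) (W j) t (J j t)"
    and eq0: "\<forall>t\<ge>0. AE \<omega> in M. X t \<omega> = x + integral {0..t} (\<lambda>s. A *v X s \<omega>) + (\<Sum>j\<in>UNIV. J j t \<omega>)"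
    by (elim exE conjE)
  have J: "has_stratonovich_integral M (\<lambda>s \<omega>. B j *v X s \<omega>) (W j) (g n k) (J j (g n k))" for j
    using J0 g_nonneg[of n k] by simp
  have eq: "AE \<omega> in M. X (g n k) \<omega> = x + integral {0..g n k} (\<lambda>s. A *v X s \<omega>) + (\<Sum>j\<in>UNIV. J j (g n k) \<omega>)"
    by (rule eq0[THEN spec, THEN mp, OF g_nonneg])
  have Jm[measurable]: "J j (g n k) \<in> borel_measurable M" for j using J[of j] by (simp add: has_stratonovich_integral_def)
  \<comment> \<open>The drift error tends to zero along almost every path, the noise errors
    \<open>S\<close> only in probability.\<close>
  define D where "D r \<omega> = X (g n k) \<omega> - x - (\<Sum>j\<in>UNIV. J j (g n k) \<omega>) - (\<Sum>l<k * 2 ^ r. mesh (n + r) *\<^sub>R (A *v X (g (n + r) l) \<omega>))" for r \<omega>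
  have D: "null_in_prob M D"
  proof (rule null_in_prob_AE)
    show "D r \<in> borel_measurable M" for r unfolding D_def by measurable
    show "AE \<omega> in M. (\<lambda>r. D r \<omega>) \<longlonglongrightarrow> 0"
      using eq X_continuous
    proof eventually_elim
      case (elim \<omega>)
      have "continuous_on {0..} (\<lambda>s. A *v X s \<omega>)"
        by (rule linear_continuous_on_compose[OF elim(2) matrix_vector_mul_linear])
      from riemann_sum_tendsto[OF this, of n k]
      show ?case unfolding D_def elim(1) by simp
    qed
  qed
  define S where "S j r \<omega> = J j (g n k) \<omega> - (\<Sum>l<k * 2 ^ r. dW j (n + r) l \<omega> *\<^sub>R ((1/2) *\<^sub>R (B j *v X (g (n + r) l) \<omega> + B j *v X (g (n + r) (Suc l)) \<omega>)))" for j r \<omega>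
  have S: "null_in_prob M (S j)" for j
    unfolding S_def by (rule stratonovich_sum_null[OF J]) measurable
  have "null_in_prob M (\<lambda>r \<omega>. D r \<omega> + (\<Sum>j\<in>UNIV. S j r \<omega>))"
    by (intro null_in_prob_add D null_in_prob_sum S)
  moreover have "D r \<omega> + (\<Sum>j\<in>UNIV. S j r \<omega>) = X (g n k) \<omega> - x - (\<Sum>l<k * 2 ^ r. strat_step (n + r) l \<omega>)" for r \<omega>
  proof -
    have "(\<Sum>l<k * 2 ^ r. strat_step (n + r) l \<omega>) = (\<Sum>l<k * 2 ^ r. mesh (n + r) *\<^sub>R (A *v X (g (n + r) l) \<omega>)) +
      (\<Sum>j\<in>UNIV. \<Sum>l<k * 2 ^ r. dW j (n + r) l \<omega> *\<^sub>R ((1/2) *\<^sub>R (B j *v X (g (n + r) l) \<omega> + B j *v X (g (n + r) (Suc l)) \<omega>)))"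
      unfolding strat_step_def sum.distrib
      by (subst sum.swap) (simp add: matrix_vector_right_distrib matrix_vector_mult_scaleR)
    then show ?thesis by (simp add: D_def S_def sum_subtractf)
  qed
  ultimately show ?thesis by simp
qed

text \<open>The equation is available only for integrals that start at 0, so the expansion over a
  cell is the difference of two expansions from 0.\<close>

lemma strat_cell_expansion:
  "null_in_prob M (\<lambda>r \<omega>. X (g n (Suc k)) \<omega> - X (g n k) \<omega> - (\<Sum>l<2 ^ r. strat_step (n + r) (k * 2 ^ r + l) \<omega>))"
proof -
  have "null_in_prob M (\<lambda>r \<omega>. (X (g n (Suc k)) \<omega> - x - (\<Sum>l<Suc k * 2 ^ r. strat_step (n + r) l \<omega>))
     - (X (g n k) \<omega> - x - (\<Sum>l<k * 2 ^ r. strat_step (n + r) l \<omega>)))"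
    by (intro null_in_prob_diff strat_expansion)
  moreover have "(X (g n (Suc k)) \<omega> - x - (\<Sum>l<Suc k * 2 ^ r. strat_step (n + r) l \<omega>))
     - (X (g n k) \<omega> - x - (\<Sum>l<k * 2 ^ r. strat_step (n + r) l \<omega>)) =
     X (g n (Suc k)) \<omega> - X (g n k) \<omega> - (\<Sum>l<2 ^ r. strat_step (n + r) (k * 2 ^ r + l) \<omega>)" for r \<omega>
  proof -
    have eq: "Suc k * 2 ^ r = k * 2 ^ r + 2 ^ r" by simp
    show ?thesis unfolding eq sum_lessThan_add by simp
  qed
  ultimately show ?thesis by (simp only:)
qed

section \<open>Path bounds and oscillations on the grid\<close>

lemma X_grid_bounded: "AE \<omega> in M. \<exists>K. \<forall>m l. l \<le> 2 ^ m \<longrightarrow> norm (X (g m l) \<omega>) \<le> K"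
  using X_continuous
proof eventually_elim
  case (elim \<omega>)
  then have "continuous_on {0..T} (\<lambda>t. X t \<omega>)" by (rule continuous_on_subset) auto
  then have "bounded ((\<lambda>t. X t \<omega>) ` {0..T})" by (intro compact_imp_bounded compact_continuous_image) auto
  then obtain K where K0: "\<forall>t\<in>{0..T}. norm (X t \<omega>) \<le> K" by (auto simp: bounded_iff)
  then show ?case using g_le_T by (intro exI[of _ K]) auto
qed

lemma X_grid_bounded_event:
  assumes "\<eta> > 0"
  obtains c E where "c > 0" "E \<in> events" "prob E \<le> \<eta>"
    "\<And>\<omega> m l. \<omega> \<in> space M \<Longrightarrow> \<omega> \<notin> E \<Longrightarrow> l \<le> 2 ^ m \<Longrightarrow> norm (X (g m l) \<omega>) \<le> c"
proof -
  define Y where "Y ml \<omega> = (if snd ml \<le> 2 ^ fst ml then norm (X (g (fst ml) (snd ml)) \<omega>) else 0)" for ml :: "nat \<times> nat" and \<omega>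
  have Ym: "Y ml \<in> borel_measurable M" for ml
    by (cases "snd ml \<le> 2 ^ fst ml") (auto simp: Y_def[abs_def])
  have "AE \<omega> in M. \<exists>K. \<forall>ml. \<bar>Y ml \<omega>\<bar> \<le> K"
    using X_grid_bounded
  proof eventually_elim
    case (elim \<omega>)
    then obtain K where K: "\<And>m l. l \<le> 2 ^ m \<Longrightarrow> norm (X (g m l) \<omega>) \<le> K" by blast
    have "0 \<le> K" using K[of 0 0] norm_ge_zero order_trans by blast
    then show ?case using K by (intro exI[of _ K]) (auto simp: Y_def)
  qed
  from AE_bounded_event[OF Ym this assms] obtain c where
    c: "c > 0" "{\<omega> \<in> space M. \<exists>i. c < \<bar>Y i \<omega>\<bar>} \<in> events" "prob {\<omega> \<in> space M. \<exists>i. c < \<bar>Y i \<omega>\<bar>} \<le> \<eta>" .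
  show ?thesis
  proof (rule that[OF c])
    fix \<omega> and m l :: nat assume "\<omega> \<in> space M" "\<omega> \<notin> {\<omega> \<in> space M. \<exists>i. c < \<bar>Y i \<omega>\<bar>}" "l \<le> 2 ^ m"
    then have "\<not> c < \<bar>Y (m, l) \<omega>\<bar>" by blast
    then show "norm (X (g m l) \<omega>) \<le> c" using \<open>l \<le> 2 ^ m\<close> by (simp add: Y_def)
  qed
qed

text \<open>The oscillation within cells is taken over all refinements r at once, so that the event
  does not depend on the depth chosen later; being a countable union, it is measurable.\<close>

definition X_modulus_event :: "real \<Rightarrow> nat \<Rightarrow> 'a set" where
  "X_modulus_event \<epsilon> n = {\<omega>\<in>space M. \<exists>r k l. k < 2 ^ n \<and> l < 2 ^ r \<and> \<epsilon> < norm (X (g (n + r) (k * 2 ^ r + l)) \<omega> - X (g n k) \<omega>)}"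

lemma X_modulus_event_measurable[measurable]: "X_modulus_event \<epsilon> n \<in> events"
  unfolding X_modulus_event_def by measurable

lemma subcell_bounds:
  assumes "k < 2 ^ n" "l < 2 ^ r"
  shows "g n k \<le> g (n + r) (k * 2 ^ r + l)" "g (n + r) (k * 2 ^ r + l) \<le> g n k + mesh n" "g (n + r) (k * 2 ^ r + l) \<le> T"
proof -
  have *: "k * 2 ^ r + l \<le> Suc k * 2 ^ r" using assms by simp
  show "g n k \<le> g (n + r) (k * 2 ^ r + l)" using g_mono[of "k * 2 ^ r" "k * 2 ^ r + l" "n + r"] by (simp add: g_refine)
  have "g (n + r) (k * 2 ^ r + l) \<le> g n (Suc k)" using g_mono[OF *, of "n + r"] by (simp only: g_refine)
  then show "g (n + r) (k * 2 ^ r + l) \<le> g n k + mesh n" "g (n + r) (k * 2 ^ r + l) \<le> T"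
    using g_le_T[of "Suc k" n] assms by (auto simp: g_Suc)
qed

lemma X_modulus_event_prob:
  assumes "\<epsilon> > 0" shows "(\<lambda>n. prob (X_modulus_event \<epsilon> n)) \<longlonglongrightarrow> 0"
proof (rule prob_tendsto_0_AE[OF X_modulus_event_measurable])
  show "AE \<omega> in M. \<forall>\<^sub>F n in sequentially. \<omega> \<notin> X_modulus_event \<epsilon> n"
    using X_continuous
  proof eventually_elim
    case (elim \<omega>)
    from uniform_modulus[OF elim assms less_imp_le[OF T_pos]] obtain \<delta> where \<delta>: "\<delta> > 0"
      "\<And>s t. 0 \<le> s \<Longrightarrow> s \<le> T \<Longrightarrow> 0 \<le> t \<Longrightarrow> t \<le> T \<Longrightarrow> \<bar>s - t\<bar> < \<delta> \<Longrightarrow> dist (X s \<omega>) (X t \<omega>) < \<epsilon>" by blast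
    from order_tendstoD(2)[OF mesh_tendsto \<delta>(1)] show ?case
    proof eventually_elim
      case (elim n)
      show ?case
      proof
        assume "\<omega> \<in> X_modulus_event \<epsilon> n"
        then obtain r k l where *: "k < 2 ^ n" "l < 2 ^ r" "\<epsilon> < norm (X (g (n + r) (k * 2 ^ r + l)) \<omega> - X (g n k) \<omega>)"
          by (auto simp: X_modulus_event_def)
        have "dist (X (g (n + r) (k * 2 ^ r + l)) \<omega>) (X (g n k) \<omega>) < \<epsilon>"
          by (rule \<delta>(2)) (use subcell_bounds[OF *(1,2)] elim g_le_T[of k n] *(1) in auto)
        then show False using *(3) by (simp add: dist_norm)
      qed
    qed
  qed
qed

definition dW_max :: "'l \<Rightarrow> nat \<Rightarrow> 'a \<Rightarrow> real" where
  "dW_max j n \<omega> = Max ((\<lambda>k. \<bar>dW j n k \<omega>\<bar>) ` {..<2 ^ n})"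

lemma dW_le_max: "k < 2 ^ n \<Longrightarrow> \<bar>dW j n k \<omega>\<bar> \<le> dW_max j n \<omega>"
  unfolding dW_max_def by (rule Max_ge) auto

text \<open>Uniform continuity of the path, without any rate. This is what makes an outer Brownian
  increment negligible against sums that are bounded in probability.\<close>

lemma dW_max_null: "null_in_prob M (dW_max j)"
proof (rule null_in_prob_AE)
  show "dW_max j n \<in> borel_measurable M" for n
    unfolding dW_max_def[abs_def] by (rule borel_measurable_Max) auto
  show "AE \<omega> in M. (\<lambda>n. dW_max j n \<omega>) \<longlonglongrightarrow> 0"
    using W_continuous[of j]
  proof eventually_elim
    case (elim \<omega>)
    show ?case
    proof (rule LIMSEQ_I)
      fix e :: real assume "e > 0"
      from uniform_modulus[OF elim this less_imp_le[OF T_pos]] obtain \<delta> where \<delta>: "\<delta> > 0"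
      "\<And>s t. 0 \<le> s \<Longrightarrow> s \<le> T \<Longrightarrow> 0 \<le> t \<Longrightarrow> t \<le> T \<Longrightarrow> \<bar>s - t\<bar> < \<delta> \<Longrightarrow> dist (W j s \<omega>) (W j t \<omega>) < e" by blast
      from order_tendstoD(2)[OF mesh_tendsto \<delta>(1)] obtain N where N: "\<And>n. n \<ge> N \<Longrightarrow> mesh n < \<delta>"
        by (auto simp: eventually_sequentially)
      have "norm (dW_max j n \<omega> - 0) < e" if "n \<ge> N" for n
      proof -
        have "\<bar>dW j n k \<omega>\<bar> < e" if "k < 2 ^ n" for k
        proof -
          have "dist (W j (g n (Suc k)) \<omega>) (W j (g n k) \<omega>) < e"
            by (rule \<delta>(2)) (use N[OF \<open>n \<ge> N\<close>] mesh_pos[of n] g_le_T[of k n] g_le_T[of "Suc k" n] that in \<open>auto simp: g_Suc\<close>)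
          then show ?thesis by (simp add: dW_def dist_real_def)
        qed
        moreover have "dW_max j n \<omega> \<in> (\<lambda>k. \<bar>dW j n k \<omega>\<bar>) ` {..<2 ^ n}"
          unfolding dW_max_def by (rule Max_in) (auto simp: lessThan_empty_iff)
        ultimately show ?thesis by auto
      qed
      then show "\<exists>no. \<forall>n\<ge>no. norm (dW_max j n \<omega> - 0) < e" by blast
    qed
  qed
qed

end

section \<open>From the Stratonovich to the Ito form\<close>

lemma norm_add_scaled_square:
  fixes S v :: "'b::real_inner"
  shows "(norm (S + d *\<^sub>R v))\<^sup>2 = (norm S)\<^sup>2 + 2 * ((S \<bullet> v) * d) + d\<^sup>2 * (norm v)\<^sup>2"
  unfolding power2_norm_eq_inner
  by (simp add: inner_add_left inner_add_right inner_commute power2_eq_square algebra_simps)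

lemma abs_inner_le_squares: "\<bar>a \<bullet> b\<bar> \<le> (norm a)\<^sup>2 + (norm b)\<^sup>2" for a b :: "'b::real_inner"
  using Cauchy_Schwarz_ineq2[of a b] abs_mult_le_squares[of "norm a" "norm b"] by simp

lemma matvec_bound:
  fixes A :: "real^'n^'m"
  obtains c where "c > 0" "\<And>v. norm (A *v v) \<le> c * norm v"
proof -
  obtain K where "K > 0" "\<forall>v. norm (A *v v) \<le> norm v * K"
    using bounded_linear.pos_bounded[OF matrix_vector_mul_bounded_linear[of A]] by blast
  then show ?thesis by (intro that[of K]) (auto simp: mult.commute)
qed

lemma sum_matrix_vector_mult: "(\<Sum>j\<in>S. f j) *v v = (\<Sum>j\<in>S. f j *v v)"
  for f :: "'i \<Rightarrow> real^'n^'m"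
  by (induction S rule: infinite_finite_induct) (simp_all add: matrix_vector_mult_add_rdistrib)

context prob_space
begin

text \<open>The comparison sequence may depend on \<open>\<eta>\<close>, typically through a
  truncation level that is inactive outside the event E.\<close>

lemma null_in_prob_localize:
  fixes Z :: "nat \<Rightarrow> 'a \<Rightarrow> 'b::{second_countable_topology,real_normed_vector}"
  assumes meas: "\<And>n. Z n \<in> borel_measurable M"
    and loc: "\<And>\<eta>. \<eta> > 0 \<Longrightarrow> \<exists>E Z'. E \<in> events \<and> prob E \<le> \<eta> \<and> null_in_prob M Z' \<and>
       (\<forall>n. \<forall>\<omega>\<in>space M. \<omega> \<notin> E \<longrightarrow> norm (Z n \<omega>) \<le> norm (Z' n \<omega> :: 'b))"
  shows "null_in_prob M Z"
proof (rule null_in_probI_bad[OF meas])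
  fix \<eta> :: real assume "\<eta> > 0"
  then have \<eta>2: "\<eta> / 2 > 0" by simp
  from loc[OF this] obtain E Z' where E: "E \<in> events" "prob E \<le> \<eta> / 2" and Z': "null_in_prob M Z'"
    and le: "\<And>n \<omega>. \<omega> \<in> space M \<Longrightarrow> \<omega> \<notin> E \<Longrightarrow> norm (Z n \<omega>) \<le> norm (Z' n \<omega> :: 'b)" by blast
  have Zm[measurable]: "Z' n \<in> borel_measurable M" for n using Z' by (rule null_in_prob_measurable)
  from order_tendstoD(2)[OF null_in_prob_tail[OF Z' \<open>\<eta> > 0\<close>] \<eta>2]
  show "\<forall>\<^sub>F n in sequentially. \<exists>E U. E \<in> events \<and> prob E \<le> \<eta> \<and> integrable M U \<and>
       expectation U \<le> \<eta> \<and> (AE \<omega> in M. 0 \<le> U \<omega>) \<and> (AE \<omega> in M. \<omega> \<notin> E \<longrightarrow> norm (Z n \<omega>) \<le> U \<omega>)"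
  proof eventually_elim
    case (elim n)
    define E' where "E' = E \<union> {\<omega>\<in>space M. \<eta> < norm (Z' n \<omega>)}"
    have E'm: "E' \<in> events" unfolding E'_def using E by measurable
    have "prob E' \<le> prob E + prob {\<omega>\<in>space M. \<eta> < norm (Z' n \<omega>)}"
      unfolding E'_def by (rule measure_Un_le) (use E in auto)
    then have 1: "prob E' \<le> \<eta>" using elim E by simp
    have 2: "norm (Z n \<omega>) \<le> \<eta>" if "\<omega> \<in> space M" "\<omega> \<notin> E'" for \<omega>
      using le[of \<omega> n] that by (auto simp: E'_def not_less)
    show ?case
      by (rule exI[of _ E'], rule exI[of _ "\<lambda>_. \<eta>"]) (use 1 2 E'm \<open>\<eta> > 0\<close> in \<open>auto simp: prob_space\<close>)
  qed
qed

end

context usual_filtered_prob_space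
begin

text \<open>Pythagoras for martingale differences: the cross term pairs \<open>d k\<close> with an
  integrable factor from the past. The differences are abstract because both Brownian increments and
  compensated products of two increments are inserted for \<open>d\<close>.\<close>

lemma martingale_sum_L2:
  fixes v :: "nat \<Rightarrow> 'a \<Rightarrow> 'b::euclidean_space" and d :: "nat \<Rightarrow> 'a \<Rightarrow> real"
  assumes t0: "\<And>l. 0 \<le> t l" and tm: "\<And>l. t l \<le> t (Suc l)"
    and v: "\<And>l. l < K \<Longrightarrow> v l \<in> borel_measurable (F (t l))"
    and d: "\<And>l. l < K \<Longrightarrow> d l \<in> borel_measurable (F (t (Suc l)))"
    and vL2: "\<And>l. l < K \<Longrightarrow> integrable M (\<lambda>\<omega>. (norm (v l \<omega>))\<^sup>2)"
    and orth: "\<And>l U. l < K \<Longrightarrow> U \<in> borel_measurable (F (t l)) \<Longrightarrow> integrable M U \<Longrightarrow>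
       integrable M (\<lambda>\<omega>. U \<omega> * d l \<omega>) \<and> expectation (\<lambda>\<omega>. U \<omega> * d l \<omega>) = 0"
    and sq: "\<And>l. l < K \<Longrightarrow> integrable M (\<lambda>\<omega>. (d l \<omega>)\<^sup>2 * (norm (v l \<omega>))\<^sup>2) \<and>
       expectation (\<lambda>\<omega>. (d l \<omega>)\<^sup>2 * (norm (v l \<omega>))\<^sup>2) \<le> b l"
  shows "integrable M (\<lambda>\<omega>. (norm (\<Sum>l<K. d l \<omega> *\<^sub>R v l \<omega>))\<^sup>2)"
    and "expectation (\<lambda>\<omega>. (norm (\<Sum>l<K. d l \<omega> *\<^sub>R v l \<omega>))\<^sup>2) \<le> (\<Sum>l<K. b l)"
proof -
  have tmono: "t l \<le> t k" if "l \<le> k" for l k by (rule lift_Suc_mono_le[OF _ that]) (rule tm)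
  have main: "integrable M (\<lambda>\<omega>. (norm (\<Sum>l<k. d l \<omega> *\<^sub>R v l \<omega>))\<^sup>2) \<and>
    expectation (\<lambda>\<omega>. (norm (\<Sum>l<k. d l \<omega> *\<^sub>R v l \<omega>))\<^sup>2) \<le> (\<Sum>l<k. b l)" if "k \<le> K" for k
    using that
  proof (induction k)
    case (Suc k)
    define S where "S \<omega> = (\<Sum>l<k. d l \<omega> *\<^sub>R v l \<omega>)" for \<omega>
    have kK: "k < K" using Suc.prems by simp
    have IH: "integrable M (\<lambda>\<omega>. (norm (S \<omega>))\<^sup>2)" "expectation (\<lambda>\<omega>. (norm (S \<omega>))\<^sup>2) \<le> (\<Sum>l<k. b l)"
      using Suc by (auto simp: S_def)
    have SF: "S \<in> borel_measurable (F (t k))"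
      unfolding S_def
    proof (intro borel_measurable_sum borel_measurable_scaleR)
      fix l assume l: "l \<in> {..<k}"
      show "d l \<in> borel_measurable (F (t k))" using l kK by (intro F_measurable_mono[OF tmono d]) auto
      show "v l \<in> borel_measurable (F (t k))" using l kK by (intro F_measurable_mono[OF tmono v]) auto
    qed
    have UF: "(\<lambda>\<omega>. S \<omega> \<bullet> v k \<omega>) \<in> borel_measurable (F (t k))"
      using SF v[OF kK] by (rule borel_measurable_inner)
    have Uint: "integrable M (\<lambda>\<omega>. S \<omega> \<bullet> v k \<omega>)"
    proof (rule Bochner_Integration.integrable_bound[where f="\<lambda>\<omega>. (norm (S \<omega>))\<^sup>2 + (norm (v k \<omega>))\<^sup>2"])
      show "(\<lambda>\<omega>. S \<omega> \<bullet> v k \<omega>) \<in> borel_measurable M" by (rule F_measurable_M[OF t0 UF])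
      have "norm (S \<omega> \<bullet> v k \<omega>) \<le> norm ((norm (S \<omega>))\<^sup>2 + (norm (v k \<omega>))\<^sup>2)" for \<omega>
        using abs_inner_le_squares[of "S \<omega>" "v k \<omega>"] by simp
      then show "AE \<omega> in M. norm (S \<omega> \<bullet> v k \<omega>) \<le> norm ((norm (S \<omega>))\<^sup>2 + (norm (v k \<omega>))\<^sup>2)" by simp
    qed (intro Bochner_Integration.integrable_add IH vL2 kK)
    note o = orth[OF kK UF Uint] and s = sq[OF kK]
    have eq: "(norm (\<Sum>l<Suc k. d l \<omega> *\<^sub>R v l \<omega>))\<^sup>2 =
      (norm (S \<omega>))\<^sup>2 + 2 * ((S \<omega> \<bullet> v k \<omega>) * d k \<omega>) + (d k \<omega>)\<^sup>2 * (norm (v k \<omega>))\<^sup>2" for \<omega>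
      by (simp add: S_def norm_add_scaled_square)
    show ?case
      unfolding eq using o s IH by simp
  qed simp
  show "integrable M (\<lambda>\<omega>. (norm (\<Sum>l<K. d l \<omega> *\<^sub>R v l \<omega>))\<^sup>2)"
    and "expectation (\<lambda>\<omega>. (norm (\<Sum>l<K. d l \<omega> *\<^sub>R v l \<omega>))\<^sup>2) \<le> (\<Sum>l<K. b l)"
    using main[of K] by auto
qed

end

context stratonovich_setting
begin

section \<open>Orthogonality of Brownian increments along the grid\<close>

lemma Xg_adapted: "X (g m l) \<in> borel_measurable (F (g m l))" by (rule X_adapted) simp

lemma dW_adapted: "dW j m l \<in> borel_measurable (F (g m (Suc l)))"
proof -
  have [measurable]: "W j (g m (Suc l)) \<in> borel_measurable (F (g m (Suc l)))" "W j (g m l) \<in> borel_measurable (F (g m (Suc l)))"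
    by (rule W_adapted, simp) (rule F_measurable_mono[OF g_mono W_adapted], simp_all)
  show ?thesis unfolding dW_def by measurable
qed

lemma dW_mult1:
  assumes "U \<in> borel_measurable (F (g m l))" "integrable M U"
  shows "integrable M (\<lambda>\<omega>. U \<omega> * dW j m l \<omega>) \<and> expectation (\<lambda>\<omega>. U \<omega> * dW j m l \<omega>) = 0"
  unfolding dW_def by (intro conjI W_increment_mult1[OF g_nonneg g_less assms])

lemma dW_mult2:
  assumes "U \<in> borel_measurable (F (g m l))" "integrable M U"
  shows "integrable M (\<lambda>\<omega>. U \<omega> * (dW j m l \<omega>)\<^sup>2) \<and> expectation (\<lambda>\<omega>. U \<omega> * (dW j m l \<omega>)\<^sup>2) = expectation U * mesh m"
  unfolding dW_def using W_increment_mult2[OF g_nonneg g_less assms] by (simp add: g_Suc)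

lemma dW_cross:
  assumes "i \<noteq> j" "U \<in> borel_measurable (F (g m l))" "integrable M U"
  shows "integrable M (\<lambda>\<omega>. U \<omega> * (dW i m l \<omega> * dW j m l \<omega>)) \<and> expectation (\<lambda>\<omega>. U \<omega> * (dW i m l \<omega> * dW j m l \<omega>)) = 0"
  unfolding dW_def
  by (intro conjI W_increment_cross[OF assms(1) g_nonneg g_less assms(2,3)]
    integrable_W_increment_prod[OF g_nonneg g_less assms(2,3)])

lemma dW_square: "integrable M (\<lambda>\<omega>. (dW j m l \<omega>)\<^sup>2)" "expectation (\<lambda>\<omega>. (dW j m l \<omega>)\<^sup>2) = mesh m"
proof -
  have "integrable M (\<lambda>\<omega>. 1 * (dW j m l \<omega>)\<^sup>2) \<and> expectation (\<lambda>\<omega>. 1 * (dW j m l \<omega>)\<^sup>2) = expectation (\<lambda>_. 1) * mesh m"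
    by (rule dW_mult2) simp_all
  then show "integrable M (\<lambda>\<omega>. (dW j m l \<omega>)\<^sup>2)" "expectation (\<lambda>\<omega>. (dW j m l \<omega>)\<^sup>2) = mesh m"
    by (simp_all add: prob_space)
qed

text \<open>The product of two increments minus its bracket, i.e. its martingale part; the
  subtracted term is the conditional mean given the past.\<close>

definition dWW :: "'l \<Rightarrow> 'l \<Rightarrow> nat \<Rightarrow> nat \<Rightarrow> 'a \<Rightarrow> real" where
  "dWW i j m l \<omega> = dW i m l \<omega> * dW j m l \<omega> - (if i = j then mesh m else 0)"

lemma dWW_orth:
  assumes "U \<in> borel_measurable (F (g m l))" "integrable M U"
  shows "integrable M (\<lambda>\<omega>. U \<omega> * dWW i j m l \<omega>) \<and> expectation (\<lambda>\<omega>. U \<omega> * dWW i j m l \<omega>) = 0"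
proof (cases "i = j")
  case True
  have "U \<omega> * dWW i j m l \<omega> = U \<omega> * (dW j m l \<omega>)\<^sup>2 - U \<omega> * mesh m" for \<omega>
    using True by (simp add: dWW_def power2_eq_square algebra_simps)
  then show ?thesis using dW_mult2[OF assms, of j] assms(2) by simp
next
  case False
  then show ?thesis using dW_cross[OF False assms] by (simp add: dWW_def)
qed

text \<open>On the diagonal the value 3 h^2 - 2 h^2 + h^2 with h = \<open>mesh m\<close> comes from
  the fourth moment of a Gaussian; off the diagonal independence gives h^2.\<close>

lemma dWW_square: "integrable M (\<lambda>\<omega>. (dWW i j m l \<omega>)\<^sup>2)" "expectation (\<lambda>\<omega>. (dWW i j m l \<omega>)\<^sup>2) \<le> 2 * (mesh m)\<^sup>2"
proof -
  have "integrable M (\<lambda>\<omega>. (dWW i j m l \<omega>)\<^sup>2) \<and> expectation (\<lambda>\<omega>. (dWW i j m l \<omega>)\<^sup>2) \<le> 2 * (mesh m)\<^sup>2"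
  proof (cases "i = j")
    case True
    have eq: "(dWW i j m l \<omega>)\<^sup>2 = (dW j m l \<omega>) ^ 4 - 2 * mesh m * (dW j m l \<omega>)\<^sup>2 + (mesh m)\<^sup>2" for \<omega>
      using True by (simp add: dWW_def power2_eq_square power4_eq_xxxx algebra_simps)
    have 4: "integrable M (\<lambda>\<omega>. (dW j m l \<omega>) ^ 4)" "expectation (\<lambda>\<omega>. (dW j m l \<omega>) ^ 4) = 3 * (mesh m)\<^sup>2"
      unfolding dW_def using W_increment_integrable_power[OF g_nonneg g_less, of j m l 4]
        W_increment_moments(3)[OF g_nonneg g_less, of j m l] by (auto simp: g_Suc)
    have "expectation (\<lambda>\<omega>. (dWW i j m l \<omega>)\<^sup>2) = 3 * (mesh m)\<^sup>2 - 2 * mesh m * mesh m + (mesh m)\<^sup>2"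
      unfolding eq using 4 dW_square[of j m l] by (simp add: prob_space)
    then have "expectation (\<lambda>\<omega>. (dWW i j m l \<omega>)\<^sup>2) \<le> 2 * (mesh m)\<^sup>2" by (simp add: power2_eq_square)
    moreover have "integrable M (\<lambda>\<omega>. (dWW i j m l \<omega>)\<^sup>2)" unfolding eq using 4 dW_square[of j m l] by simp
    ultimately show ?thesis by blast
  next
    case False
    then show ?thesis
      using W_increments_square_product[OF False g_nonneg g_less, of m l] by (simp add: dWW_def dW_def g_Suc)
  qed
  then show "integrable M (\<lambda>\<omega>. (dWW i j m l \<omega>)\<^sup>2)" "expectation (\<lambda>\<omega>. (dWW i j m l \<omega>)\<^sup>2) \<le> 2 * (mesh m)\<^sup>2" by auto
qed

lemma dWW_adapted: "dWW i j m l \<in> borel_measurable (F (g m (Suc l)))"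
  unfolding dWW_def using dW_adapted[of i m l] dW_adapted[of j m l] by measurable

lemma dWW_measurable[measurable]: "dWW i j m l \<in> borel_measurable M"
  unfolding dWW_def by measurable

text \<open>The sum is a martingale transform of the compensated products. With X cut at a level c
  its second moment is O(mesh n), as at most 2^n cells contribute the order (mesh n)^2 each; the cut
  is inactive outside a small event.\<close>

lemma bracket_sum_null:
  assumes K: "\<And>n. K n \<le> 2 ^ n"
  shows "null_in_prob M (\<lambda>n \<omega>. \<Sum>k<K n. dWW i j n k \<omega> *\<^sub>R X (g n k) \<omega>)"
proof (rule null_in_prob_localize)
  show "(\<lambda>\<omega>. \<Sum>k<K n. dWW i j n k \<omega> *\<^sub>R X (g n k) \<omega>) \<in> borel_measurable M" for n by measurable
  fix \<eta> :: real assume "\<eta> > 0"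
  from X_grid_bounded_event[OF this] obtain c E where c: "c > 0" and E: "E \<in> events" "prob E \<le> \<eta>"
    and Xc: "\<And>\<omega> m l. \<omega> \<in> space M \<Longrightarrow> \<omega> \<notin> E \<Longrightarrow> l \<le> 2 ^ m \<Longrightarrow> norm (X (g m l) \<omega>) \<le> c" by blast
  \<comment> \<open>The cut is made at every grid point separately, so that each weight is known at
    the left end of its cell.\<close>
  define H where "H n k \<omega> = (if norm (X (g n k) \<omega>) \<le> c then X (g n k) \<omega> else 0)" for n k \<omega>
  have Hm[measurable]: "H n k \<in> borel_measurable M" for n k unfolding H_def by measurable
  have HF: "H n k \<in> borel_measurable (F (g n k))" for n k unfolding H_def using Xg_adapted[of n k] by measurable
  have Hc: "norm (H n k \<omega>) \<le> c" for n k \<omega> using c by (simp add: H_def)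
  have Hc2: "(norm (H n k \<omega>))\<^sup>2 \<le> c\<^sup>2" for n k \<omega> using Hc by (intro power_mono) auto
  define Z' where "Z' n \<omega> = (\<Sum>k<K n. dWW i j n k \<omega> *\<^sub>R H n k \<omega>)" for n \<omega>
  have L2: "integrable M (\<lambda>\<omega>. (norm (Z' n \<omega>))\<^sup>2)" "expectation (\<lambda>\<omega>. (norm (Z' n \<omega>))\<^sup>2) \<le> 2 * T * c\<^sup>2 * mesh n" for n
  proof -
    have HL2: "integrable M (\<lambda>\<omega>. (norm (H n k \<omega>))\<^sup>2)" for k
      by (rule integrable_const_bound[where B="c\<^sup>2"]) (use Hc2 in auto)
    have sq: "integrable M (\<lambda>\<omega>. (dWW i j n l \<omega>)\<^sup>2 * (norm (H n l \<omega>))\<^sup>2) \<and>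
       expectation (\<lambda>\<omega>. (dWW i j n l \<omega>)\<^sup>2 * (norm (H n l \<omega>))\<^sup>2) \<le> c\<^sup>2 * (2 * (mesh n)\<^sup>2)" for l
    proof -
      have le: "(dWW i j n l \<omega>)\<^sup>2 * (norm (H n l \<omega>))\<^sup>2 \<le> c\<^sup>2 * (dWW i j n l \<omega>)\<^sup>2" for \<omega>
        using mult_left_mono[OF Hc2[of n l \<omega>], of "(dWW i j n l \<omega>)\<^sup>2"] by (simp add: mult.commute)
      have int: "integrable M (\<lambda>\<omega>. (dWW i j n l \<omega>)\<^sup>2 * (norm (H n l \<omega>))\<^sup>2)"
        by (rule Bochner_Integration.integrable_bound[where f="\<lambda>\<omega>. c\<^sup>2 * (dWW i j n l \<omega>)\<^sup>2"])
          (use le dWW_square(1)[of i j n l] in auto)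
      have "expectation (\<lambda>\<omega>. (dWW i j n l \<omega>)\<^sup>2 * (norm (H n l \<omega>))\<^sup>2) \<le> expectation (\<lambda>\<omega>. c\<^sup>2 * (dWW i j n l \<omega>)\<^sup>2)"
        by (rule integral_mono[OF int]) (use le dWW_square(1)[of i j n l] in auto)
      also have "\<dots> \<le> c\<^sup>2 * (2 * (mesh n)\<^sup>2)" using dWW_square(2)[of i j n l] by (simp add: mult_left_mono)
      finally show ?thesis using int by blast
    qed
    show "integrable M (\<lambda>\<omega>. (norm (Z' n \<omega>))\<^sup>2)" unfolding Z'_def
      by (rule martingale_sum_L2(1)[where t="g n" and b="\<lambda>_. c\<^sup>2 * (2 * (mesh n)\<^sup>2)", OF g_nonneg less_imp_le[OF g_less] HF dWW_adapted HL2 dWW_orth sq])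
    have "expectation (\<lambda>\<omega>. (norm (Z' n \<omega>))\<^sup>2) \<le> (\<Sum>l<K n. c\<^sup>2 * (2 * (mesh n)\<^sup>2))"
      unfolding Z'_def by (rule martingale_sum_L2(2)[where t="g n" and b="\<lambda>_. c\<^sup>2 * (2 * (mesh n)\<^sup>2)", OF g_nonneg less_imp_le[OF g_less] HF dWW_adapted HL2 dWW_orth sq])
    also have "\<dots> = real (K n) * (c\<^sup>2 * (2 * (mesh n)\<^sup>2))" by simp
    also have "\<dots> = (real (K n) * mesh n) * (c\<^sup>2 * 2 * mesh n)" by (simp add: power2_eq_square)
    also have "\<dots> \<le> T * (c\<^sup>2 * 2 * mesh n)"
    proof (rule mult_right_mono)
      show "real (K n) * mesh n \<le> T" using g_le_T[OF K[of n]] by (simp add: g_def)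
      show "0 \<le> c\<^sup>2 * 2 * mesh n" using mesh_pos[of n] by simp
    qed
    finally show "expectation (\<lambda>\<omega>. (norm (Z' n \<omega>))\<^sup>2) \<le> 2 * T * c\<^sup>2 * mesh n" by (simp add: mult_ac)
  qed
  have "null_in_prob M Z'"
  proof (rule null_in_prob_L2[OF _ L2])
    show "Z' n \<in> borel_measurable M" for n unfolding Z'_def by measurable
    show "(\<lambda>n. 2 * T * c\<^sup>2 * mesh n) \<longlonglongrightarrow> 0" using tendsto_mult_right_zero[OF mesh_tendsto] by simp
  qed
  moreover have "norm (\<Sum>k<K n. dWW i j n k \<omega> *\<^sub>R X (g n k) \<omega>) \<le> norm (Z' n \<omega>)" if "\<omega> \<in> space M" "\<omega> \<notin> E" for n \<omega>
  proof -
    have "H n k \<omega> = X (g n k) \<omega>" if "k < K n" for k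
      using Xc[OF \<open>\<omega> \<in> space M\<close> \<open>\<omega> \<notin> E\<close>, of k n] that K[of n] by (simp add: H_def)
    then show ?thesis by (simp add: Z'_def)
  qed
  ultimately show "\<exists>E Z'. E \<in> events \<and> prob E \<le> \<eta> \<and> null_in_prob M Z' \<and>
     (\<forall>n. \<forall>\<omega>\<in>space M. \<omega> \<notin> E \<longrightarrow> norm (\<Sum>k<K n. dWW i j n k \<omega> *\<^sub>R X (g n k) \<omega>) \<le> norm (Z' n \<omega> :: real^'n))"
    by (intro exI[of _ E] exI[of _ Z'] conjI E allI ballI impI)
qed

text \<open>A sum of iterated integrals. Once the oscillation of X in a cell is cut at
  \<open>\<epsilon>\<close>, orthogonality makes the inner sum of order \<open>\<epsilon>\<close>
  times sqrt (mesh n), while the outer increment has order sqrt (mesh n). Hence the sum of the norms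
  over all cells is at most \<open>\<epsilon>\<close> times T in mean, without cancellation between
  cells and for any depth \<open>\<mu> n\<close>.\<close>

lemma cell_fluctuation_null:
  assumes K: "\<And>n. K n \<le> 2 ^ n"
  shows "null_in_prob M (\<lambda>n \<omega>. \<Sum>k<K n. dW j n k \<omega> *\<^sub>R
     (\<Sum>l<2 ^ \<mu> n. dW i (n + \<mu> n) (k * 2 ^ \<mu> n + l) \<omega> *\<^sub>R (X (g (n + \<mu> n) (k * 2 ^ \<mu> n + l)) \<omega> - X (g n k) \<omega>)))"
    (is "null_in_prob M ?Z")
proof (rule null_in_probI_bad)
  show "?Z n \<in> borel_measurable M" for n by measurable
  fix \<eta> :: real assume "\<eta> > 0"
  define \<epsilon> where "\<epsilon> = \<eta> / T"
  have \<epsilon>: "\<epsilon> > 0" using \<open>\<eta> > 0\<close> T_pos by (simp add: \<epsilon>_def)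
  from order_tendstoD(2)[OF X_modulus_event_prob[OF \<epsilon>] \<open>\<eta> > 0\<close>]
  show "\<forall>\<^sub>F n in sequentially. \<exists>E U. E \<in> events \<and> prob E \<le> \<eta> \<and> integrable M U \<and>
       expectation U \<le> \<eta> \<and> (AE \<omega> in M. 0 \<le> U \<omega>) \<and> (AE \<omega> in M. \<omega> \<notin> E \<longrightarrow> norm (?Z n \<omega>) \<le> U \<omega>)"
  proof eventually_elim
    case (elim n)
    define r where "r = \<mu> n"
    define G where "G k l \<omega> = (let v = X (g (n + r) (k * 2 ^ r + l)) \<omega> - X (g n k) \<omega> in if norm v \<le> \<epsilon> then v else 0)" for k l \<omega>
    have Gm[measurable]: "G k l \<in> borel_measurable M" for k l unfolding G_def Let_def by measurable
    have GF: "G k l \<in> borel_measurable (F (g (n + r) (k * 2 ^ r + l)))" for k l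
    proof -
      have "g n k \<le> g (n + r) (k * 2 ^ r + l)" using g_mono[of "k * 2 ^ r" "k * 2 ^ r + l" "n + r"] by (simp add: g_refine)
      then have [measurable]: "X (g n k) \<in> borel_measurable (F (g (n + r) (k * 2 ^ r + l)))"
        by (rule F_measurable_mono[OF _ Xg_adapted])
      note [measurable] = Xg_adapted[of "n + r" "k * 2 ^ r + l"]
      show ?thesis unfolding G_def Let_def by measurable
    qed
    have G\<epsilon>: "(norm (G k l \<omega>))\<^sup>2 \<le> \<epsilon>\<^sup>2" for k l \<omega>
      using \<epsilon> by (intro power_mono) (auto simp: G_def Let_def)
    have GL2: "integrable M (\<lambda>\<omega>. (norm (G k l \<omega>))\<^sup>2)" for k l
      by (rule integrable_const_bound[where B="\<epsilon>\<^sup>2"]) (use G\<epsilon> in auto)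
    have GE: "expectation (\<lambda>\<omega>. (norm (G k l \<omega>))\<^sup>2) \<le> \<epsilon>\<^sup>2" for k l
    proof -
      have "expectation (\<lambda>\<omega>. (norm (G k l \<omega>))\<^sup>2) \<le> expectation (\<lambda>\<omega>. \<epsilon>\<^sup>2)"
        by (rule integral_mono[OF GL2]) (use G\<epsilon> in auto)
      then show ?thesis by (simp add: prob_space)
    qed
    define Y where "Y k \<omega> = (\<Sum>l<2 ^ r. dW i (n + r) (k * 2 ^ r + l) \<omega> *\<^sub>R G k l \<omega>)" for k \<omega>
    have Y: "integrable M (\<lambda>\<omega>. (norm (Y k \<omega>))\<^sup>2)" "expectation (\<lambda>\<omega>. (norm (Y k \<omega>))\<^sup>2) \<le> \<epsilon>\<^sup>2 * mesh n" for k
    proof -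
      have sq: "integrable M (\<lambda>\<omega>. (dW i (n + r) (k * 2 ^ r + l) \<omega>)\<^sup>2 * (norm (G k l \<omega>))\<^sup>2) \<and>
        expectation (\<lambda>\<omega>. (dW i (n + r) (k * 2 ^ r + l) \<omega>)\<^sup>2 * (norm (G k l \<omega>))\<^sup>2) \<le> \<epsilon>\<^sup>2 * mesh (n + r)" for l
      proof -
        have "(\<lambda>\<omega>. (norm (G k l \<omega>))\<^sup>2) \<in> borel_measurable (F (g (n + r) (k * 2 ^ r + l)))"
          using GF[of k l] by measurable
        from dW_mult2[OF this GL2, of i] show ?thesis
          using mult_right_mono[OF GE[of k l] less_imp_le[OF mesh_pos[of "n + r"]]] by (simp add: mult.commute)
      qed
      have p: "g (n + r) (k * 2 ^ r + l) \<le> g (n + r) (k * 2 ^ r + Suc l)" for l by (rule g_mono) simp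
      have q: "dW i (n + r) (k * 2 ^ r + l) \<in> borel_measurable (F (g (n + r) (k * 2 ^ r + Suc l)))" for l
        using dW_adapted[of i "n + r" "k * 2 ^ r + l"] by simp
      show "integrable M (\<lambda>\<omega>. (norm (Y k \<omega>))\<^sup>2)" unfolding Y_def
        by (rule martingale_sum_L2(1)[where t="\<lambda>l. g (n + r) (k * 2 ^ r + l)" and b="\<lambda>_. \<epsilon>\<^sup>2 * mesh (n + r)", OF g_nonneg p GF q GL2 dW_mult1 sq])
      have "expectation (\<lambda>\<omega>. (norm (Y k \<omega>))\<^sup>2) \<le> (\<Sum>l<(2::nat) ^ r. \<epsilon>\<^sup>2 * mesh (n + r))" unfolding Y_def
        by (rule martingale_sum_L2(2)[where t="\<lambda>l. g (n + r) (k * 2 ^ r + l)" and b="\<lambda>_. \<epsilon>\<^sup>2 * mesh (n + r)", OF g_nonneg p GF q GL2 dW_mult1 sq])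
      also have "\<dots> = \<epsilon>\<^sup>2 * mesh n" using mesh_refine[of r n] by (simp add: algebra_simps)
      finally show "expectation (\<lambda>\<omega>. (norm (Y k \<omega>))\<^sup>2) \<le> \<epsilon>\<^sup>2 * mesh n" .
    qed
    \<comment> \<open>With these weights each of the two summands contributes at most \<epsilon> *
      mesh n / 2 per cell in the mean.\<close>
    define U where "U \<omega> = (\<Sum>k<K n. (\<epsilon> * (dW j n k \<omega>)\<^sup>2 + (norm (Y k \<omega>))\<^sup>2 / \<epsilon>) / 2)" for \<omega>
    have Uint: "integrable M U" unfolding U_def using Y dW_square by auto
    have "expectation U = (\<Sum>k<K n. (\<epsilon> * mesh n + expectation (\<lambda>\<omega>. (norm (Y k \<omega>))\<^sup>2) / \<epsilon>) / 2)"
      unfolding U_def using Y(1) dW_square by simp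
    also have "\<dots> \<le> (\<Sum>k<K n. \<epsilon> * mesh n)"
    proof (rule sum_mono)
      fix k
      have "expectation (\<lambda>\<omega>. (norm (Y k \<omega>))\<^sup>2) / \<epsilon> \<le> (\<epsilon>\<^sup>2 * mesh n) / \<epsilon>"
        using Y(2)[of k] \<epsilon> by (intro divide_right_mono) auto
      also have "\<dots> = \<epsilon> * mesh n" using \<epsilon> by (simp add: power2_eq_square)
      finally show "(\<epsilon> * mesh n + expectation (\<lambda>\<omega>. (norm (Y k \<omega>))\<^sup>2) / \<epsilon>) / 2 \<le> \<epsilon> * mesh n" by simp
    qed
    also have "\<dots> = \<epsilon> * g n (K n)" by (simp add: g_def)
    also have "\<dots> \<le> \<epsilon> * T" using g_le_T[OF K[of n]] \<epsilon> by (intro mult_left_mono) auto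
    also have "\<dots> = \<eta>" using T_pos by (simp add: \<epsilon>_def)
    finally have UE: "expectation U \<le> \<eta>" .
    have U0: "0 \<le> U \<omega>" for \<omega> unfolding U_def by (intro sum_nonneg) (use \<epsilon> in auto)
    have le: "norm (?Z n \<omega>) \<le> U \<omega>" if \<omega>: "\<omega> \<in> space M" "\<omega> \<notin> X_modulus_event \<epsilon> n" for \<omega>
    proof -
      have GX: "G k l \<omega> = X (g (n + r) (k * 2 ^ r + l)) \<omega> - X (g n k) \<omega>" if "k < K n" "l < 2 ^ r" for k l
      proof -
        have "k < 2 ^ n" using that K[of n] by simp
        then have "\<not> \<epsilon> < norm (X (g (n + r) (k * 2 ^ r + l)) \<omega> - X (g n k) \<omega>)"
          using \<omega> that(2) unfolding X_modulus_event_def by blast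
        then show ?thesis by (simp add: G_def Let_def)
      qed
      have "?Z n \<omega> = (\<Sum>k<K n. dW j n k \<omega> *\<^sub>R Y k \<omega>)"
        unfolding Y_def r_def[symmetric] using GX by (intro sum.cong refl arg_cong2[where f="(*\<^sub>R)"]) auto
      also have "norm \<dots> \<le> (\<Sum>k<K n. norm (dW j n k \<omega> *\<^sub>R Y k \<omega>))" by (rule norm_sum)
      also have "\<dots> \<le> U \<omega>" unfolding U_def
      proof (rule sum_mono)
        fix k
        define a b where "a = \<bar>dW j n k \<omega>\<bar>" and "b = norm (Y k \<omega>)"
        have "0 \<le> (\<epsilon> * a - b)\<^sup>2" by simp
        then have "2 * (a * b) * \<epsilon> \<le> \<epsilon> * (\<epsilon> * a\<^sup>2) + b\<^sup>2"
          by (simp add: power2_diff power2_eq_square algebra_simps)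
        then have "a * b \<le> (\<epsilon> * a\<^sup>2 + b\<^sup>2 / \<epsilon>) / 2" using \<epsilon> by (simp add: field_simps)
        then show "norm (dW j n k \<omega> *\<^sub>R Y k \<omega>) \<le> (\<epsilon> * (dW j n k \<omega>)\<^sup>2 + (norm (Y k \<omega>))\<^sup>2 / \<epsilon>) / 2"
          by (simp add: a_def b_def)
      qed
      finally show ?thesis .
    qed
    show ?case
      by (rule exI[of _ "X_modulus_event \<epsilon> n"], rule exI[of _ U]) (use Uint UE U0 le elim in auto)
  qed
qed

section \<open>Remainder sums controlled by tightness\<close>

lemma tight_dW_squares: "tight_seq (\<lambda>n \<omega>. \<Sum>l<2 ^ \<nu> n. (dW j (\<nu> n) l \<omega>)\<^sup>2)"
proof (rule tight_seqI_bad)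
  show "(\<lambda>\<omega>. \<Sum>l<2 ^ \<nu> n. (dW j (\<nu> n) l \<omega>)\<^sup>2) \<in> borel_measurable M" for n by measurable
  fix \<eta> :: real assume "\<eta> > 0"
  show "\<exists>E K. E \<in> events \<and> prob E \<le> \<eta> \<and> (\<forall>n. \<exists>U. integrable M U \<and> expectation U \<le> K \<and> (AE \<omega> in M. 0 \<le> U \<omega>) \<and>
        (AE \<omega> in M. \<omega> \<notin> E \<longrightarrow> \<bar>\<Sum>l<2 ^ \<nu> n. (dW j (\<nu> n) l \<omega>)\<^sup>2\<bar> \<le> U \<omega>))"
  proof (rule exI[of _ "{}"], rule exI[of _ T], intro conjI allI)
    fix n
    show "\<exists>U. integrable M U \<and> expectation U \<le> T \<and> (AE \<omega> in M. 0 \<le> U \<omega>) \<and>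
        (AE \<omega> in M. \<omega> \<notin> {} \<longrightarrow> \<bar>\<Sum>l<2 ^ \<nu> n. (dW j (\<nu> n) l \<omega>)\<^sup>2\<bar> \<le> U \<omega>)"
      by (rule exI[of _ "\<lambda>\<omega>. \<Sum>l<2 ^ \<nu> n. (dW j (\<nu> n) l \<omega>)\<^sup>2"])
        (auto simp: dW_square mesh_total sum_nonneg)
  qed (use \<open>\<eta> > 0\<close> in auto)
qed

text \<open>Here the semimartingale property of the solution enters, component by component. The
  level may be any function \<open>\<nu>\<close> of n, because the tightness result admits every
  sequence of subdivisions.\<close>

lemma tight_dX_squares: "tight_seq (\<lambda>n \<omega>. \<Sum>l<2 ^ \<nu> n. (norm (X (g (\<nu> n) (Suc l)) \<omega> - X (g (\<nu> n) l) \<omega>))\<^sup>2)"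
proof -
  have semi: "continuous_semimartingale M F (\<lambda>t \<omega>. X t \<omega> $ i)" for i
    using sol by (simp add: stratonovich_solution_def)
  have sub: "subdivision T (2 ^ \<nu> n) (g (\<nu> n))" for n
    using subdivision_g[of "\<nu> n" "2 ^ \<nu> n"] by (simp add: g_top)
  have "tight_seq (\<lambda>n \<omega>. \<Sum>i\<in>UNIV. \<Sum>l<2 ^ \<nu> n. (X (g (\<nu> n) (Suc l)) \<omega> $ i - X (g (\<nu> n) l) \<omega> $ i)\<^sup>2)"
    by (intro tight_seq_sum tight_quadratic_sum_semimartingale[OF semi sub])
  moreover have "(\<Sum>i\<in>UNIV. \<Sum>l<2 ^ \<nu> n. (X (g (\<nu> n) (Suc l)) \<omega> $ i - X (g (\<nu> n) l) \<omega> $ i)\<^sup>2)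
    = (\<Sum>l<2 ^ \<nu> n. (norm (X (g (\<nu> n) (Suc l)) \<omega> - X (g (\<nu> n) l) \<omega>))\<^sup>2)" for n \<omega>
    by (subst sum.swap) (simp add: norm_vec_def L2_set_def sum_nonneg)
  ultimately show ?thesis by simp
qed

lemma subgrid_sum_le:
  assumes "K \<le> (2::nat) ^ n" and "\<And>l. 0 \<le> f l"
  shows "(\<Sum>k<K. \<Sum>l<2 ^ r. f (k * 2 ^ r + l)) \<le> (\<Sum>l<2 ^ (n + r). f l :: real)"
proof -
  have "K * 2 ^ r \<le> 2 ^ (n + r)" using assms(1) by (simp add: power_add)
  then show ?thesis
    unfolding sum_lessThan_mult[symmetric] using assms(2) by (intro sum_mono2) auto
qed

text \<open>The outer increments are estimated by their maximum \<open>dW_max\<close>, which tends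
  to zero, and the fine terms by sums that are bounded in probability.\<close>

lemma cell_product_null:
  fixes v :: "nat \<Rightarrow> nat \<Rightarrow> 'a \<Rightarrow> real^'n"
  assumes K: "\<And>n. K n \<le> 2 ^ n"
    and [measurable]: "\<And>n l. v n l \<in> borel_measurable M"
    and v: "\<And>n l \<omega>. norm (v n l \<omega>) \<le> f n l \<omega>"
    and tight: "tight_seq (\<lambda>n \<omega>. \<Sum>l<2 ^ (n + \<mu> n). f n l \<omega>)"
  shows "null_in_prob M (\<lambda>n \<omega>. \<Sum>k<K n. dW j n k \<omega> *\<^sub>R (\<Sum>l<2 ^ \<mu> n. v n (k * 2 ^ \<mu> n + l) \<omega>))"
proof (rule null_in_prob_dominated[OF _ null_in_prob_mult_tight[OF dW_max_null tight], where C=1])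
  fix n
  let ?Z = "\<lambda>\<omega>. \<Sum>k<K n. dW j n k \<omega> *\<^sub>R (\<Sum>l<2 ^ \<mu> n. v n (k * 2 ^ \<mu> n + l) \<omega>)"
  let ?Y = "\<lambda>\<omega>. \<Sum>l<2 ^ (n + \<mu> n). f n l \<omega>"
  show "?Z \<in> borel_measurable M" by measurable
  have f0: "0 \<le> f n l \<omega>" for l \<omega> using v[of n l \<omega>] norm_ge_zero order_trans by blast
  have "norm (?Z \<omega>) \<le> 1 * norm (?Y \<omega> *\<^sub>R dW_max j n \<omega>)" for \<omega>
  proof -
    have "\<bar>dW j n 0 \<omega>\<bar> \<le> dW_max j n \<omega>" by (rule dW_le_max) simp
    then have max0: "0 \<le> dW_max j n \<omega>" by linarith
    have "norm (?Z \<omega>) \<le> (\<Sum>k<K n. dW_max j n \<omega> * (\<Sum>l<2 ^ \<mu> n. f n (k * 2 ^ \<mu> n + l) \<omega>))"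
    proof (intro sum_norm_le)
      fix k assume "k \<in> {..<K n}"
      then have "\<bar>dW j n k \<omega>\<bar> \<le> dW_max j n \<omega>" using K[of n] by (intro dW_le_max) simp
      moreover have "norm (\<Sum>l<2 ^ \<mu> n. v n (k * 2 ^ \<mu> n + l) \<omega>) \<le> (\<Sum>l<2 ^ \<mu> n. f n (k * 2 ^ \<mu> n + l) \<omega>)"
        by (intro sum_norm_le v)
      ultimately show "norm (dW j n k \<omega> *\<^sub>R (\<Sum>l<2 ^ \<mu> n. v n (k * 2 ^ \<mu> n + l) \<omega>)) \<le>
        dW_max j n \<omega> * (\<Sum>l<2 ^ \<mu> n. f n (k * 2 ^ \<mu> n + l) \<omega>)"
        unfolding norm_scaleR using max0 by (intro mult_mono) auto
    qed
    also have "\<dots> = dW_max j n \<omega> * (\<Sum>k<K n. \<Sum>l<2 ^ \<mu> n. f n (k * 2 ^ \<mu> n + l) \<omega>)"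
      by (simp add: sum_distrib_left)
    also have "\<dots> \<le> dW_max j n \<omega> * ?Y \<omega>"
      by (rule mult_left_mono[OF subgrid_sum_le[OF K f0] max0])
    also have "\<dots> \<le> norm (?Y \<omega> *\<^sub>R dW_max j n \<omega>)"
      unfolding real_scaleR_def real_norm_def by (subst mult.commute) (rule abs_ge_self)
    finally show ?thesis by simp
  qed
  then show "AE \<omega> in M. norm (?Z \<omega>) \<le> 1 * norm (?Y \<omega> *\<^sub>R dW_max j n \<omega>)" by simp
qed

text \<open>The fine drift terms form Riemann sums, which along each path are bounded by T times a
  bound of A X.\<close>

lemma cell_drift_null:
  assumes K: "\<And>n. K n \<le> 2 ^ n"
  shows "null_in_prob M (\<lambda>n \<omega>. \<Sum>k<K n. dW j n k \<omega> *\<^sub>R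
     (\<Sum>l<2 ^ \<mu> n. mesh (n + \<mu> n) *\<^sub>R (A *v X (g (n + \<mu> n) (k * 2 ^ \<mu> n + l)) \<omega>)))"
proof (rule cell_product_null[where f="\<lambda>n l \<omega>. mesh (n + \<mu> n) * norm (A *v X (g (n + \<mu> n) l) \<omega>)" and \<mu>=\<mu>, OF K])
  show "norm (mesh (n + \<mu> n) *\<^sub>R (A *v X (g (n + \<mu> n) l) \<omega>)) \<le> mesh (n + \<mu> n) * norm (A *v X (g (n + \<mu> n) l) \<omega>)" for n l \<omega>
    using mesh_pos[of "n + \<mu> n"] by simp
  show "tight_seq (\<lambda>n \<omega>. \<Sum>l<2 ^ (n + \<mu> n). mesh (n + \<mu> n) * norm (A *v X (g (n + \<mu> n) l) \<omega>))"
    (is "tight_seq ?Y")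
  proof (rule tight_seq_AE_bounded)
    show "?Y n \<in> borel_measurable M" for n by measurable
    obtain c where c: "c > 0" "\<And>v. norm (A *v v) \<le> c * norm v" using matvec_bound[of A] by blast
    show "AE \<omega> in M. \<exists>K. \<forall>n. \<bar>?Y n \<omega>\<bar> \<le> K"
      using X_grid_bounded
    proof eventually_elim
      case (elim \<omega>)
      then obtain L where L: "\<And>m l. l \<le> 2 ^ m \<Longrightarrow> norm (X (g m l) \<omega>) \<le> L" by blast
      have "\<bar>?Y n \<omega>\<bar> \<le> T * (c * L)" for n
      proof -
        let ?m = "n + \<mu> n"
        have "?Y n \<omega> \<le> (\<Sum>l<(2::nat) ^ ?m. mesh ?m * (c * L))"
        proof (intro sum_mono mult_left_mono)
          fix l :: nat assume "l \<in> {..<2 ^ ?m}"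
          then have "norm (X (g ?m l) \<omega>) \<le> L" using L[of l ?m] by simp
          then have "c * norm (X (g ?m l) \<omega>) \<le> c * L" using c by simp
          then show "norm (A *v X (g ?m l) \<omega>) \<le> c * L" using c(2)[of "X (g ?m l) \<omega>"] by linarith
        qed (use mesh_pos[of ?m] in simp)
        also have "\<dots> = (2 ^ ?m * mesh ?m) * (c * L)" by simp
        finally have "?Y n \<omega> \<le> T * (c * L)" unfolding mesh_total .
        moreover have "0 \<le> ?Y n \<omega>" by (intro sum_nonneg) (use mesh_pos[of ?m] in auto)
        ultimately show ?thesis by simp
      qed
      then show ?case by blast
    qed
  qed
qed measurable

text \<open>The second order part of the symmetric sum: |dW| |dX| <= dW^2 + |dX|^2, and both sums of
  squares over the fine grid are tight.\<close>

lemma cell_second_order_null: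
  assumes K: "\<And>n. K n \<le> 2 ^ n"
  shows "null_in_prob M (\<lambda>n \<omega>. \<Sum>k<K n. dW j n k \<omega> *\<^sub>R
     (\<Sum>l<2 ^ \<mu> n. dW i (n + \<mu> n) (k * 2 ^ \<mu> n + l) \<omega> *\<^sub>R
        (X (g (n + \<mu> n) (Suc (k * 2 ^ \<mu> n + l))) \<omega> - X (g (n + \<mu> n) (k * 2 ^ \<mu> n + l)) \<omega>)))"
proof (rule cell_product_null[where f="\<lambda>n l \<omega>. (dW i (n + \<mu> n) l \<omega>)\<^sup>2 + (norm (X (g (n + \<mu> n) (Suc l)) \<omega> - X (g (n + \<mu> n) l) \<omega>))\<^sup>2"
      and \<mu>=\<mu> and v="\<lambda>n l \<omega>. dW i (n + \<mu> n) l \<omega> *\<^sub>R (X (g (n + \<mu> n) (Suc l)) \<omega> - X (g (n + \<mu> n) l) \<omega>)", OF K])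
  show "norm (dW i (n + \<mu> n) l \<omega> *\<^sub>R (X (g (n + \<mu> n) (Suc l)) \<omega> - X (g (n + \<mu> n) l) \<omega>))
    \<le> (dW i (n + \<mu> n) l \<omega>)\<^sup>2 + (norm (X (g (n + \<mu> n) (Suc l)) \<omega> - X (g (n + \<mu> n) l) \<omega>))\<^sup>2" for n l \<omega>
    using abs_mult_le_squares[of "dW i (n + \<mu> n) l \<omega>" "norm (X (g (n + \<mu> n) (Suc l)) \<omega> - X (g (n + \<mu> n) l) \<omega>)"]
    by (simp add: abs_mult)
  show "tight_seq (\<lambda>n \<omega>. \<Sum>l<2 ^ (n + \<mu> n). (dW i (n + \<mu> n) l \<omega>)\<^sup>2
      + (norm (X (g (n + \<mu> n) (Suc l)) \<omega> - X (g (n + \<mu> n) l) \<omega>))\<^sup>2)"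
    unfolding sum.distrib by (intro tight_seq_add tight_dW_squares tight_dX_squares)
qed measurable

lemma dW_refine: "(\<Sum>l<2 ^ r. dW j (n + r) (k * 2 ^ r + l) \<omega>) = dW j n k \<omega>"
proof -
  have "(\<Sum>l<2 ^ r. dW j (n + r) (k * 2 ^ r + l) \<omega>) =
    (\<Sum>l<2 ^ r. W j (g (n + r) (k * 2 ^ r + Suc l)) \<omega> - W j (g (n + r) (k * 2 ^ r + l)) \<omega>)"
    by (simp add: dW_def)
  also have "\<dots> = W j (g (n + r) (k * 2 ^ r + 2 ^ r)) \<omega> - W j (g (n + r) (k * 2 ^ r)) \<omega>"
    by (subst sum_lessThan_telescope) simp
  also have "k * 2 ^ r + 2 ^ r = Suc k * 2 ^ r" by simp
  finally show ?thesis by (simp only: g_refine dW_def)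
qed

text \<open>In a fine step the symmetric mean of X is X at the left end of the coarse cell, plus the
  fluctuation within the cell, plus half the fine increment. The first part adds up to the coarse
  Brownian increment; the other two give the sums treated in \<open>cell_fluctuation_null\<close>
  and \<open>cell_second_order_null\<close>.\<close>

lemma cell_strat_decomposition:
  fixes r n k
  defines "m \<equiv> n + r" and "p \<equiv> \<lambda>l. k * 2 ^ r + l"
  shows "(\<Sum>l<2 ^ r. strat_step m (p l) \<omega>) =
    (\<Sum>l<2 ^ r. mesh m *\<^sub>R (A *v X (g m (p l)) \<omega>)) +
    (\<Sum>i\<in>UNIV. B i *v (dW i n k \<omega> *\<^sub>R X (g n k) \<omega>
       + (\<Sum>l<2 ^ r. dW i m (p l) \<omega> *\<^sub>R (X (g m (p l)) \<omega> - X (g n k) \<omega>))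
       + (1/2) *\<^sub>R (\<Sum>l<2 ^ r. dW i m (p l) \<omega> *\<^sub>R (X (g m (Suc (p l))) \<omega> - X (g m (p l)) \<omega>))))"
proof -
  have steps: "(\<Sum>l<2 ^ r. strat_step m (p l) \<omega>) = (\<Sum>l<2 ^ r. mesh m *\<^sub>R (A *v X (g m (p l)) \<omega>)) +
    (\<Sum>i\<in>UNIV. \<Sum>l<2 ^ r. dW i m (p l) \<omega> *\<^sub>R (B i *v ((1/2) *\<^sub>R (X (g m (p l)) \<omega> + X (g m (Suc (p l))) \<omega>))))"
    unfolding strat_step_def sum.distrib by (subst sum.swap) simp
  have cell: "(\<Sum>l<2 ^ r. dW i m (p l) \<omega> *\<^sub>R (B i *v ((1/2) *\<^sub>R (X (g m (p l)) \<omega> + X (g m (Suc (p l))) \<omega>)))) =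
     B i *v (dW i n k \<omega> *\<^sub>R X (g n k) \<omega>
       + (\<Sum>l<2 ^ r. dW i m (p l) \<omega> *\<^sub>R (X (g m (p l)) \<omega> - X (g n k) \<omega>))
       + (1/2) *\<^sub>R (\<Sum>l<2 ^ r. dW i m (p l) \<omega> *\<^sub>R (X (g m (Suc (p l))) \<omega> - X (g m (p l)) \<omega>)))" for i
  proof -
    have half: "dW i m (p l) \<omega> *\<^sub>R ((1/2) *\<^sub>R (X (g m (p l)) \<omega> + X (g m (Suc (p l))) \<omega>)) =
      dW i m (p l) \<omega> *\<^sub>R X (g n k) \<omega> + dW i m (p l) \<omega> *\<^sub>R (X (g m (p l)) \<omega> - X (g n k) \<omega>) +
      (1/2) *\<^sub>R (dW i m (p l) \<omega> *\<^sub>R (X (g m (Suc (p l))) \<omega> - X (g m (p l)) \<omega>))" for l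
      by (simp add: vec_eq_iff field_simps)
    have "(\<Sum>l<2 ^ r. dW i m (p l) \<omega> *\<^sub>R (B i *v ((1/2) *\<^sub>R (X (g m (p l)) \<omega> + X (g m (Suc (p l))) \<omega>)))) =
      B i *v (\<Sum>l<2 ^ r. dW i m (p l) \<omega> *\<^sub>R ((1/2) *\<^sub>R (X (g m (p l)) \<omega> + X (g m (Suc (p l))) \<omega>)))"
      by (simp only: linear_sum[OF matrix_vector_mul_linear] matrix_vector_mult_scaleR)
    also have "(\<Sum>l<2 ^ r. dW i m (p l) \<omega> *\<^sub>R ((1/2) *\<^sub>R (X (g m (p l)) \<omega> + X (g m (Suc (p l))) \<omega>))) =
      (\<Sum>l<2 ^ r. dW i m (p l) \<omega>) *\<^sub>R X (g n k) \<omega>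
       + (\<Sum>l<2 ^ r. dW i m (p l) \<omega> *\<^sub>R (X (g m (p l)) \<omega> - X (g n k) \<omega>))
       + (1/2) *\<^sub>R (\<Sum>l<2 ^ r. dW i m (p l) \<omega> *\<^sub>R (X (g m (Suc (p l))) \<omega> - X (g m (p l)) \<omega>))"
      unfolding half sum.distrib scaleR_sum_left scaleR_sum_right ..
    also have "(\<Sum>l<2 ^ r. dW i m (p l) \<omega>) = dW i n k \<omega>" unfolding m_def p_def by (rule dW_refine)
    finally show ?thesis .
  qed
  show ?thesis unfolding steps cell ..
qed

text \<open>The increments of \<open>X\<close> over the cells of level \<open>n\<close> are expanded on a level \<open>n + \<mu> n\<close>, where
  \<open>\<mu> n\<close> is so large that the error of the expansion is negligible even after summation over all
  cells. No limit object such as the Ito integral is needed.\<close>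

lemma covariation_null:
  assumes K: "\<And>n. K n \<le> 2 ^ n"
  shows "null_in_prob M (\<lambda>n \<omega>. \<Sum>k<K n. dW j n k \<omega> *\<^sub>R (X (g n (Suc k)) \<omega> - X (g n k) \<omega>) - mesh n *\<^sub>R (B j *v X (g n k) \<omega>))"
proof -
  define \<rho> where "\<rho> n k r \<omega> = X (g n (Suc k)) \<omega> - X (g n k) \<omega> - (\<Sum>l<2 ^ r. strat_step (n + r) (k * 2 ^ r + l) \<omega>)" for n k r \<omega>
  have \<rho>m[measurable]: "\<rho> n k r \<in> borel_measurable M" for n k r unfolding \<rho>_def by measurable
  \<comment> \<open>For fixed n there are finitely many cells, and \<open>dW j n k\<close> does not
    change with r, so it is a tight factor.\<close>
  have en: "null_in_prob M (\<lambda>r \<omega>. \<Sum>k<K n. dW j n k \<omega> *\<^sub>R \<rho> n k r \<omega>)" for n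
    unfolding \<rho>_def by (intro null_in_prob_sum null_in_prob_mult_tight strat_cell_expansion tight_seq_const) measurable
  \<comment> \<open>The rate 1 / (n + 1) is arbitrary. What matters is that a depth can be chosen
    for each n, which turns the double limit into a single one.\<close>
  have "\<exists>r. expectation (\<lambda>\<omega>. min 1 (norm (\<Sum>k<K n. dW j n k \<omega> *\<^sub>R \<rho> n k r \<omega>))) < 1 / real (Suc n)" for n
  proof -
    have "(\<lambda>r. expectation (\<lambda>\<omega>. min 1 (norm (\<Sum>k<K n. dW j n k \<omega> *\<^sub>R \<rho> n k r \<omega>)))) \<longlonglongrightarrow> 0"
      using en[of n] unfolding null_in_prob_def by (rule conjunct2)
    then have "\<forall>\<^sub>F r in sequentially. expectation (\<lambda>\<omega>. min 1 (norm (\<Sum>k<K n. dW j n k \<omega> *\<^sub>R \<rho> n k r \<omega>))) < 1 / real (Suc n)"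
      by (rule order_tendstoD(2)) simp
    then show ?thesis by (rule eventually_happens'[OF sequentially_bot])
  qed
  then have "\<exists>\<mu>. \<forall>n. expectation (\<lambda>\<omega>. min 1 (norm (\<Sum>k<K n. dW j n k \<omega> *\<^sub>R \<rho> n k (\<mu> n) \<omega>))) < 1 / real (Suc n)"
    by (intro choice allI)
  then obtain \<mu> where \<mu>: "\<forall>n. expectation (\<lambda>\<omega>. min 1 (norm (\<Sum>k<K n. dW j n k \<omega> *\<^sub>R \<rho> n k (\<mu> n) \<omega>))) < 1 / real (Suc n)" ..
  define e where "e n \<omega> = (\<Sum>k<K n. dW j n k \<omega> *\<^sub>R \<rho> n k (\<mu> n) \<omega>)" for n \<omega>
  have e: "null_in_prob M e"
    unfolding null_in_prob_def
  proof (intro conjI allI)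
    show "e n \<in> borel_measurable M" for n unfolding e_def by measurable
    show "(\<lambda>n. expectation (\<lambda>\<omega>. min 1 (norm (e n \<omega>)))) \<longlonglongrightarrow> 0"
    proof (rule tendsto_sandwich[OF _ _ tendsto_const])
      show "\<forall>\<^sub>F n in sequentially. 0 \<le> expectation (\<lambda>\<omega>. min 1 (norm (e n \<omega>)))"
        by (intro always_eventually allI integral_nonneg_AE) auto
      show "\<forall>\<^sub>F n in sequentially. expectation (\<lambda>\<omega>. min 1 (norm (e n \<omega>))) \<le> 1 / real (Suc n)"
        using \<mu> by (intro always_eventually allI less_imp_le) (simp add: e_def)
      show "(\<lambda>n. 1 / real (Suc n)) \<longlonglongrightarrow> 0" by (rule LIMSEQ_Suc) (rule lim_1_over_n)
    qed
  qed
  define p where "p n k l = k * 2 ^ \<mu> n + l" for n k l :: nat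
  define a where "a n \<omega> = (\<Sum>k<K n. dW j n k \<omega> *\<^sub>R (\<Sum>l<2 ^ \<mu> n. mesh (n + \<mu> n) *\<^sub>R (A *v X (g (n + \<mu> n) (p n k l)) \<omega>)))" for n \<omega>
  define b where "b i n \<omega> = (\<Sum>k<K n. dWW j i n k \<omega> *\<^sub>R X (g n k) \<omega>)" for i n \<omega>
  define C where "C i n k \<omega> = (\<Sum>l<2 ^ \<mu> n. dW i (n + \<mu> n) (p n k l) \<omega> *\<^sub>R (X (g (n + \<mu> n) (p n k l)) \<omega> - X (g n k) \<omega>))" for i n k \<omega>
  define D where "D i n k \<omega> = (\<Sum>l<2 ^ \<mu> n. dW i (n + \<mu> n) (p n k l) \<omega> *\<^sub>R (X (g (n + \<mu> n) (Suc (p n k l))) \<omega> - X (g (n + \<mu> n) (p n k l)) \<omega>))" for i n k \<omega>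
  have a: "null_in_prob M a" unfolding a_def p_def by (rule cell_drift_null[OF K])
  have b: "null_in_prob M (b i)" for i unfolding b_def by (rule bracket_sum_null[OF K])
  have c: "null_in_prob M (\<lambda>n \<omega>. \<Sum>k<K n. dW j n k \<omega> *\<^sub>R C i n k \<omega>)" for i
    unfolding C_def p_def by (rule cell_fluctuation_null[OF K])
  have d: "null_in_prob M (\<lambda>n \<omega>. \<Sum>k<K n. dW j n k \<omega> *\<^sub>R D i n k \<omega>)" for i
    unfolding D_def p_def by (rule cell_second_order_null[OF K])
  have main: "null_in_prob M (\<lambda>n \<omega>. a n \<omega> + e n \<omega> + (\<Sum>i\<in>UNIV. B i *v (b i n \<omega> + (\<Sum>k<K n. dW j n k \<omega> *\<^sub>R C i n k \<omega>)
     + (1/2) *\<^sub>R (\<Sum>k<K n. dW j n k \<omega> *\<^sub>R D i n k \<omega>))))"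
    by (intro null_in_prob_add a e null_in_prob_sum null_in_prob_bounded_linear[OF _ matrix_vector_mul_bounded_linear]
        b c null_in_prob_bounded_linear[OF d bounded_linear_scaleR_right])
  moreover have "(\<Sum>k<K n. dW j n k \<omega> *\<^sub>R (X (g n (Suc k)) \<omega> - X (g n k) \<omega>) - mesh n *\<^sub>R (B j *v X (g n k) \<omega>)) =
     a n \<omega> + e n \<omega> + (\<Sum>i\<in>UNIV. B i *v (b i n \<omega> + (\<Sum>k<K n. dW j n k \<omega> *\<^sub>R C i n k \<omega>)
     + (1/2) *\<^sub>R (\<Sum>k<K n. dW j n k \<omega> *\<^sub>R D i n k \<omega>)))" for n \<omega>
  proof -
    \<comment> \<open>\<open>\<delta> i\<close> is the bracket part removed in \<open>dWW\<close>.
      After application of B_i and summation over i exactly the term of B_j is left, which is the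
      compensator in the claim.\<close>
    define \<delta> where "\<delta> i = (if j = i then mesh n else 0)" for i
    have cell: "dW j n k \<omega> *\<^sub>R (X (g n (Suc k)) \<omega> - X (g n k) \<omega>) - mesh n *\<^sub>R (B j *v X (g n k) \<omega>) =
      dW j n k \<omega> *\<^sub>R (\<Sum>l<2 ^ \<mu> n. mesh (n + \<mu> n) *\<^sub>R (A *v X (g (n + \<mu> n) (p n k l)) \<omega>)) + dW j n k \<omega> *\<^sub>R \<rho> n k (\<mu> n) \<omega>
      + (\<Sum>i\<in>UNIV. B i *v (dWW j i n k \<omega> *\<^sub>R X (g n k) \<omega> + dW j n k \<omega> *\<^sub>R C i n k \<omega> + (1/2) *\<^sub>R (dW j n k \<omega> *\<^sub>R D i n k \<omega>)))" for k
    proof -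
      have 1: "X (g n (Suc k)) \<omega> - X (g n k) \<omega> = \<rho> n k (\<mu> n) \<omega> + ((\<Sum>l<2 ^ \<mu> n. mesh (n + \<mu> n) *\<^sub>R (A *v X (g (n + \<mu> n) (p n k l)) \<omega>))
        + (\<Sum>i\<in>UNIV. B i *v (dW i n k \<omega> *\<^sub>R X (g n k) \<omega> + C i n k \<omega> + (1/2) *\<^sub>R D i n k \<omega>)))"
        unfolding C_def D_def p_def cell_strat_decomposition[symmetric] by (simp add: \<rho>_def)
      have "(\<Sum>i\<in>UNIV. \<delta> i *\<^sub>R (B i *v X (g n k) \<omega>)) = (\<Sum>i\<in>UNIV. if j = i then mesh n *\<^sub>R (B i *v X (g n k) \<omega>) else 0)"
        by (rule sum.cong) (auto simp: \<delta>_def)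
      also have "\<dots> = mesh n *\<^sub>R (B j *v X (g n k) \<omega>)" by simp
      finally have 2: "mesh n *\<^sub>R (B j *v X (g n k) \<omega>) = (\<Sum>i\<in>UNIV. \<delta> i *\<^sub>R (B i *v X (g n k) \<omega>))" by simp
      have 3: "B i *v (dWW j i n k \<omega> *\<^sub>R X (g n k) \<omega> + dW j n k \<omega> *\<^sub>R C i n k \<omega> + (1/2) *\<^sub>R (dW j n k \<omega> *\<^sub>R D i n k \<omega>)) =
        dW j n k \<omega> *\<^sub>R (B i *v (dW i n k \<omega> *\<^sub>R X (g n k) \<omega> + C i n k \<omega> + (1/2) *\<^sub>R D i n k \<omega>)) - \<delta> i *\<^sub>R (B i *v X (g n k) \<omega>)" for i
        by (simp add: dWW_def \<delta>_def[symmetric] matrix_vector_right_distrib matrix_vector_mult_scaleR algebra_simps)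
      show ?thesis unfolding 1 2 3 sum_subtractf scaleR_sum_right[symmetric] by (simp add: scaleR_add_right)
    qed
    have "(\<Sum>k<K n. dW j n k \<omega> *\<^sub>R (X (g n (Suc k)) \<omega> - X (g n k) \<omega>) - mesh n *\<^sub>R (B j *v X (g n k) \<omega>)) =
      a n \<omega> + e n \<omega> + (\<Sum>k<K n. \<Sum>i\<in>UNIV. B i *v (dWW j i n k \<omega> *\<^sub>R X (g n k) \<omega> + dW j n k \<omega> *\<^sub>R C i n k \<omega> + (1/2) *\<^sub>R (dW j n k \<omega> *\<^sub>R D i n k \<omega>)))"
      unfolding cell sum.distrib a_def e_def ..
    also have "(\<Sum>k<K n. \<Sum>i\<in>UNIV. B i *v (dWW j i n k \<omega> *\<^sub>R X (g n k) \<omega> + dW j n k \<omega> *\<^sub>R C i n k \<omega> + (1/2) *\<^sub>R (dW j n k \<omega> *\<^sub>R D i n k \<omega>))) =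
      (\<Sum>i\<in>UNIV. B i *v (b i n \<omega> + (\<Sum>k<K n. dW j n k \<omega> *\<^sub>R C i n k \<omega>) + (1/2) *\<^sub>R (\<Sum>k<K n. dW j n k \<omega> *\<^sub>R D i n k \<omega>)))"
      by (subst sum.swap) (simp add: b_def linear_sum[OF matrix_vector_mul_linear, symmetric] sum.distrib scaleR_sum_right)
    finally show ?thesis .
  qed
  ultimately show ?thesis by (simp only:)
qed

section \<open>Left-point steps with corrected drift\<close>

abbreviation At :: "real^'n^'n" where "At \<equiv> ito_drift A B"

text \<open>The state \<open>v\<close> is an argument because the same linear step is applied to X,
  to its truncation, to increments of X, to the Euler scheme and to its error.\<close>

definition ito_step :: "nat \<Rightarrow> nat \<Rightarrow> 'a \<Rightarrow> real^'n \<Rightarrow> real^'n" where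
  "ito_step m l \<omega> v = mesh m *\<^sub>R (At *v v) + (\<Sum>j\<in>UNIV. dW j m l \<omega> *\<^sub>R (B j *v v))"

lemma ito_step_measurable[measurable (raw)]:
  assumes [measurable]: "G \<in> borel_measurable M"
  shows "(\<lambda>\<omega>. ito_step m l \<omega> (G \<omega>)) \<in> borel_measurable M"
  unfolding ito_step_def by measurable

lemma ito_drift_mult: "At *v v = A *v v + (1/2) *\<^sub>R (\<Sum>j\<in>UNIV. B j *v (B j *v v))"
  by (simp add: sum_matrix_vector_mult ito_drift_def matrix_vector_mult_add_rdistrib matrix_vector_mul_assoc scaleR_matrix_vector_assoc[symmetric])

text \<open>The symmetric rule differs from the left-point rule by half the product of the two
  increments. The compensator of this product, \<open>mesh m\<close> times B_j applied to B_j X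
  after the outer B_j, is what \<open>ito_drift\<close> adds to A in halves, so that only the
  compensated covariation remains.\<close>

lemma strat_minus_ito:
  "strat_step m l \<omega> - ito_step m l \<omega> (X (g m l) \<omega>) =
    (1/2) *\<^sub>R (\<Sum>j\<in>UNIV. B j *v (dW j m l \<omega> *\<^sub>R (X (g m (Suc l)) \<omega> - X (g m l) \<omega>) - mesh m *\<^sub>R (B j *v X (g m l) \<omega>)))"
proof -
  define Y Y' where "Y = X (g m l) \<omega>" and "Y' = X (g m (Suc l)) \<omega>"
  have 1: "dW j m l \<omega> *\<^sub>R (B j *v ((1/2) *\<^sub>R (Y + Y'))) - dW j m l \<omega> *\<^sub>R (B j *v Y) =
     (1/2) *\<^sub>R (dW j m l \<omega> *\<^sub>R (B j *v (Y' - Y)))" for j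
  proof -
    have "(1/2) *\<^sub>R (Y + Y') = Y + (1/2) *\<^sub>R (Y' - Y)"
      by (simp add: vec_eq_iff field_simps)
    then show ?thesis by (simp add: matrix_vector_right_distrib matrix_vector_mult_scaleR scaleR_add_right)
  qed
  have "strat_step m l \<omega> - ito_step m l \<omega> Y = (\<Sum>j\<in>UNIV. (1/2) *\<^sub>R (dW j m l \<omega> *\<^sub>R (B j *v (Y' - Y)))) - mesh m *\<^sub>R ((1/2) *\<^sub>R (\<Sum>j\<in>UNIV. B j *v (B j *v Y)))"
    unfolding strat_step_def ito_step_def ito_drift_mult Y_def[symmetric] Y'_def[symmetric] 1[symmetric] sum_subtractf
    by (simp add: scaleR_add_right)
  also have "\<dots> = (1/2) *\<^sub>R (\<Sum>j\<in>UNIV. B j *v (dW j m l \<omega> *\<^sub>R (Y' - Y) - mesh m *\<^sub>R (B j *v Y)))"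
    by (simp add: matrix_vector_mult_diff_distrib matrix_vector_mult_scaleR sum_subtractf scaleR_diff_right scaleR_sum_right mult.commute)
  finally show ?thesis by (simp add: Y_def Y'_def)
qed

lemma ito_expansion:
  assumes "k \<le> 2 ^ n"
  shows "null_in_prob M (\<lambda>r \<omega>. X (g n k) \<omega> - x - (\<Sum>l<k * 2 ^ r. ito_step (n + r) l \<omega> (X (g (n + r) l) \<omega>)))"
proof -
  \<comment> \<open>\<open>covariation_null\<close> is indexed by the level m itself, and
    \<open>K m\<close> is the position of the time \<open>g n k\<close> on level m. The value 0
    below level n keeps the position within the grid; the subsequence m = n + r is taken
    afterwards.\<close>
  define K where "K m = (if n \<le> m then k * 2 ^ (m - n) else 0)" for m
  have K: "K m \<le> 2 ^ m" for m
  proof (cases "n \<le> m")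
    case True
    then have "k * 2 ^ (m - n) \<le> 2 ^ n * 2 ^ (m - n)" using assms by simp
    then show ?thesis using True by (simp add: K_def power_add[symmetric])
  qed (simp add: K_def)
  define Q where "Q j m \<omega> = (\<Sum>k<K m. dW j m k \<omega> *\<^sub>R (X (g m (Suc k)) \<omega> - X (g m k) \<omega>) - mesh m *\<^sub>R (B j *v X (g m k) \<omega>))" for j m \<omega>
  have Q: "null_in_prob M (Q j)" for j unfolding Q_def by (rule covariation_null[OF K])
  have "filterlim (\<lambda>r. n + r) sequentially sequentially" by (rule filterlim_subseq) (auto simp: strict_mono_def)
  from null_in_prob_subseq[OF Q this]
  have Q': "null_in_prob M (\<lambda>r. Q j (n + r))" for j .
  have "null_in_prob M (\<lambda>r \<omega>. (X (g n k) \<omega> - x - (\<Sum>l<k * 2 ^ r. strat_step (n + r) l \<omega>)) + (1/2) *\<^sub>R (\<Sum>j\<in>UNIV. B j *v Q j (n + r) \<omega>))"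
    by (intro null_in_prob_add strat_expansion null_in_prob_bounded_linear[OF _ bounded_linear_scaleR_right]
      null_in_prob_sum null_in_prob_bounded_linear[OF Q' matrix_vector_mul_bounded_linear])
  moreover have "(X (g n k) \<omega> - x - (\<Sum>l<k * 2 ^ r. strat_step (n + r) l \<omega>)) + (1/2) *\<^sub>R (\<Sum>j\<in>UNIV. B j *v Q j (n + r) \<omega>)
     = X (g n k) \<omega> - x - (\<Sum>l<k * 2 ^ r. ito_step (n + r) l \<omega> (X (g (n + r) l) \<omega>))" for r \<omega>
  proof -
    let ?m = "n + r"
    have "(\<Sum>l<k * 2 ^ r. strat_step ?m l \<omega>) - (\<Sum>l<k * 2 ^ r. ito_step ?m l \<omega> (X (g ?m l) \<omega>)) =
      (\<Sum>l<k * 2 ^ r. (1/2) *\<^sub>R (\<Sum>j\<in>UNIV. B j *v (dW j ?m l \<omega> *\<^sub>R (X (g ?m (Suc l)) \<omega> - X (g ?m l) \<omega>) - mesh ?m *\<^sub>R (B j *v X (g ?m l) \<omega>))))"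
      unfolding sum_subtractf[symmetric] strat_minus_ito ..
    also have "\<dots> = (1/2) *\<^sub>R (\<Sum>j\<in>UNIV. B j *v Q j ?m \<omega>)"
    proof -
      have KK: "K ?m = k * 2 ^ r" by (simp add: K_def)
      have "(\<Sum>l<k * 2 ^ r. \<Sum>j\<in>UNIV. B j *v (dW j ?m l \<omega> *\<^sub>R (X (g ?m (Suc l)) \<omega> - X (g ?m l) \<omega>) - mesh ?m *\<^sub>R (B j *v X (g ?m l) \<omega>)))
        = (\<Sum>j\<in>UNIV. B j *v Q j ?m \<omega>)"
        unfolding Q_def KK linear_sum[OF matrix_vector_mul_linear] by (rule sum.swap)
      then show ?thesis by (simp only: scaleR_sum_right[symmetric])
    qed
    finally show ?thesis by (simp add: algebra_simps)
  qed
  ultimately show ?thesis by (simp only:)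
qed

end

section \<open>Mean square estimates and the Euler scheme\<close>

lemma norm_add_square_le: "(norm (a + b))\<^sup>2 \<le> 2 * (norm a)\<^sup>2 + 2 * (norm b)\<^sup>2"
  for a b :: "'b::real_normed_vector"
proof -
  have "(norm (a + b))\<^sup>2 \<le> (norm a + norm b)\<^sup>2" by (intro power_mono norm_triangle_ineq) auto
  also have "\<dots> \<le> 2 * (norm a)\<^sup>2 + 2 * (norm b)\<^sup>2"
    using sum_squares_bound[of "norm a" "norm b"] by (simp add: power2_sum)
  finally show ?thesis .
qed

lemma norm_sum_square_le:
  fixes f :: "'i \<Rightarrow> 'b::real_normed_vector"
  shows "(norm (\<Sum>i\<in>S. f i))\<^sup>2 \<le> real (card S) * (\<Sum>i\<in>S. (norm (f i))\<^sup>2)"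
proof -
  have "(norm (\<Sum>i\<in>S. f i))\<^sup>2 \<le> (\<Sum>i\<in>S. norm (f i))\<^sup>2" by (intro power_mono norm_sum) auto
  also have "\<dots> \<le> (\<Sum>i\<in>S. (norm (f i))\<^sup>2) * real (card S)" by (rule sum_squared_le_sum_of_squares)
  finally show ?thesis by (simp add: mult.commute)
qed

lemma discrete_gronwall:
  fixes u :: "nat \<Rightarrow> real"
  assumes u: "\<And>k. k \<le> K \<Longrightarrow> u k \<le> a + b * (\<Sum>l<k. u l)" and b: "b \<ge> 0" and k: "k \<le> K"
  shows "u k \<le> a * (1 + b) ^ k"
proof -
  \<comment> \<open>The induction runs over the right-hand side, whose value at k + 1 exceeds that
    at k by b times \<open>u k\<close>.\<close>
  have "a + b * (\<Sum>l<k. u l) \<le> a * (1 + b) ^ k" using k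
  proof (induction k)
    case (Suc k)
    then have "u k \<le> a * (1 + b) ^ k" and "a + b * (\<Sum>l<k. u l) \<le> a * (1 + b) ^ k"
      using u[of k] by auto
    then have "a + b * (\<Sum>l<Suc k. u l) \<le> a * (1 + b) ^ k + b * (a * (1 + b) ^ k)"
      using mult_left_mono[OF \<open>u k \<le> a * (1 + b) ^ k\<close> b] by (simp add: distrib_left)
    then show ?case by (simp add: algebra_simps)
  qed simp
  then show ?thesis using u[OF k] by linarith
qed

context prob_space
begin

lemma L2_add:
  fixes f g :: "'a \<Rightarrow> 'b::{second_countable_topology,real_normed_vector}"
  assumes [measurable]: "f \<in> borel_measurable M" "g \<in> borel_measurable M"
    and f: "integrable M (\<lambda>\<omega>. (norm (f \<omega>))\<^sup>2)" and g: "integrable M (\<lambda>\<omega>. (norm (g \<omega>))\<^sup>2)"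
  shows "integrable M (\<lambda>\<omega>. (norm (f \<omega> + g \<omega>))\<^sup>2)"
    and "expectation (\<lambda>\<omega>. (norm (f \<omega> + g \<omega>))\<^sup>2) \<le> 2 * expectation (\<lambda>\<omega>. (norm (f \<omega>))\<^sup>2) + 2 * expectation (\<lambda>\<omega>. (norm (g \<omega>))\<^sup>2)"
proof -
  show int: "integrable M (\<lambda>\<omega>. (norm (f \<omega> + g \<omega>))\<^sup>2)"
    by (rule Bochner_Integration.integrable_bound[where f="\<lambda>\<omega>. 2 * (norm (f \<omega>))\<^sup>2 + 2 * (norm (g \<omega>))\<^sup>2"])
      (use f g norm_add_square_le in auto)
  have "expectation (\<lambda>\<omega>. (norm (f \<omega> + g \<omega>))\<^sup>2) \<le> expectation (\<lambda>\<omega>. 2 * (norm (f \<omega>))\<^sup>2 + 2 * (norm (g \<omega>))\<^sup>2)"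
    by (rule integral_mono[OF int]) (use f g norm_add_square_le in auto)
  then show "expectation (\<lambda>\<omega>. (norm (f \<omega> + g \<omega>))\<^sup>2) \<le> 2 * expectation (\<lambda>\<omega>. (norm (f \<omega>))\<^sup>2) + 2 * expectation (\<lambda>\<omega>. (norm (g \<omega>))\<^sup>2)"
    using f g by simp
qed

lemma L2_diff:
  fixes f g :: "'a \<Rightarrow> 'b::{second_countable_topology,real_normed_vector}"
  assumes [measurable]: "f \<in> borel_measurable M" "g \<in> borel_measurable M"
    and f: "integrable M (\<lambda>\<omega>. (norm (f \<omega>))\<^sup>2)" and g: "integrable M (\<lambda>\<omega>. (norm (g \<omega>))\<^sup>2)"
  shows "integrable M (\<lambda>\<omega>. (norm (f \<omega> - g \<omega>))\<^sup>2)"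
  using L2_add(1)[of f "\<lambda>\<omega>. - g \<omega>"] assms by simp

end

context stratonovich_setting
begin

text \<open>The factors 2 come from separating drift and noise inside a square, T from
  Cauchy-Schwarz over the time steps, and the number of noises from Cauchy-Schwarz over j. The
  summand 1 makes the constant positive, as it is later used to define a positive exponential
  rate.\<close>

definition C0 :: real where
  "C0 = 1 + 2 * T * (onorm ((*v) At))\<^sup>2 + 2 * real (CARD('l)) * (\<Sum>j\<in>UNIV. (onorm ((*v) (B j)))\<^sup>2)"

lemma C0_pos: "C0 > 0"
proof -
  have "0 \<le> 2 * T * (onorm ((*v) At))\<^sup>2" using T_pos by simp
  moreover have "0 \<le> 2 * real (CARD('l)) * (\<Sum>j\<in>UNIV. (onorm ((*v) (B j)))\<^sup>2)" by (intro mult_nonneg_nonneg sum_nonneg) auto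
  ultimately show ?thesis unfolding C0_def by linarith
qed

lemma matvec_onorm_square: "(norm (N *v v))\<^sup>2 \<le> (onorm ((*v) N))\<^sup>2 * (norm v)\<^sup>2"
  for N :: "real^'n^'n"
  using power_mono[OF onorm[OF matrix_vector_mul_bounded_linear, of N v] norm_ge_zero, of 2] by (simp add: power_mult_distrib)

lemma L2_matvec:
  fixes N :: "real^'n^'n"
  assumes [measurable]: "G \<in> borel_measurable M" and G: "integrable M (\<lambda>\<omega>. (norm (G \<omega>))\<^sup>2)"
  shows "integrable M (\<lambda>\<omega>. (norm (N *v G \<omega>))\<^sup>2)"
    and "expectation (\<lambda>\<omega>. (norm (N *v G \<omega>))\<^sup>2) \<le> (onorm ((*v) N))\<^sup>2 * expectation (\<lambda>\<omega>. (norm (G \<omega>))\<^sup>2)"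
proof -
  show int: "integrable M (\<lambda>\<omega>. (norm (N *v G \<omega>))\<^sup>2)"
    by (rule Bochner_Integration.integrable_bound[where f="\<lambda>\<omega>. (onorm ((*v) N))\<^sup>2 * (norm (G \<omega>))\<^sup>2"])
      (use G matvec_onorm_square in auto)
  have "expectation (\<lambda>\<omega>. (norm (N *v G \<omega>))\<^sup>2) \<le> expectation (\<lambda>\<omega>. (onorm ((*v) N))\<^sup>2 * (norm (G \<omega>))\<^sup>2)"
    by (rule integral_mono[OF int]) (use G matvec_onorm_square in auto)
  then show "expectation (\<lambda>\<omega>. (norm (N *v G \<omega>))\<^sup>2) \<le> (onorm ((*v) N))\<^sup>2 * expectation (\<lambda>\<omega>. (norm (G \<omega>))\<^sup>2)"
    by simp
qed

text \<open>Discrete Ito isometry with drift. The drift is estimated by Cauchy-Schwarz over steps of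
  total length at most T, the noise by orthogonality; both are of the order of the mesh times the
  sum of the second moments.\<close>

lemma ito_sum_L2:
  assumes K: "K \<le> 2 ^ m" and GF: "\<And>l. l < K \<Longrightarrow> G l \<in> borel_measurable (F (g m l))"
    and GL2: "\<And>l. l < K \<Longrightarrow> integrable M (\<lambda>\<omega>. (norm (G l \<omega>))\<^sup>2)"
  shows "integrable M (\<lambda>\<omega>. (norm (\<Sum>l<K. ito_step m l \<omega> (G l \<omega>)))\<^sup>2)"
    and "expectation (\<lambda>\<omega>. (norm (\<Sum>l<K. ito_step m l \<omega> (G l \<omega>)))\<^sup>2)
      \<le> C0 * mesh m * (\<Sum>l<K. expectation (\<lambda>\<omega>. (norm (G l \<omega>))\<^sup>2))"
proof -
  have Gm: "G l \<in> borel_measurable M" if "l < K" for l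
    by (rule F_measurable_M[OF g_nonneg GF[OF that]])
  define S where "S = (\<Sum>l<K. expectation (\<lambda>\<omega>. (norm (G l \<omega>))\<^sup>2))"
  have S0: "S \<ge> 0" unfolding S_def by (intro sum_nonneg integral_nonneg_AE) auto
  have h0: "mesh m \<ge> 0" using mesh_pos[of m] by simp
  define a where "a \<omega> = (\<Sum>l<K. mesh m *\<^sub>R (At *v G l \<omega>))" for \<omega>
  define b where "b j \<omega> = (\<Sum>l<K. dW j m l \<omega> *\<^sub>R (B j *v G l \<omega>))" for j \<omega>
  have am: "a \<in> borel_measurable M" unfolding a_def
    by (intro borel_measurable_sum borel_measurable_scaleR borel_measurable_const matvec_measurable Gm) auto
  have bm: "b j \<in> borel_measurable M" for j unfolding b_def
    by (intro borel_measurable_sum borel_measurable_scaleR dW_measurable matvec_measurable Gm) auto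
  have eq: "(\<Sum>l<K. ito_step m l \<omega> (G l \<omega>)) = a \<omega> + (\<Sum>j\<in>UNIV. b j \<omega>)" for \<omega>
    unfolding a_def b_def ito_step_def sum.distrib by (subst sum.swap) simp
  have a: "integrable M (\<lambda>\<omega>. (norm (a \<omega>))\<^sup>2)" "expectation (\<lambda>\<omega>. (norm (a \<omega>))\<^sup>2) \<le> T * (onorm ((*v) At))\<^sup>2 * (mesh m * S)"
  proof -
    have le: "(norm (a \<omega>))\<^sup>2 \<le> T * mesh m * (\<Sum>l<K. (norm (At *v G l \<omega>))\<^sup>2)" for \<omega>
    proof -
      have "(norm (a \<omega>))\<^sup>2 \<le> real (card {..<K}) * (\<Sum>l<K. (norm (mesh m *\<^sub>R (At *v G l \<omega>)))\<^sup>2)"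
        unfolding a_def by (rule norm_sum_square_le)
      also have "\<dots> = (real K * mesh m) * mesh m * (\<Sum>l<K. (norm (At *v G l \<omega>))\<^sup>2)"
      proof -
        have "(norm (mesh m *\<^sub>R (At *v G l \<omega>)))\<^sup>2 = (mesh m * mesh m) * (norm (At *v G l \<omega>))\<^sup>2" for l
          by (simp add: power_mult_distrib power2_eq_square[of "mesh m"])
        then have "(\<Sum>l<K. (norm (mesh m *\<^sub>R (At *v G l \<omega>)))\<^sup>2) = (mesh m * mesh m) * (\<Sum>l<K. (norm (At *v G l \<omega>))\<^sup>2)"
          by (simp only: sum_distrib_left)
        then show ?thesis by simp
      qed
      also have "\<dots> \<le> T * mesh m * (\<Sum>l<K. (norm (At *v G l \<omega>))\<^sup>2)"
        using g_le_T[OF K] h0 by (intro mult_right_mono sum_nonneg) (auto simp: g_def)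
      finally show ?thesis .
    qed
    have int: "integrable M (\<lambda>\<omega>. T * mesh m * (\<Sum>l<K. (norm (At *v G l \<omega>))\<^sup>2))"
      by (intro Bochner_Integration.integrable_mult_right Bochner_Integration.integrable_sum L2_matvec Gm GL2) auto
    show aint: "integrable M (\<lambda>\<omega>. (norm (a \<omega>))\<^sup>2)"
      by (rule Bochner_Integration.integrable_bound[OF int]) (use am le in \<open>auto intro!: AE_I2 order_trans[OF _ abs_ge_self]\<close>)
    have "expectation (\<lambda>\<omega>. (norm (a \<omega>))\<^sup>2) \<le> expectation (\<lambda>\<omega>. T * mesh m * (\<Sum>l<K. (norm (At *v G l \<omega>))\<^sup>2))"
      by (rule integral_mono[OF aint int le])
    also have "\<dots> = T * mesh m * (\<Sum>l<K. expectation (\<lambda>\<omega>. (norm (At *v G l \<omega>))\<^sup>2))"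
      using L2_matvec(1)[OF Gm GL2] by simp
    also have "\<dots> \<le> T * mesh m * (\<Sum>l<K. (onorm ((*v) At))\<^sup>2 * expectation (\<lambda>\<omega>. (norm (G l \<omega>))\<^sup>2))"
      using h0 T_pos L2_matvec(2)[OF Gm GL2] by (intro mult_left_mono sum_mono) auto
    also have "\<dots> = T * (onorm ((*v) At))\<^sup>2 * (mesh m * S)" by (simp add: S_def sum_distrib_left[symmetric])
    finally show "expectation (\<lambda>\<omega>. (norm (a \<omega>))\<^sup>2) \<le> T * (onorm ((*v) At))\<^sup>2 * (mesh m * S)" .
  qed
  have b: "integrable M (\<lambda>\<omega>. (norm (b j \<omega>))\<^sup>2)" "expectation (\<lambda>\<omega>. (norm (b j \<omega>))\<^sup>2) \<le> (onorm ((*v) (B j)))\<^sup>2 * (mesh m * S)" for j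
  proof -
    have sq: "integrable M (\<lambda>\<omega>. (dW j m l \<omega>)\<^sup>2 * (norm (B j *v G l \<omega>))\<^sup>2) \<and>
       expectation (\<lambda>\<omega>. (dW j m l \<omega>)\<^sup>2 * (norm (B j *v G l \<omega>))\<^sup>2) \<le> mesh m * ((onorm ((*v) (B j)))\<^sup>2 * expectation (\<lambda>\<omega>. (norm (G l \<omega>))\<^sup>2))"
      if "l < K" for l
    proof -
      have "(\<lambda>\<omega>. (norm (B j *v G l \<omega>))\<^sup>2) \<in> borel_measurable (F (g m l))" using GF[OF that] by measurable
      from dW_mult2[OF this L2_matvec(1)[OF Gm[OF that] GL2[OF that]], of j]
      show ?thesis using mult_left_mono[OF L2_matvec(2)[OF Gm[OF that] GL2[OF that], of "B j"] h0] by (simp add: mult.commute)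
    qed
    have vF: "(\<lambda>\<omega>. B j *v G l \<omega>) \<in> borel_measurable (F (g m l))" if "l < K" for l using GF[OF that] by measurable
    note rule = martingale_sum_L2[where t="g m", OF g_nonneg less_imp_le[OF g_less] vF dW_adapted L2_matvec(1)[OF Gm GL2] dW_mult1 sq]
    show "integrable M (\<lambda>\<omega>. (norm (b j \<omega>))\<^sup>2)" unfolding b_def by (rule rule(1))
    have "expectation (\<lambda>\<omega>. (norm (b j \<omega>))\<^sup>2) \<le> (\<Sum>l<K. mesh m * ((onorm ((*v) (B j)))\<^sup>2 * expectation (\<lambda>\<omega>. (norm (G l \<omega>))\<^sup>2)))"
      unfolding b_def by (rule rule(2))
    also have "\<dots> = (onorm ((*v) (B j)))\<^sup>2 * (mesh m * S)" by (simp add: S_def sum_distrib_left[symmetric])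
    finally show "expectation (\<lambda>\<omega>. (norm (b j \<omega>))\<^sup>2) \<le> (onorm ((*v) (B j)))\<^sup>2 * (mesh m * S)" .
  qed
  have le: "(norm (a \<omega> + (\<Sum>j\<in>UNIV. b j \<omega>)))\<^sup>2 \<le> 2 * (norm (a \<omega>))\<^sup>2 + 2 * real CARD('l) * (\<Sum>j\<in>UNIV. (norm (b j \<omega>))\<^sup>2)" for \<omega>
    using norm_add_square_le[of "a \<omega>" "\<Sum>j\<in>UNIV. b j \<omega>"] norm_sum_square_le[of "\<lambda>j. b j \<omega>" UNIV] by linarith
  have int: "integrable M (\<lambda>\<omega>. 2 * (norm (a \<omega>))\<^sup>2 + 2 * real CARD('l) * (\<Sum>j\<in>UNIV. (norm (b j \<omega>))\<^sup>2))"
    using a b by auto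
  show res: "integrable M (\<lambda>\<omega>. (norm (\<Sum>l<K. ito_step m l \<omega> (G l \<omega>)))\<^sup>2)"
    unfolding eq
    by (rule Bochner_Integration.integrable_bound[OF int]) (use am bm le in \<open>auto intro!: AE_I2 order_trans[OF _ abs_ge_self]\<close>)
  have "expectation (\<lambda>\<omega>. (norm (\<Sum>l<K. ito_step m l \<omega> (G l \<omega>)))\<^sup>2) \<le>
     expectation (\<lambda>\<omega>. 2 * (norm (a \<omega>))\<^sup>2 + 2 * real CARD('l) * (\<Sum>j\<in>UNIV. (norm (b j \<omega>))\<^sup>2))"
    unfolding eq by (rule integral_mono[OF res[unfolded eq] int le])
  also have "\<dots> = 2 * expectation (\<lambda>\<omega>. (norm (a \<omega>))\<^sup>2) + 2 * real CARD('l) * (\<Sum>j\<in>UNIV. expectation (\<lambda>\<omega>. (norm (b j \<omega>))\<^sup>2))"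
    using a(1) b(1) by simp
  also have "\<dots> \<le> 2 * (T * (onorm ((*v) At))\<^sup>2 * (mesh m * S)) + 2 * real CARD('l) * (\<Sum>j\<in>UNIV. (onorm ((*v) (B j)))\<^sup>2 * (mesh m * S))"
    by (intro add_mono mult_left_mono sum_mono a(2) b(2)) auto
  also have "\<dots> = (C0 - 1) * (mesh m * S)"
    unfolding C0_def sum_distrib_right[symmetric] by (simp add: algebra_simps)
  also have "\<dots> \<le> C0 * (mesh m * S)" using S0 h0 by (intro mult_right_mono) auto
  finally show "expectation (\<lambda>\<omega>. (norm (\<Sum>l<K. ito_step m l \<omega> (G l \<omega>)))\<^sup>2)
      \<le> C0 * mesh m * (\<Sum>l<K. expectation (\<lambda>\<omega>. (norm (G l \<omega>))\<^sup>2))" by (simp add: S_def)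
qed

section \<open>Linearity of the step and a priori bounds of second moments\<close>

lemma ito_step_0[simp]: "ito_step m l \<omega> 0 = 0" by (simp add: ito_step_def)

lemma ito_step_diff: "ito_step m l \<omega> (u - v) = ito_step m l \<omega> u - ito_step m l \<omega> v"
  by (simp add: ito_step_def matrix_vector_mult_diff_distrib scaleR_diff_right sum_subtractf)

text \<open>While the state is frozen, fine steps add up exactly to the coarse step. This is why the
  error of the Euler scheme involves only increments of X inside a cell.\<close>

lemma ito_step_refine: "(\<Sum>l<2 ^ r. ito_step (n + r) (i * 2 ^ r + l) \<omega> v) = ito_step n i \<omega> v"
proof -
  have "(\<Sum>l<2 ^ r. ito_step (n + r) (i * 2 ^ r + l) \<omega> v) = (2 ^ r * mesh (n + r)) *\<^sub>R (At *v v)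
    + (\<Sum>j\<in>UNIV. (\<Sum>l<2 ^ r. dW j (n + r) (i * 2 ^ r + l) \<omega>) *\<^sub>R (B j *v v))"
    unfolding ito_step_def sum.distrib scaleR_sum_left
    by (subst sum.swap) (simp add: sum_constant_scaleR del: sum_constant)
  then show ?thesis by (simp only: mesh_refine dW_refine ito_step_def)
qed

text \<open>Discrete form of the bound exp (\<kappa> t) / \<kappa> for the integral of exp (\<kappa>
  s) up to t; the induction step is 1 + \<kappa> h <= exp (\<kappa> h).\<close>

lemma mesh_exp_sum: "\<kappa> > 0 \<Longrightarrow> mesh m * (\<Sum>l<K. exp (\<kappa> * g m l)) \<le> exp (\<kappa> * g m K) / \<kappa>"
proof (induction K)
  case (Suc K)
  have "mesh m * (\<Sum>l<Suc K. exp (\<kappa> * g m l)) \<le> exp (\<kappa> * g m K) / \<kappa> + mesh m * exp (\<kappa> * g m K)"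
    using Suc by (simp add: distrib_left)
  also have "\<dots> = exp (\<kappa> * g m K) * (1 + \<kappa> * mesh m) / \<kappa>" using Suc.prems by (simp add: field_simps)
  also have "\<dots> \<le> exp (\<kappa> * g m K) * exp (\<kappa> * mesh m) / \<kappa>"
    using Suc.prems exp_ge_add_one_self[of "\<kappa> * mesh m"] by (intro divide_right_mono mult_left_mono) auto
  also have "\<dots> = exp (\<kappa> * g m (Suc K)) / \<kappa>" by (simp add: exp_add[symmetric] g_Suc distrib_left)
  finally show ?case .
qed simp

text \<open>The process is killed rather than stopped: it is 0 from the first excess of N on. The
  condition ranges over the grid points of all levels, so it is countable, known at time t, and
  identical for every refinement; if it holds at t, it holds at all earlier times.\<close>

definition stopped :: "nat \<Rightarrow> real \<Rightarrow> 'a \<Rightarrow> real^'n" where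
  "stopped N t \<omega> = (if \<forall>n k. g n k \<le> t \<longrightarrow> norm (X (g n k) \<omega>) \<le> real N then X t \<omega> else 0)"

lemma stopped_pred_measurable:
  assumes "0 \<le> t"
  shows "Measurable.pred (F t) (\<lambda>\<omega>. \<forall>n k. g n k \<le> t \<longrightarrow> norm (X (g n k) \<omega>) \<le> real N)"
proof (intro pred_intros_countable)
  fix n k
  show "Measurable.pred (F t) (\<lambda>\<omega>. g n k \<le> t \<longrightarrow> norm (X (g n k) \<omega>) \<le> real N)"
  proof (cases "g n k \<le> t")
    case True
    then have [measurable]: "X (g n k) \<in> borel_measurable (F t)" by (rule F_measurable_mono[OF _ Xg_adapted])
    show ?thesis by measurable
  qed simp
qed

lemma stopped_adapted: "0 \<le> t \<Longrightarrow> stopped N t \<in> borel_measurable (F t)"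
  unfolding stopped_def using stopped_pred_measurable[of t N] X_adapted[of t] by measurable

lemma stopped_measurable: "0 \<le> t \<Longrightarrow> stopped N t \<in> borel_measurable M"
  using stopped_adapted F_measurable_M by blast

lemma stopped_bound: "norm (stopped N (g n k) \<omega>) \<le> real N"
  by (auto simp: stopped_def)

lemma stopped_L2: "integrable M (\<lambda>\<omega>. (norm (stopped N (g n k) \<omega>))\<^sup>2)"
  by (rule integrable_const_bound[where B="(real N)\<^sup>2"])
    (use stopped_bound stopped_measurable[of "g n k"] in \<open>auto intro!: power_mono borel_measurable_power borel_measurable_norm\<close>)

lemma stopped_moment_le: "expectation (\<lambda>\<omega>. (norm (stopped N (g n k) \<omega>))\<^sup>2) \<le> (real N)\<^sup>2"
proof -
  have "expectation (\<lambda>\<omega>. (norm (stopped N (g n k) \<omega>))\<^sup>2) \<le> expectation (\<lambda>_. (real N)\<^sup>2)"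
    by (intro integral_mono stopped_L2 power_mono stopped_bound) auto
  then show ?thesis by (simp add: prob_space)
qed

text \<open>If no grid value up to this time exceeds N, all earlier truncated values equal those of
  X, and \<open>x + S r\<close> is the expansion of X; otherwise \<open>Z r\<close> and the
  truncated value are both 0. Hence the error is dominated by the one in
  \<open>ito_expansion\<close>. Each factor 4 is 2 from separating x from the sum times 2 from the
  Fatou argument.\<close>

lemma stopped_moment_step:
  assumes k: "k \<le> 2 ^ n"
    and b: "\<And>r. mesh (n + r) * (\<Sum>l<k * 2 ^ r. expectation (\<lambda>\<omega>. (norm (stopped N (g (n + r) l) \<omega>))\<^sup>2)) \<le> b"
  shows "expectation (\<lambda>\<omega>. (norm (stopped N (g n k) \<omega>))\<^sup>2) \<le> 4 * (norm x)\<^sup>2 + 4 * C0 * b"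
proof -
  let ?P = "\<lambda>\<omega>. \<forall>n' k'. g n' k' \<le> g n k \<longrightarrow> norm (X (g n' k') \<omega>) \<le> real N"
  define S where "S r \<omega> = (\<Sum>l<k * 2 ^ r. ito_step (n + r) l \<omega> (stopped N (g (n + r) l) \<omega>))" for r \<omega>
  define Z where "Z r \<omega> = (if ?P \<omega> then x + S r \<omega> else 0)" for r \<omega>
  have K: "k * 2 ^ r \<le> 2 ^ (n + r)" for r using k by (simp add: power_add)
  have [measurable]: "stopped N (g m l) \<in> borel_measurable M" for m l by (rule stopped_measurable) simp
  have [measurable]: "Measurable.pred M ?P"
    by (rule F_measurable_M[OF g_nonneg stopped_pred_measurable[OF g_nonneg]])
  have Sm[measurable]: "S r \<in> borel_measurable M" for r unfolding S_def by measurable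
  have Zm[measurable]: "Z r \<in> borel_measurable M" for r unfolding Z_def by measurable
  have S: "integrable M (\<lambda>\<omega>. (norm (S r \<omega>))\<^sup>2)" "expectation (\<lambda>\<omega>. (norm (S r \<omega>))\<^sup>2) \<le> C0 * b" for r
  proof -
    note rule = ito_sum_L2[where m="n + r" and K="k * 2 ^ r" and G="\<lambda>l. stopped N (g (n + r) l)", OF K stopped_adapted[OF g_nonneg] stopped_L2]
    show "integrable M (\<lambda>\<omega>. (norm (S r \<omega>))\<^sup>2)" unfolding S_def by (rule rule(1))
    have "expectation (\<lambda>\<omega>. (norm (S r \<omega>))\<^sup>2) \<le> C0 * mesh (n + r) * (\<Sum>l<k * 2 ^ r. expectation (\<lambda>\<omega>. (norm (stopped N (g (n + r) l) \<omega>))\<^sup>2))"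
      unfolding S_def by (rule rule(2))
    also have "\<dots> \<le> C0 * b" using mult_left_mono[OF b[of r] less_imp_le[OF C0_pos]] by (simp add: mult.assoc)
    finally show "expectation (\<lambda>\<omega>. (norm (S r \<omega>))\<^sup>2) \<le> C0 * b" .
  qed
  have Zint: "integrable M (\<lambda>\<omega>. (norm (Z r \<omega>))\<^sup>2)" and ZE: "expectation (\<lambda>\<omega>. (norm (Z r \<omega>))\<^sup>2) \<le> 2 * (norm x)\<^sup>2 + 2 * (C0 * b)" for r
  proof -
    have xS1: "integrable M (\<lambda>\<omega>. (norm (x + S r \<omega>))\<^sup>2)"
      by (rule L2_add(1)) (simp_all add: S)
    have "expectation (\<lambda>\<omega>. (norm (x + S r \<omega>))\<^sup>2) \<le> 2 * expectation (\<lambda>_. (norm x)\<^sup>2) + 2 * expectation (\<lambda>\<omega>. (norm (S r \<omega>))\<^sup>2)"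
      by (rule L2_add(2)) (simp_all add: S)
    then have xS2: "expectation (\<lambda>\<omega>. (norm (x + S r \<omega>))\<^sup>2) \<le> 2 * (norm x)\<^sup>2 + 2 * (C0 * b)"
      using S(2)[of r] by (simp add: prob_space)
    have le: "(norm (Z r \<omega>))\<^sup>2 \<le> (norm (x + S r \<omega>))\<^sup>2" for \<omega> by (simp add: Z_def)
    show Zi: "integrable M (\<lambda>\<omega>. (norm (Z r \<omega>))\<^sup>2)"
      by (rule Bochner_Integration.integrable_bound[OF xS1]) (use le in auto)
    show "expectation (\<lambda>\<omega>. (norm (Z r \<omega>))\<^sup>2) \<le> 2 * (norm x)\<^sup>2 + 2 * (C0 * b)"
      using integral_mono[OF Zi xS1 le] xS2 by linarith
  qed
  have null: "null_in_prob M (\<lambda>r \<omega>. stopped N (g n k) \<omega> - Z r \<omega>)"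
  proof (rule null_in_prob_dominated[OF _ ito_expansion[OF k], where C=1])
    show "(\<lambda>\<omega>. stopped N (g n k) \<omega> - Z r \<omega>) \<in> borel_measurable M" for r by measurable
    fix r
    have "norm (stopped N (g n k) \<omega> - Z r \<omega>) \<le> 1 * norm (X (g n k) \<omega> - x - (\<Sum>l<k * 2 ^ r. ito_step (n + r) l \<omega> (X (g (n + r) l) \<omega>)))" for \<omega>
    proof (cases "?P \<omega>")
      case True
      have "stopped N (g (n + r) l) \<omega> = X (g (n + r) l) \<omega>" if "l < k * 2 ^ r" for l
      proof -
        have "g (n + r) l \<le> g n k" using g_mono[of l "k * 2 ^ r" "n + r"] that by (simp add: g_refine)
        then show ?thesis using True by (auto simp: stopped_def intro: order_trans)
      qed
      then have "S r \<omega> = (\<Sum>l<k * 2 ^ r. ito_step (n + r) l \<omega> (X (g (n + r) l) \<omega>))" by (simp add: S_def)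
      then show ?thesis using True by (simp add: stopped_def Z_def diff_diff_eq)
    next
      case False
      then show ?thesis by (simp only: stopped_def Z_def if_False) simp
    qed
    then show "AE \<omega> in M. norm (stopped N (g n k) \<omega> - Z r \<omega>) \<le> 1 * norm (X (g n k) \<omega> - x - (\<Sum>l<k * 2 ^ r. ito_step (n + r) l \<omega> (X (g (n + r) l) \<omega>)))"
      by simp
  qed
  have "expectation (\<lambda>\<omega>. (norm (stopped N (g n k) \<omega>))\<^sup>2) \<le> 2 * (2 * (norm x)\<^sup>2 + 2 * (C0 * b))"
    by (rule null_in_prob_second_moment_le(2)[OF _ _ null Zint]) (use ZE in auto)
  then show ?thesis by simp
qed

text \<open>A supremum weighted by an exponential closes the Gronwall argument without any integral with
  respect to time.\<close>

lemma stopped_moment_bound: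
  assumes k: "k \<le> 2 ^ n"
  shows "expectation (\<lambda>\<omega>. (norm (stopped N (g n k) \<omega>))\<^sup>2) \<le> 8 * (norm x)\<^sup>2 * exp (8 * C0 * T)"
proof -
  \<comment> \<open>Chosen so that 4 C0 / \<kappa> = 1 / 2, which lets the supremum be absorbed into
    the left-hand side.\<close>
  define \<kappa> where "\<kappa> = 8 * C0"
  have \<kappa>: "\<kappa> > 0" using C0_pos by (simp add: \<kappa>_def)
  define u where "u n k = expectation (\<lambda>\<omega>. (norm (stopped N (g n k) \<omega>))\<^sup>2)" for n k
  \<comment> \<open>The supremum is over all levels at once, since the bound at level n involves the
    moments at every finer level.\<close>
  define I where "I = {nk :: nat \<times> nat. snd nk \<le> 2 ^ fst nk}"
  define f where "f nk = exp (- \<kappa> * g (fst nk) (snd nk)) * u (fst nk) (snd nk)" for nk :: "nat \<times> nat"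
  define w where "w = (SUP nk\<in>I. f nk)"
  have u0: "0 \<le> u n k" for n k unfolding u_def by (rule integral_nonneg_AE) auto
  \<comment> \<open>The crude bound N^2 makes the supremum finite, without which the absorption
    would be meaningless; the final bound is independent of N.\<close>
  have bdd: "bdd_above (f ` I)"
  proof (rule bdd_aboveI2)
    fix nk
    have "exp (- \<kappa> * g (fst nk) (snd nk)) \<le> 1" using \<kappa> by simp
    then have "f nk \<le> 1 * u (fst nk) (snd nk)" unfolding f_def using u0 by (intro mult_right_mono) auto
    also have "\<dots> \<le> (real N)\<^sup>2" unfolding u_def using stopped_moment_le by simp
    finally show "f nk \<le> (real N)\<^sup>2" .
  qed
  have uw: "u n k \<le> w * exp (\<kappa> * g n k)" if "k \<le> 2 ^ n" for n k
  proof -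
    have "f (n, k) \<le> w" unfolding w_def using that by (intro cSUP_upper bdd) (auto simp: I_def)
    then have "exp (\<kappa> * g n k) * f (n, k) \<le> exp (\<kappa> * g n k) * w" by (intro mult_left_mono) auto
    moreover have "exp (\<kappa> * g n k) * f (n, k) = u n k" by (simp add: f_def mult.assoc[symmetric] exp_add[symmetric])
    ultimately show ?thesis by (simp only: mult.commute[of w])
  qed
  have w0: "0 \<le> w" using uw[of 0 0] u0[of 0 0] by simp
  have "w \<le> 4 * (norm x)\<^sup>2 + w / 2" unfolding w_def
  proof (rule cSUP_least)
    show "I \<noteq> {}" by (auto simp: I_def intro!: exI[of _ 0])
    fix nk assume "nk \<in> I"
    then obtain n k where nk: "nk = (n, k)" "k \<le> 2 ^ n" by (cases nk) (auto simp: I_def)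
    have "u n k \<le> 4 * (norm x)\<^sup>2 + 4 * C0 * (w * exp (\<kappa> * g n k) / \<kappa>)"
      unfolding u_def
    proof (rule stopped_moment_step[OF nk(2)])
      fix r
      have "mesh (n + r) * (\<Sum>l<k * 2 ^ r. u (n + r) l) \<le> mesh (n + r) * (\<Sum>l<k * 2 ^ r. w * exp (\<kappa> * g (n + r) l))"
      proof (intro mult_left_mono sum_mono uw)
        fix l assume "l \<in> {..<k * 2 ^ r}"
        then have "l \<le> k * 2 ^ r" by simp
        also have "\<dots> \<le> 2 ^ (n + r)" using nk(2) by (simp add: power_add)
        finally show "l \<le> 2 ^ (n + r)" .
      qed (use mesh_pos[of "n + r"] in simp)
      also have "\<dots> = w * (mesh (n + r) * (\<Sum>l<k * 2 ^ r. exp (\<kappa> * g (n + r) l)))" by (simp add: sum_distrib_left[symmetric])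
      also have "\<dots> \<le> w * (exp (\<kappa> * g (n + r) (k * 2 ^ r)) / \<kappa>)" by (intro mult_left_mono mesh_exp_sum \<kappa> w0)
      finally show "mesh (n + r) * (\<Sum>l<k * 2 ^ r. expectation (\<lambda>\<omega>. (norm (stopped N (g (n + r) l) \<omega>))\<^sup>2)) \<le> w * exp (\<kappa> * g n k) / \<kappa>"
        by (simp add: u_def g_refine)
    qed
    then have "u n k \<le> 4 * (norm x)\<^sup>2 + w / 2 * exp (\<kappa> * g n k)" using C0_pos by (simp add: \<kappa>_def)
    then have "exp (- \<kappa> * g n k) * u n k \<le> exp (- \<kappa> * g n k) * (4 * (norm x)\<^sup>2 + w / 2 * exp (\<kappa> * g n k))"
      by (intro mult_left_mono) auto
    also have "\<dots> = exp (- \<kappa> * g n k) * (4 * (norm x)\<^sup>2) + w / 2" by (simp add: algebra_simps exp_minus)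
    also have "\<dots> \<le> 1 * (4 * (norm x)\<^sup>2) + w / 2" using \<kappa> by (intro add_mono mult_right_mono) auto
    finally show "f nk \<le> 4 * (norm x)\<^sup>2 + (SUP nk\<in>I. f nk) / 2" by (simp add: f_def nk w_def)
  qed
  then have "w \<le> 8 * (norm x)\<^sup>2" by simp
  then have "u n k \<le> 8 * (norm x)\<^sup>2 * exp (\<kappa> * g n k)" using uw[OF k] by (meson exp_ge_zero mult_right_mono order_trans)
  also have "\<dots> \<le> 8 * (norm x)\<^sup>2 * exp (\<kappa> * T)" using \<kappa> g_le_T[OF k] by (intro mult_left_mono) auto
  finally show ?thesis by (simp add: u_def \<kappa>_def)
qed

text \<open>Twice the bound for the truncated process, because the limit in N is again taken by the
  Fatou argument.\<close>

definition C1 :: real where "C1 = 16 * (norm x)\<^sup>2 * exp (8 * C0 * T)"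

text \<open>A continuous path is bounded on [0, T], so for large N the truncation no longer changes
  it, and the bound uniform in N survives in the limit.\<close>

lemma X_moment_bound:
  assumes k: "k \<le> 2 ^ n"
  shows "integrable M (\<lambda>\<omega>. (norm (X (g n k) \<omega>))\<^sup>2)" "expectation (\<lambda>\<omega>. (norm (X (g n k) \<omega>))\<^sup>2) \<le> C1"
proof -
  have [measurable]: "stopped N (g m l) \<in> borel_measurable M" for N m l by (rule stopped_measurable) simp
  have null: "null_in_prob M (\<lambda>N \<omega>. X (g n k) \<omega> - stopped N (g n k) \<omega>)"
  proof (rule null_in_prob_AE)
    show "(\<lambda>\<omega>. X (g n k) \<omega> - stopped N (g n k) \<omega>) \<in> borel_measurable M" for N by measurable
    show "AE \<omega> in M. (\<lambda>N. X (g n k) \<omega> - stopped N (g n k) \<omega>) \<longlonglongrightarrow> 0"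
      using X_continuous
    proof eventually_elim
      case (elim \<omega>)
      then have "continuous_on {0..T} (\<lambda>t. X t \<omega>)" by (rule continuous_on_subset) auto
      then have "bounded ((\<lambda>t. X t \<omega>) ` {0..T})" by (intro compact_imp_bounded compact_continuous_image) auto
      then obtain L where L: "\<forall>t\<in>{0..T}. norm (X t \<omega>) \<le> L" by (auto simp: bounded_iff)
      obtain N0 :: nat where N0: "L \<le> real N0" using real_arch_simple by blast
      have "stopped N (g n k) \<omega> = X (g n k) \<omega>" if "N \<ge> N0" for N
      proof -
        have "norm (X (g n' k') \<omega>) \<le> real N" if "g n' k' \<le> g n k" for n' k'
        proof -
          have "g n' k' \<in> {0..T}" using that g_le_T[OF k] by simp
          then have "norm (X (g n' k') \<omega>) \<le> L" using L by blast
          then show ?thesis using N0 \<open>N \<ge> N0\<close> by linarith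
        qed
        then show ?thesis by (simp add: stopped_def)
      qed
      then have "\<forall>\<^sub>F N in sequentially. X (g n k) \<omega> - stopped N (g n k) \<omega> = 0"
        unfolding eventually_sequentially by (intro exI[of _ N0]) simp
      then show ?case by (rule tendsto_eventually)
    qed
  qed
  note rule = null_in_prob_second_moment_le[OF _ _ null stopped_L2, of "8 * (norm x)\<^sup>2 * exp (8 * C0 * T)"]
  show "integrable M (\<lambda>\<omega>. (norm (X (g n k) \<omega>))\<^sup>2)" by (rule rule(1)) (use stopped_moment_bound[OF k] in auto)
  have "expectation (\<lambda>\<omega>. (norm (X (g n k) \<omega>))\<^sup>2) \<le> 2 * (8 * (norm x)\<^sup>2 * exp (8 * C0 * T))"
    by (rule rule(2)) (use stopped_moment_bound[OF k] in auto)
  then show "expectation (\<lambda>\<omega>. (norm (X (g n k) \<omega>))\<^sup>2) \<le> C1" by (simp add: C1_def)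
qed

lemma C1_nonneg: "0 \<le> C1" by (simp add: C1_def)

text \<open>Subtracting the expansions at the two times leaves the fine steps between them. Their
  states have second moments at most \<open>C1\<close>, so the discrete isometry gives linear growth
  in the length of the interval.\<close>

lemma X_increment_bound:
  assumes k: "k \<le> 2 ^ n" and i: "i \<le> k"
  shows "expectation (\<lambda>\<omega>. (norm (X (g n k) \<omega> - X (g n i) \<omega>))\<^sup>2) \<le> 2 * C0 * C1 * (g n k - g n i)"
proof -
  \<comment> \<open>Steps before the time \<open>g n i\<close> get the state 0, so that an estimate
    for sums from 0 applies to a partial interval.\<close>
  define G where "G r l = (if l < i * 2 ^ r then (\<lambda>\<omega>. 0) else X (g (n + r) l))" for r l
  define Z where "Z r \<omega> = (\<Sum>l<k * 2 ^ r. ito_step (n + r) l \<omega> (G r l \<omega>))" for r \<omega>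
  have GF: "G r l \<in> borel_measurable (F (g (n + r) l))" for r l using Xg_adapted by (simp add: G_def)
  have [measurable]: "G r l \<in> borel_measurable M" for r l by (rule F_measurable_M[OF g_nonneg GF])
  have Zm[measurable]: "Z r \<in> borel_measurable M" for r unfolding Z_def by measurable
  have K: "k * 2 ^ r \<le> 2 ^ (n + r)" for r using k by (simp add: power_add)
  have lK: "l \<le> 2 ^ (n + r)" if "l < k * 2 ^ r" for l r using K[of r] that by linarith
  have GL2: "integrable M (\<lambda>\<omega>. (norm (G r l \<omega>))\<^sup>2)" if "l < k * 2 ^ r" for r l
    using X_moment_bound(1)[OF lK[OF that]] by (simp add: G_def)
  have ki: "k * 2 ^ r = i * 2 ^ r + (k - i) * 2 ^ r" for r using i by (simp add: add_mult_distrib[symmetric])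
  have Zi: "integrable M (\<lambda>\<omega>. (norm (Z r \<omega>))\<^sup>2)" for r
    unfolding Z_def by (rule ito_sum_L2(1)[OF K GF GL2])
  have ZE: "expectation (\<lambda>\<omega>. (norm (Z r \<omega>))\<^sup>2) \<le> C0 * C1 * (g n k - g n i)" for r
  proof -
    have "(\<Sum>l<k * 2 ^ r. expectation (\<lambda>\<omega>. (norm (G r l \<omega>))\<^sup>2)) =
      (\<Sum>l<(k - i) * 2 ^ r. expectation (\<lambda>\<omega>. (norm (X (g (n + r) (i * 2 ^ r + l)) \<omega>))\<^sup>2))"
      unfolding ki[of r] sum_lessThan_add by (simp add: G_def)
    also have "\<dots> \<le> (\<Sum>l<(k - i) * 2 ^ r. C1)"
    proof (intro sum_mono X_moment_bound(2))
      fix l assume "l \<in> {..<(k - i) * 2 ^ r}"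
      then show "i * 2 ^ r + l \<le> 2 ^ (n + r)" by (intro lK) (simp add: ki[of r])
    qed
    also have "\<dots> = real (k - i) * 2 ^ r * C1" by simp
    finally have s: "(\<Sum>l<k * 2 ^ r. expectation (\<lambda>\<omega>. (norm (G r l \<omega>))\<^sup>2)) \<le> real (k - i) * 2 ^ r * C1" .
    have "expectation (\<lambda>\<omega>. (norm (Z r \<omega>))\<^sup>2) \<le> C0 * mesh (n + r) * (\<Sum>l<k * 2 ^ r. expectation (\<lambda>\<omega>. (norm (G r l \<omega>))\<^sup>2))"
      unfolding Z_def by (rule ito_sum_L2(2)[OF K GF GL2])
    also have "\<dots> \<le> C0 * mesh (n + r) * (real (k - i) * 2 ^ r * C1)"
      using s C0_pos mesh_pos[of "n + r"] by (intro mult_left_mono) auto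
    also have "\<dots> = C0 * C1 * (real (k - i) * (2 ^ r * mesh (n + r)))" by simp
    also have "\<dots> = C0 * C1 * (g n k - g n i)" unfolding mesh_refine using i by (simp add: g_def of_nat_diff left_diff_distrib)
    finally show ?thesis .
  qed
  have "null_in_prob M (\<lambda>r \<omega>. (X (g n k) \<omega> - x - (\<Sum>l<k * 2 ^ r. ito_step (n + r) l \<omega> (X (g (n + r) l) \<omega>)))
     - (X (g n i) \<omega> - x - (\<Sum>l<i * 2 ^ r. ito_step (n + r) l \<omega> (X (g (n + r) l) \<omega>))))"
    using k i by (intro null_in_prob_diff ito_expansion) auto
  moreover have "(X (g n k) \<omega> - x - (\<Sum>l<k * 2 ^ r. ito_step (n + r) l \<omega> (X (g (n + r) l) \<omega>)))
     - (X (g n i) \<omega> - x - (\<Sum>l<i * 2 ^ r. ito_step (n + r) l \<omega> (X (g (n + r) l) \<omega>))) =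
     X (g n k) \<omega> - X (g n i) \<omega> - Z r \<omega>" for r \<omega>
    unfolding Z_def ki[of r] sum_lessThan_add by (simp add: G_def)
  ultimately have null: "null_in_prob M (\<lambda>r \<omega>. X (g n k) \<omega> - X (g n i) \<omega> - Z r \<omega>)" by (simp only:)
  have "expectation (\<lambda>\<omega>. (norm (X (g n k) \<omega> - X (g n i) \<omega>))\<^sup>2) \<le> 2 * (C0 * C1 * (g n k - g n i))"
    by (rule null_in_prob_second_moment_le(2)[OF _ _ null Zi]) (use ZE in auto)
  then show ?thesis by simp
qed

section \<open>Error of the Euler scheme\<close>

definition residual :: "nat \<Rightarrow> nat \<Rightarrow> 'a \<Rightarrow> real^'n" where
  "residual n k \<omega> = X (g n k) \<omega> - x - (\<Sum>l<k. ito_step n l \<omega> (X (g n l) \<omega>))"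

lemma residual_measurable[measurable]: "residual n k \<in> borel_measurable M"
  unfolding residual_def by measurable

text \<open>The factor C0 T of the isometry, times 2 C0 C1 from the increments of X, times 2 from
  the Fatou argument.\<close>

definition C2 :: real where "C2 = 4 * C0 * C0 * C1 * T"

lemma C2_nonneg: "0 \<le> C2" unfolding C2_def using C0_pos C1_nonneg T_pos by simp

text \<open>By \<open>ito_step_refine\<close> the residual is the limit of the sums of fine steps
  applied to X at the fine time minus X at the left end of its coarse cell. These differences have
  second moments of order mesh n by \<open>X_increment_bound\<close>.\<close>

lemma residual_bound:
  assumes k: "k \<le> 2 ^ n"
  shows "integrable M (\<lambda>\<omega>. (norm (residual n k \<omega>))\<^sup>2)"
    "expectation (\<lambda>\<omega>. (norm (residual n k \<omega>))\<^sup>2) \<le> C2 * mesh n"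
proof -
  \<comment> \<open>\<open>l div 2 ^ r\<close> is the coarse cell that contains the fine position
    l.\<close>
  define G where "G r l \<omega> = X (g (n + r) l) \<omega> - X (g n (l div 2 ^ r)) \<omega>" for r l \<omega>
  define Z where "Z r \<omega> = (\<Sum>l<k * 2 ^ r. ito_step (n + r) l \<omega> (G r l \<omega>))" for r \<omega>
  have par: "g n (l div 2 ^ r) \<le> g (n + r) l" "g (n + r) l \<le> g n (l div 2 ^ r) + mesh n" for l r
  proof -
    have "l div 2 ^ r * 2 ^ r \<le> l" by simp
    from g_mono[OF this, of "n + r"] show "g n (l div 2 ^ r) \<le> g (n + r) l" by (simp add: g_refine)
    have "l \<le> Suc (l div 2 ^ r) * 2 ^ r"
      using dividend_less_div_times[of "2 ^ r" l] by simp
    from g_mono[OF this, of "n + r"] show "g (n + r) l \<le> g n (l div 2 ^ r) + mesh n" by (simp only: g_refine g_Suc)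
  qed
  have GF: "G r l \<in> borel_measurable (F (g (n + r) l))" for r l
    unfolding G_def using Xg_adapted[of "n + r" l] F_measurable_mono[OF par(1) Xg_adapted] by measurable
  have [measurable]: "G r l \<in> borel_measurable M" for r l by (rule F_measurable_M[OF g_nonneg GF])
  have Zm[measurable]: "Z r \<in> borel_measurable M" for r unfolding Z_def by measurable
  have K: "k * 2 ^ r \<le> 2 ^ (n + r)" for r using k by (simp add: power_add)
  have lK: "l \<le> 2 ^ (n + r)" if "l < k * 2 ^ r" for l r using K[of r] that by linarith
  have Gp: "G r l \<omega> = X (g (n + r) l) \<omega> - X (g (n + r) (l div 2 ^ r * 2 ^ r)) \<omega>" for r l \<omega>
    by (simp add: G_def g_refine)
  have GL2: "integrable M (\<lambda>\<omega>. (norm (G r l \<omega>))\<^sup>2)" if "l < k * 2 ^ r" for r l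
    unfolding Gp using lK[OF that] by (intro L2_diff X_moment_bound(1) Xg_measurable) (auto intro: order_trans[OF div_times_less_eq_dividend])
  have GE: "expectation (\<lambda>\<omega>. (norm (G r l \<omega>))\<^sup>2) \<le> 2 * C0 * C1 * mesh n" if "l < k * 2 ^ r" for r l
  proof -
    have "expectation (\<lambda>\<omega>. (norm (G r l \<omega>))\<^sup>2) \<le> 2 * C0 * C1 * (g (n + r) l - g (n + r) (l div 2 ^ r * 2 ^ r))"
      unfolding Gp by (rule X_increment_bound[OF lK[OF that]]) simp
    also have "\<dots> \<le> 2 * C0 * C1 * mesh n"
      using par(1)[of l r] par(2)[of r l] C0_pos C1_nonneg by (intro mult_left_mono) (auto simp: g_refine)
    finally show ?thesis .
  qed
  have Zi: "integrable M (\<lambda>\<omega>. (norm (Z r \<omega>))\<^sup>2)" for r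
    unfolding Z_def by (rule ito_sum_L2(1)[OF K GF GL2])
  have ZE: "expectation (\<lambda>\<omega>. (norm (Z r \<omega>))\<^sup>2) \<le> 2 * C0 * C0 * C1 * T * mesh n" for r
  proof -
    have "expectation (\<lambda>\<omega>. (norm (Z r \<omega>))\<^sup>2) \<le> C0 * mesh (n + r) * (\<Sum>l<k * 2 ^ r. expectation (\<lambda>\<omega>. (norm (G r l \<omega>))\<^sup>2))"
      unfolding Z_def by (rule ito_sum_L2(2)[OF K GF GL2])
    also have "\<dots> \<le> C0 * mesh (n + r) * (\<Sum>l<k * 2 ^ r. 2 * C0 * C1 * mesh n)"
      using C0_pos mesh_pos[of "n + r"] by (intro mult_left_mono sum_mono GE) auto
    also have "\<dots> = g n k * (2 * C0 * C0 * C1 * mesh n)"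
      using mesh_refine[of r n] by (simp add: g_def mult_ac)
    also have "\<dots> \<le> T * (2 * C0 * C0 * C1 * mesh n)"
      using g_le_T[OF k] C0_pos C1_nonneg mesh_pos[of n] by (intro mult_right_mono) auto
    finally show ?thesis by (simp add: mult_ac)
  qed
  have "(\<Sum>l<k * 2 ^ r. ito_step (n + r) l \<omega> (X (g n (l div 2 ^ r)) \<omega>)) = (\<Sum>l<k. ito_step n l \<omega> (X (g n l) \<omega>))" for r \<omega>
    unfolding sum_lessThan_mult
  proof (intro sum.cong refl)
    fix i
    have "(\<Sum>l<2 ^ r. ito_step (n + r) (i * 2 ^ r + l) \<omega> (X (g n ((i * 2 ^ r + l) div 2 ^ r)) \<omega>)) =
      (\<Sum>l<2 ^ r. ito_step (n + r) (i * 2 ^ r + l) \<omega> (X (g n i) \<omega>))"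
      by (intro sum.cong refl) simp
    then show "(\<Sum>l<2 ^ r. ito_step (n + r) (i * 2 ^ r + l) \<omega> (X (g n ((i * 2 ^ r + l) div 2 ^ r)) \<omega>)) = ito_step n i \<omega> (X (g n i) \<omega>)"
      by (simp only: ito_step_refine)
  qed
  then have eq: "X (g n k) \<omega> - x - (\<Sum>l<k * 2 ^ r. ito_step (n + r) l \<omega> (X (g (n + r) l) \<omega>)) = residual n k \<omega> - Z r \<omega>" for r \<omega>
    by (simp add: Z_def G_def residual_def ito_step_diff sum_subtractf)
  have null: "null_in_prob M (\<lambda>r \<omega>. residual n k \<omega> - Z r \<omega>)"
    using ito_expansion[OF k] unfolding eq .
  note rule = null_in_prob_second_moment_le[OF _ _ null Zi, of "2 * C0 * C0 * C1 * T * mesh n"]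
  show "integrable M (\<lambda>\<omega>. (norm (residual n k \<omega>))\<^sup>2)" by (rule rule(1)) (use ZE in auto)
  have "expectation (\<lambda>\<omega>. (norm (residual n k \<omega>))\<^sup>2) \<le> 2 * (2 * C0 * C0 * C1 * T * mesh n)" by (rule rule(2)) (use ZE in auto)
  then show "expectation (\<lambda>\<omega>. (norm (residual n k \<omega>))\<^sup>2) \<le> C2 * mesh n" by (simp add: C2_def)
qed

primrec euler :: "nat \<Rightarrow> nat \<Rightarrow> 'a \<Rightarrow> real^'n" where
  "euler n 0 = (\<lambda>\<omega>. x)"
| "euler n (Suc k) = (\<lambda>\<omega>. euler n k \<omega> + ito_step n k \<omega> (euler n k \<omega>))"

lemma euler_sum: "euler n k \<omega> = x + (\<Sum>l<k. ito_step n l \<omega> (euler n l \<omega>))"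
  by (induction k) (simp_all add: add.assoc)

lemma euler_adapted: "euler n k \<in> borel_measurable (F (g n k))"
proof (induction k)
  case (Suc k)
  have [measurable]: "euler n k \<in> borel_measurable (F (g n (Suc k)))"
    by (rule F_measurable_mono[OF less_imp_le[OF g_less] Suc])
  have [measurable]: "dW j n k \<in> borel_measurable (F (g n (Suc k)))" for j by (rule dW_adapted)
  show ?case unfolding euler.simps ito_step_def by measurable
qed simp

lemma euler_measurable[measurable]: "euler n k \<in> borel_measurable M"
  by (rule F_measurable_M[OF g_nonneg euler_adapted])

lemma euler_L2: "k \<le> 2 ^ n \<Longrightarrow> integrable M (\<lambda>\<omega>. (norm (euler n k \<omega>))\<^sup>2)"
proof (induction k rule: less_induct)
  case (less k)
  have "integrable M (\<lambda>\<omega>. (norm (\<Sum>l<k. ito_step n l \<omega> (euler n l \<omega>)))\<^sup>2)"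
    by (rule ito_sum_L2(1)[OF less.prems euler_adapted less.IH]) (use less.prems in auto)
  then have "integrable M (\<lambda>\<omega>. (norm (x + (\<Sum>l<k. ito_step n l \<omega> (euler n l \<omega>))))\<^sup>2)"
    by (intro L2_add(1)) auto
  then show ?case by (subst euler_sum)
qed

text \<open>By linearity the error satisfies the recursion of the scheme with the residual as a
  source. The discrete Gronwall inequality over 2^n steps of length \<open>mesh n\<close> then
  produces the exponential.\<close>

lemma euler_error:
  shows "integrable M (\<lambda>\<omega>. (norm (X T \<omega> - euler n (2 ^ n) \<omega>))\<^sup>2)"
    and "expectation (\<lambda>\<omega>. (norm (X T \<omega> - euler n (2 ^ n) \<omega>))\<^sup>2) \<le> 2 * C2 * mesh n * exp (2 * C0 * T)"
proof -
  define e where "e k \<omega> = X (g n k) \<omega> - euler n k \<omega>" for k \<omega>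
  have em[measurable]: "e k \<in> borel_measurable M" for k unfolding e_def by measurable
  have eF: "e k \<in> borel_measurable (F (g n k))" for k
    unfolding e_def using Xg_adapted[of n k] euler_adapted[of n k] by measurable
  have eL2: "integrable M (\<lambda>\<omega>. (norm (e k \<omega>))\<^sup>2)" if "k \<le> 2 ^ n" for k
    unfolding e_def using that by (intro L2_diff X_moment_bound euler_L2) auto
  define u where "u k = expectation (\<lambda>\<omega>. (norm (e k \<omega>))\<^sup>2)" for k
  have step: "u k \<le> 2 * C2 * mesh n + (2 * C0 * mesh n) * (\<Sum>l<k. u l)" if k: "k \<le> 2 ^ n" for k
  proof -
    have eq: "e k \<omega> = residual n k \<omega> + (\<Sum>l<k. ito_step n l \<omega> (e l \<omega>))" for \<omega>
      unfolding e_def residual_def ito_step_diff sum_subtractf by (subst euler_sum) simp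
    note S = ito_sum_L2[where K=k and m=n and G=e, OF k eF eL2]
    have S1: "integrable M (\<lambda>\<omega>. (norm (\<Sum>l<k. ito_step n l \<omega> (e l \<omega>)))\<^sup>2)" by (rule S(1)) (use k in auto)
    have S2: "expectation (\<lambda>\<omega>. (norm (\<Sum>l<k. ito_step n l \<omega> (e l \<omega>)))\<^sup>2) \<le> C0 * mesh n * (\<Sum>l<k. u l)"
      unfolding u_def by (rule S(2)) (use k in auto)
    have "u k = expectation (\<lambda>\<omega>. (norm (residual n k \<omega> + (\<Sum>l<k. ito_step n l \<omega> (e l \<omega>))))\<^sup>2)"
      unfolding u_def by (subst eq) simp
    also have "\<dots> \<le> 2 * expectation (\<lambda>\<omega>. (norm (residual n k \<omega>))\<^sup>2) + 2 * expectation (\<lambda>\<omega>. (norm (\<Sum>l<k. ito_step n l \<omega> (e l \<omega>)))\<^sup>2)"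
      by (rule L2_add(2)[OF _ _ residual_bound(1)[OF k] S1]) measurable
    also have "\<dots> \<le> 2 * (C2 * mesh n) + 2 * (C0 * mesh n * (\<Sum>l<k. u l))"
      using residual_bound(2)[OF k] S2 by linarith
    finally show ?thesis by simp
  qed
  have h0: "0 \<le> mesh n" using mesh_pos[of n] by simp
  have b0: "0 \<le> 2 * C0 * mesh n" using C0_pos h0 by simp
  have "u (2 ^ n) \<le> 2 * C2 * mesh n * (1 + 2 * C0 * mesh n) ^ (2 ^ n)"
    by (rule discrete_gronwall[OF step b0]) auto
  also have "\<dots> \<le> 2 * C2 * mesh n * exp (2 * C0 * T)"
  proof (rule mult_left_mono)
    have "(1 + 2 * C0 * mesh n) ^ (2 ^ n) \<le> exp (2 * C0 * mesh n) ^ (2 ^ n)"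
      using b0 by (intro power_mono exp_ge_add_one_self) auto
    also have "\<dots> = exp (2 ^ n * (2 * C0 * mesh n))" by (simp add: exp_of_nat_mult[symmetric])
    also have "2 ^ n * (2 * C0 * mesh n) = 2 * C0 * T" using mesh_total[of n] by (simp add: mult_ac)
    finally show "(1 + 2 * C0 * mesh n) ^ (2 ^ n) \<le> exp (2 * C0 * T)" .
    show "0 \<le> 2 * C2 * mesh n" using C2_nonneg h0 by simp
  qed
  finally show "expectation (\<lambda>\<omega>. (norm (X T \<omega> - euler n (2 ^ n) \<omega>))\<^sup>2) \<le> 2 * C2 * mesh n * exp (2 * C0 * T)"
    by (simp add: u_def e_def g_top)
  show "integrable M (\<lambda>\<omega>. (norm (X T \<omega> - euler n (2 ^ n) \<omega>))\<^sup>2)"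
    using eL2[of "2 ^ n"] by (simp add: e_def g_top)
qed

end

section \<open>The matrix exponential\<close>

definition mpow :: "real^'k^'k \<Rightarrow> nat \<Rightarrow> real^'k^'k" where
  "mpow D n = ((**) D ^^ n) (mat 1)"

lemma mpow_simps[simp]: "mpow D 0 = mat 1" "mpow D (Suc n) = D ** mpow D n"
  by (simp_all add: mpow_def)

lemma scaleR_matrix_mult: "(t *\<^sub>R D) ** P = t *\<^sub>R (D ** P)" for D P :: "real^'k^'k"
  by (simp add: matrix_matrix_mult_def vec_eq_iff sum_distrib_left mult.assoc)

lemma matrix_mult_scaleR: "D ** (t *\<^sub>R P) = t *\<^sub>R (D ** P)" for D P :: "real^'k^'k"
  by (simp add: matrix_matrix_mult_def vec_eq_iff sum_distrib_left mult.left_commute)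

lemma mpow_scaleR: "mpow (t *\<^sub>R D) n = t ^ n *\<^sub>R mpow D n"
  by (induction n) (simp_all add: scaleR_matrix_mult matrix_mult_scaleR)

text \<open>The ratio c is a bound of left multiplication by D as a linear map, which avoids the
  need for a submultiplicative matrix norm.\<close>

lemma mpow_bound:
  fixes D :: "real^'k^'k"
  obtains c where "c > 0" "\<And>n. norm (mpow D n) \<le> c ^ n * norm (mat 1 :: real^'k^'k)"
proof -
  have "linear (\<lambda>P :: real^'k^'k. D ** P)"
    by (rule linearI) (simp_all add: matrix_add_ldistrib matrix_mult_scaleR)
  then have "bounded_linear (\<lambda>P :: real^'k^'k. D ** P)" by (simp add: linear_conv_bounded_linear)
  from bounded_linear.pos_bounded[OF this] obtain c where c: "c > 0" "\<forall>P :: real^'k^'k. norm (D ** P) \<le> norm P * c"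
    by blast
  have "norm (mpow D n) \<le> c ^ n * norm (mat 1 :: real^'k^'k)" for n
  proof (induction n)
    case (Suc n)
    have "norm (mpow D (Suc n)) \<le> norm (mpow D n) * c" using c(2) by simp
    also have "\<dots> \<le> c ^ n * norm (mat 1 :: real^'k^'k) * c" using Suc c(1) by (intro mult_right_mono) auto
    finally show ?case by (simp add: mult_ac)
  qed simp
  then show ?thesis using c(1) that by blast
qed

lemma matrix_exp_summable: "summable (\<lambda>n. (t ^ n / fact n) *\<^sub>R mpow D n)" for D :: "real^'k^'k"
proof -
  obtain c where c: "c > 0" "\<And>n. norm (mpow D n) \<le> c ^ n * norm (mat 1 :: real^'k^'k)" using mpow_bound[of D] by blast
  have "summable (\<lambda>n. ((\<bar>t\<bar> * c) ^ n / fact n) * norm (mat 1 :: real^'k^'k))"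
    using summable_exp[of "\<bar>t\<bar> * c"] by (intro summable_mult2) (simp add: divide_inverse mult.commute)
  then show ?thesis
  proof (rule summable_comparison_test')
    fix n :: nat
    have "norm ((t ^ n / fact n) *\<^sub>R mpow D n) = (\<bar>t\<bar> ^ n / fact n) * norm (mpow D n)"
      by (simp add: power_abs)
    also have "\<dots> \<le> (\<bar>t\<bar> ^ n / fact n) * (c ^ n * norm (mat 1 :: real^'k^'k))"
      using c(2) by (intro mult_left_mono) auto
    finally show "norm ((t ^ n / fact n) *\<^sub>R mpow D n) \<le> ((\<bar>t\<bar> * c) ^ n / fact n) * norm (mat 1 :: real^'k^'k)"
      by (simp add: power_mult_distrib)
  qed
qed

lemma matrix_exp_scaled: "matrix_exp (t *\<^sub>R D) = (\<Sum>n. (t ^ n / fact n) *\<^sub>R mpow D n)"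
proof -
  have "(1 / fact n) *\<^sub>R (((**) (t *\<^sub>R D) ^^ n) (mat 1)) = (t ^ n / fact n) *\<^sub>R mpow D n" for n
    using mpow_scaleR[of t D n] by (simp add: mpow_def)
  then show ?thesis by (simp add: matrix_exp_def)
qed

lemma bounded_linear_matvec_left: "bounded_linear (\<lambda>P :: real^'k^'k. P *v y)"
proof -
  have "linear (\<lambda>P :: real^'k^'k. P *v y)"
    by (rule linearI) (simp_all add: matrix_vector_mult_add_rdistrib scaleR_matrix_vector_assoc)
  then show ?thesis by (simp add: linear_conv_bounded_linear)
qed

lemma matrix_exp_vec_sums:
  "(\<lambda>n. (t ^ n / fact n) *\<^sub>R (mpow D n *v y)) sums (matrix_exp (t *\<^sub>R D) *v y)"
proof -
  from bounded_linear.sums[OF bounded_linear_matvec_left summable_sums[OF matrix_exp_summable], of t D y]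
  show ?thesis by (simp add: matrix_exp_scaled scaleR_matrix_vector_assoc)
qed

lemma matrix_exp_vec_derivative:
  "((\<lambda>t. matrix_exp (t *\<^sub>R D) *v y) has_vector_derivative (D *v (matrix_exp (t *\<^sub>R D) *v y))) (at t within S)"
proof -
  define f where "f t = matrix_exp (t *\<^sub>R D) *v y" for t
  \<comment> \<open>Each component is a real power series in t and can be differentiated termwise;
    the shift of the coefficients amounts to a multiplication by D.\<close>
  have comp: "((\<lambda>t. f t $ i) has_field_derivative ((D *v f t) $ i)) (at t)" for i t
  proof -
    define a where "a n = (mpow D n *v y) $ i / fact n" for n
    have s: "(\<lambda>n. a n * t ^ n) sums (f t $ i)" for t
      using bounded_linear.sums[OF bounded_linear_vec_nth matrix_exp_vec_sums[of t D y], of i]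
      by (simp add: a_def f_def mult_ac)
    have eq: "(\<lambda>t. \<Sum>n. a n * t ^ n) = (\<lambda>t. f t $ i)" by (intro ext) (rule sums_unique[OF s, symmetric])
    have da: "diffs a n = (D *v (mpow D n *v y)) $ i / fact n" for n
      unfolding diffs_def a_def by (simp add: matrix_vector_mul_assoc field_simps del: of_nat_Suc)
    have "(\<lambda>n. (D *v ((t ^ n / fact n) *\<^sub>R (mpow D n *v y))) $ i) sums ((D *v f t) $ i)"
      unfolding f_def by (intro bounded_linear.sums[OF bounded_linear_vec_nth] bounded_linear.sums[OF matrix_vector_mul_bounded_linear] matrix_exp_vec_sums)
    then have "(\<lambda>n. diffs a n * t ^ n) sums ((D *v f t) $ i)"
      by (simp add: da matrix_vector_mult_scaleR mult_ac)
    then have "(\<Sum>n. diffs a n * t ^ n) = (D *v f t) $ i" by (rule sums_unique[symmetric])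
    with termdiffs_strong_converges_everywhere[of a t] s show ?thesis
      unfolding eq by (metis sums_summable)
  qed
  have "((\<lambda>t. f t) has_derivative (\<lambda>s. s *\<^sub>R (D *v f t))) (at t within S)"
    unfolding has_derivative_componentwise_within[where f=f]
  proof
    fix b :: "real^'a" assume "b \<in> Basis"
    then obtain i where b: "b = axis i 1" by (auto simp: Basis_vec_def)
    have "((\<lambda>t. f t $ i) has_derivative (\<lambda>s. s * (D *v f t) $ i)) (at t within S)"
      using has_field_derivative_at_within[OF comp[of i t], of S] by (simp add: has_field_derivative_def mult.commute[of "(D *v f t) $ i"] mult_commute_abs)
    then show "((\<lambda>x. f x \<bullet> b) has_derivative (\<lambda>x. (x *\<^sub>R (D *v f t)) \<bullet> b)) (at t within S)"
      by (simp add: b inner_axis)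
  qed
  then show ?thesis by (simp add: has_vector_derivative_def f_def)
qed

lemma matrix_exp_0: "matrix_exp (0 *\<^sub>R D) *v y = y"
proof -
  have "(\<lambda>n. (0 ^ n / fact n) *\<^sub>R (mpow D n *v y)) sums (\<Sum>n\<in>{0}. (0 ^ n / fact n) *\<^sub>R (mpow D n *v y))"
    by (rule sums_finite) auto
  then show ?thesis using matrix_exp_vec_sums[of 0 D y] sums_unique2 by fastforce
qed

lemma linear_euler_convergence:
  fixes D N :: "real^'k^'k" and z :: "nat \<Rightarrow> nat \<Rightarrow> real^'k" and T :: real
  assumes T: "T > 0" and z0: "\<And>n. z n 0 = y"
    and zS: "\<And>n k. k < 2 ^ n \<Longrightarrow> z n (Suc k) = z n k + (T / 2 ^ n) *\<^sub>R (D *v z n k) + (T / 2 ^ n)\<^sup>2 *\<^sub>R (N *v z n k)"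
  shows "(\<lambda>n. z n (2 ^ n)) \<longlonglongrightarrow> matrix_exp (T *\<^sub>R D) *v y"
proof -
  define f where "f t = matrix_exp (t *\<^sub>R D) *v y" for t
  have df: "(f has_vector_derivative (D *v f t)) (at t within S)" for t S
    unfolding f_def by (rule matrix_exp_vec_derivative)
  have cf: "continuous_on S f" for S
    unfolding continuous_on_eq_continuous_within using has_vector_derivative_continuous[OF df] by blast
  have cDf: "continuous_on S (\<lambda>t. D *v f t)" for S
    by (rule linear_continuous_on_compose[OF cf matrix_vector_mul_linear])
  obtain a where a: "a > 0" "\<And>v. norm (D *v v) \<le> a * norm v" using matvec_bound[of D] by blast
  obtain c where c: "c > 0" "\<And>v. norm (N *v v) \<le> c * norm v" using matvec_bound[of N] by blast
  have "bounded (f ` {0..T})" by (intro compact_imp_bounded compact_continuous_image cf) auto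
  then obtain L0 where L0: "\<forall>t\<in>{0..T}. norm (f t) \<le> L0" by (auto simp: bounded_iff)
  define L where "L = max L0 1"
  have L: "L > 0" "\<And>t. 0 \<le> t \<Longrightarrow> t \<le> T \<Longrightarrow> norm (f t) \<le> L" using L0 by (auto simp: L_def le_max_iff_disj)
  define h where "h n = T / 2 ^ n" for n :: nat
  have h0: "h n > 0" for n using T by (simp add: h_def)
  have hlim: "h \<longlonglongrightarrow> 0" unfolding h_def[abs_def] by real_asymp
  have "(\<lambda>n. norm (f T - z n (2 ^ n))) \<longlonglongrightarrow> 0"
  proof (rule LIMSEQ_I)
    fix e :: real assume "e > 0"
    define G where "G = T * exp ((a + c) * T)"
    have G: "G > 0" using T by (simp add: G_def)
    \<comment> \<open>The final bound is 2 \<epsilon> T exp ((a + c) T), which this choice turns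
      into e / 2.\<close>
    define \<epsilon> where "\<epsilon> = e / (4 * G)"
    have \<epsilon>: "\<epsilon> > 0" using \<open>e > 0\<close> G by (simp add: \<epsilon>_def)
    have "uniformly_continuous_on {0..T} (\<lambda>t. D *v f t)" by (intro compact_uniformly_continuous cDf) auto
    from this[unfolded uniformly_continuous_on_def, rule_format, OF \<epsilon>] obtain \<delta> where \<delta>: "\<delta> > 0"
      "\<forall>x\<in>{0..T}. \<forall>x'\<in>{0..T}. dist x' x < \<delta> \<longrightarrow> dist (D *v f x') (D *v f x) < \<epsilon>" by blast
    \<comment> \<open>The three bounds on h serve, in this order, the modulus of the derivative, the
      inequality h^2 <= h in the term with N E, and h c L <= \<epsilon> in the term with N
      f.\<close>
    have "\<forall>\<^sub>F n in sequentially. h n < min (min \<delta> 1) (\<epsilon> / (c * L))"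
      by (rule order_tendstoD(2)[OF hlim]) (use \<delta> \<epsilon> c L in auto)
    then obtain n0 where n0: "\<And>n. n \<ge> n0 \<Longrightarrow> h n < \<delta> \<and> h n < 1 \<and> h n < \<epsilon> / (c * L)"
      by (auto simp: eventually_sequentially)
    have "norm (f T - z n (2 ^ n)) < e" if n: "n \<ge> n0" for n
    proof -
      define q where "q = 1 + h n * (a + c)"
      have q: "q \<ge> 1" using h0[of n] a c by (simp add: q_def)
      \<comment> \<open>A crude accumulation, k times the local error times q^k, is enough because k
        h is at most T.\<close>
      have err: "norm (f (real k * h n) - z n k) \<le> real k * (2 * \<epsilon> * h n) * q ^ k" if "k \<le> 2 ^ n" for k
        using that
      proof (induction k)
        case 0
        then show ?case using matrix_exp_0[of D y] by (simp add: f_def z0)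
      next
        case (Suc k)
        define t where "t = real k * h n"
        have t': "real (Suc k) * h n = t + h n" by (simp add: t_def algebra_simps)
        have "real (Suc k) \<le> real (2 ^ n)" using Suc.prems by (rule of_nat_mono)
        then have "real (Suc k) * h n \<le> 2 ^ n * h n" using h0[of n] by (intro mult_right_mono) auto
        also have "\<dots> = T" by (simp add: h_def)
        finally have tT2: "t + h n \<le> T" unfolding t' .
        have tT1: "0 \<le> t" using h0[of n] by (simp add: t_def)
        note tT = tT1 tT2
        define r where "r = f (t + h n) - f t - h n *\<^sub>R (D *v f t)"
        have "norm (f (t + h n) - f t - ((t + h n) - t) *\<^sub>R (D *v f t)) \<le> norm ((t + h n) - t) * \<epsilon>"
        proof (rule vector_differentiable_bound_linearization[where S="{t..t + h n}"])
          show "(f has_vector_derivative D *v f s) (at s within {t..t + h n})" for s by (rule df)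
          show "closed_segment t (t + h n) \<subseteq> {t..t + h n}" using h0[of n] by (simp add: closed_segment_eq_real_ivl)
          show "t \<in> {t..t + h n}" using h0[of n] by simp
          fix s assume "s \<in> {t..t + h n}"
          then have "dist (D *v f s) (D *v f t) < \<epsilon>"
            using tT n0[OF n] h0[of n] by (intro \<delta>(2)[rule_format]) (auto simp: dist_real_def)
          then show "norm (D *v f s - D *v f t) \<le> \<epsilon>" by (simp add: dist_norm)
        qed
        then have r: "norm r \<le> \<epsilon> * h n" using h0[of n] by (simp add: r_def mult.commute)
        define E where "E = f t - z n k"
        have k: "k < 2 ^ n" using Suc.prems by simp
        have IH: "norm E \<le> real k * (2 * \<epsilon> * h n) * q ^ k" using Suc by (simp add: E_def t_def)
        have "f (real (Suc k) * h n) - z n (Suc k) = E + h n *\<^sub>R (D *v E) + (h n)\<^sup>2 *\<^sub>R (N *v E) + r - (h n)\<^sup>2 *\<^sub>R (N *v f t)"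
          unfolding t' zS[OF k] h_def[symmetric] E_def r_def by (simp add: matrix_vector_mult_diff_distrib algebra_simps)
        also have "norm \<dots> \<le> norm E + norm (h n *\<^sub>R (D *v E)) + norm ((h n)\<^sup>2 *\<^sub>R (N *v E)) + norm r + norm ((h n)\<^sup>2 *\<^sub>R (N *v f t))"
          by (intro order_trans[OF norm_triangle_ineq4] order_trans[OF norm_triangle_ineq] add_mono order_refl)
        also have "\<dots> \<le> norm E + h n * (a * norm E) + h n * (c * norm E) + \<epsilon> * h n + \<epsilon> * h n"
        proof (intro add_mono order_refl)
          show "norm (h n *\<^sub>R (D *v E)) \<le> h n * (a * norm E)" using h0[of n] a(2)[of E] by simp
          have "(h n)\<^sup>2 \<le> h n" using n0[OF n] h0[of n] by (simp add: power2_eq_square mult_left_le)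
          then show "norm ((h n)\<^sup>2 *\<^sub>R (N *v E)) \<le> h n * (c * norm E)"
            using c(2)[of E] h0[of n] by (auto intro!: mult_mono)
          show "norm r \<le> \<epsilon> * h n" by (rule r)
          have "norm ((h n)\<^sup>2 *\<^sub>R (N *v f t)) \<le> (h n)\<^sup>2 * (c * L)"
          proof -
            have "norm (N *v f t) \<le> c * L" using c(2)[of "f t"] L(2)[of t] tT h0[of n] c(1) by (meson add_increasing2 less_imp_le mult_left_mono order_trans le_add_same_cancel1)
            then show ?thesis by (simp add: mult_left_mono)
          qed
          also have "\<dots> = h n * (c * L) * h n" by (simp add: power2_eq_square)
          also have "\<dots> \<le> \<epsilon> * h n"
          proof (rule mult_right_mono)
            have "c * L > 0" using c L by simp
            then show "h n * (c * L) \<le> \<epsilon>" using n0[OF n] by (simp add: field_simps)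
          qed (use h0[of n] in simp)
          finally show "norm ((h n)\<^sup>2 *\<^sub>R (N *v f t)) \<le> \<epsilon> * h n" .
        qed
        also have "\<dots> = q * norm E + 2 * \<epsilon> * h n" by (simp add: q_def algebra_simps)
        also have "\<dots> \<le> q * (real k * (2 * \<epsilon> * h n) * q ^ k) + (2 * \<epsilon> * h n) * q ^ Suc k"
        proof (rule add_mono)
          show "q * norm E \<le> q * (real k * (2 * \<epsilon> * h n) * q ^ k)" using IH q by (intro mult_left_mono) auto
          have "1 \<le> q ^ Suc k" using q by (rule one_le_power)
          then have "(2 * \<epsilon> * h n) * 1 \<le> (2 * \<epsilon> * h n) * q ^ Suc k" using \<epsilon> h0[of n] by (intro mult_left_mono) auto
          then show "2 * \<epsilon> * h n \<le> (2 * \<epsilon> * h n) * q ^ Suc k" by simp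
        qed
        also have "\<dots> = real (Suc k) * (2 * \<epsilon> * h n) * q ^ Suc k" by (simp add: algebra_simps)
        finally show ?case .
      qed
      have "norm (f T - z n (2 ^ n)) \<le> real (2 ^ n) * (2 * \<epsilon> * h n) * q ^ (2 ^ n)"
        using err[of "2 ^ n"] by (simp add: h_def)
      also have "\<dots> = T * (2 * \<epsilon>) * q ^ (2 ^ n)" by (simp add: h_def)
      also have "\<dots> \<le> T * (2 * \<epsilon>) * exp ((a + c) * T)"
      proof (rule mult_left_mono)
        have "q ^ (2 ^ n) \<le> exp (h n * (a + c)) ^ (2 ^ n)"
          unfolding q_def using h0[of n] a c by (intro power_mono exp_ge_add_one_self) auto
        also have "\<dots> = exp (real (2 ^ n) * (h n * (a + c)))" by (rule exp_of_nat_mult[symmetric])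
        also have "real (2 ^ n) * (h n * (a + c)) = (a + c) * T" by (simp add: h_def)
        finally show "q ^ (2 ^ n) \<le> exp ((a + c) * T)" .
        show "0 \<le> T * (2 * \<epsilon>)" using T \<epsilon> by simp
      qed
      also have "\<dots> = e / 2" unfolding \<epsilon>_def G_def using T by simp
      finally show ?thesis using \<open>e > 0\<close> by simp
    qed
    then show "\<exists>no. \<forall>n\<ge>no. norm (norm (f T - z n (2 ^ n)) - 0) < e" by auto
  qed
  then have "(\<lambda>n. f T - z n (2 ^ n)) \<longlonglongrightarrow> 0" by (rule tendsto_norm_zero_cancel)
  then have "(\<lambda>n. f T - (f T - z n (2 ^ n))) \<longlonglongrightarrow> f T - 0" by (intro tendsto_intros)
  then show ?thesis by (simp add: f_def)
qed

section \<open>Second moments of the solution\<close>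

lemma kronecker_mult_vec: "(kronecker P Q *v m) $ (a, b) = (\<Sum>c\<in>UNIV. \<Sum>d\<in>UNIV. P $ a $ c * Q $ b $ d * m $ (c, d))"
  by (subst sum.cartesian_product) (simp add: matrix_vector_mult_def kronecker_def case_prod_beta)

lemma kronecker_one: "kronecker (mat 1) (mat 1) *v m = m" for m :: "real^('n::finite \<times> 'n)"
proof -
  have "kronecker (mat 1 :: real^'n::finite^'n) (mat 1) = mat 1"
    by (auto simp: kronecker_def mat_def vec_eq_iff prod_eq_iff)
  then show ?thesis by simp
qed

lemma vec_nth_measurable[measurable (raw)]:
  fixes f :: "'a \<Rightarrow> real^'n"
  assumes "f \<in> borel_measurable N" shows "(\<lambda>\<omega>. f \<omega> $ i) \<in> borel_measurable N"
  by (rule measurable_compose[OF assms borel_measurable_continuous_onI]) (intro linear_continuous_on bounded_linear_vec_nth)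

context prob_space
begin

definition second_moments :: "('a \<Rightarrow> real^'n) \<Rightarrow> real^('n \<times> 'n)" where
  "second_moments G = (\<chi> p. expectation (\<lambda>\<omega>. G \<omega> $ fst p * G \<omega> $ snd p))"

lemma L2_component_product:
  fixes G H :: "'a \<Rightarrow> real^'n"
  assumes [measurable]: "G \<in> borel_measurable M" "H \<in> borel_measurable M"
    and "integrable M (\<lambda>\<omega>. (norm (G \<omega>))\<^sup>2)" "integrable M (\<lambda>\<omega>. (norm (H \<omega>))\<^sup>2)"
  shows "integrable M (\<lambda>\<omega>. G \<omega> $ a * H \<omega> $ b)"
proof (rule Bochner_Integration.integrable_bound[where f="\<lambda>\<omega>. (norm (G \<omega>))\<^sup>2 + (norm (H \<omega>))\<^sup>2"])
  have "\<bar>G \<omega> $ a * H \<omega> $ b\<bar> \<le> (norm (G \<omega>))\<^sup>2 + (norm (H \<omega>))\<^sup>2" for \<omega>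
  proof -
    have "\<bar>G \<omega> $ a * H \<omega> $ b\<bar> \<le> norm (G \<omega>) * norm (H \<omega>)"
      unfolding abs_mult by (intro mult_mono component_le_norm_cart) auto
    also have "\<dots> \<le> (norm (G \<omega>))\<^sup>2 + (norm (H \<omega>))\<^sup>2" using abs_mult_le_squares[of "norm (G \<omega>)" "norm (H \<omega>)"] by simp
    finally show ?thesis .
  qed
  then show "AE \<omega> in M. norm (G \<omega> $ a * H \<omega> $ b) \<le> norm ((norm (G \<omega>))\<^sup>2 + (norm (H \<omega>))\<^sup>2)" by simp
qed (use assms in auto)

lemma second_moments_linear:
  fixes G :: "'a \<Rightarrow> real^'n"
  assumes "G \<in> borel_measurable M" "integrable M (\<lambda>\<omega>. (norm (G \<omega>))\<^sup>2)"
  shows "expectation (\<lambda>\<omega>. (P *v G \<omega>) $ a * (Q *v G \<omega>) $ b) = (kronecker P Q *v second_moments G) $ (a, b)"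
proof -
  have "(P *v G \<omega>) $ a * (Q *v G \<omega>) $ b = (\<Sum>c\<in>UNIV. \<Sum>d\<in>UNIV. P $ a $ c * Q $ b $ d * (G \<omega> $ c * G \<omega> $ d))" for \<omega>
    by (simp add: matrix_vector_mult_def sum_product mult_ac)
  then show ?thesis
    using L2_component_product[OF assms(1) assms(1) assms(2) assms(2)]
    by (simp add: kronecker_mult_vec second_moments_def)
qed

end

context stratonovich_setting
begin

text \<open>An exact identity. Terms linear in a Brownian increment have mean zero, and a product of
  two increments is its compensated part plus \<open>mesh n\<close> on the diagonal. The diagonal
  yields the sum of the Kronecker products of B_j with itself, the products of the state with the
  drift yield the rest of \<open>Delta\<close>.\<close>

lemma euler_moments_step:
  assumes k: "k < 2 ^ n"
  shows "second_moments (euler n (Suc k)) = second_moments (euler n k)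
     + mesh n *\<^sub>R (Delta A B *v second_moments (euler n k)) + (mesh n)\<^sup>2 *\<^sub>R (kronecker At At *v second_moments (euler n k))"
proof -
  define Y where "Y = euler n k"
  have Ym[measurable]: "Y \<in> borel_measurable M" unfolding Y_def by measurable
  have YF: "Y \<in> borel_measurable (F (g n k))" unfolding Y_def by (rule euler_adapted)
  have Y2: "integrable M (\<lambda>\<omega>. (norm (Y \<omega>))\<^sup>2)" unfolding Y_def using k by (intro euler_L2) simp
  have PYF: "(\<lambda>\<omega>. (P *v Y \<omega>) $ a) \<in> borel_measurable (F (g n k))" for P :: "real^'n^'n" and a
    using YF by measurable
  have prodF: "(\<lambda>\<omega>. (P *v Y \<omega>) $ a * (Q *v Y \<omega>) $ b) \<in> borel_measurable (F (g n k))" for P Q :: "real^'n^'n" and a b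
    using PYF[of P a] PYF[of Q b] by measurable
  have prodI: "integrable M (\<lambda>\<omega>. (P *v Y \<omega>) $ a * (Q *v Y \<omega>) $ b)" for P Q :: "real^'n^'n" and a b
    by (intro L2_component_product L2_matvec Y2) measurable
  note prodE = second_moments_linear[OF Ym Y2]
  note d1 = dW_mult1[OF prodF prodI]
  note d2 = dWW_orth[OF prodF prodI]
  show ?thesis
  proof (rule vec_eq_iff[THEN iffD2], rule allI)
    fix p :: "'n \<times> 'n"
    obtain a b where p: "p = (a, b)" by (cases p)
    define h where "h = mesh n"
    \<comment> \<open>The identity matrix is written out so that every term has the form (P Y)_a (Q
      Y)_b and becomes a Kronecker product; for the same reason \<open>matrix_vector_mul_lid\<close>
      is withheld from the simplifier below.\<close>
    let ?I = "mat 1 :: real^'n^'n"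
    have eq: "euler n (Suc k) \<omega> $ a * euler n (Suc k) \<omega> $ b =
      (?I *v Y \<omega>) $ a * (?I *v Y \<omega>) $ b
      + h * ((At *v Y \<omega>) $ a * (?I *v Y \<omega>) $ b) + h * ((?I *v Y \<omega>) $ a * (At *v Y \<omega>) $ b)
      + h\<^sup>2 * ((At *v Y \<omega>) $ a * (At *v Y \<omega>) $ b)
      + (\<Sum>j\<in>UNIV. (?I *v Y \<omega>) $ a * (B j *v Y \<omega>) $ b * dW j n k \<omega>)
      + (\<Sum>j\<in>UNIV. (B j *v Y \<omega>) $ a * (?I *v Y \<omega>) $ b * dW j n k \<omega>)
      + h * (\<Sum>j\<in>UNIV. (At *v Y \<omega>) $ a * (B j *v Y \<omega>) $ b * dW j n k \<omega>)
      + h * (\<Sum>j\<in>UNIV. (B j *v Y \<omega>) $ a * (At *v Y \<omega>) $ b * dW j n k \<omega>)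
      + (\<Sum>i\<in>UNIV. \<Sum>j\<in>UNIV. (B i *v Y \<omega>) $ a * (B j *v Y \<omega>) $ b * dWW i j n k \<omega>)
      + h * (\<Sum>j\<in>UNIV. (B j *v Y \<omega>) $ a * (B j *v Y \<omega>) $ b)" for \<omega>
    proof -
      define U V where "U = (\<Sum>j\<in>UNIV. (B j *v Y \<omega>) $ a * dW j n k \<omega>)" and "V = (\<Sum>j\<in>UNIV. (B j *v Y \<omega>) $ b * dW j n k \<omega>)"
      have comp: "euler n (Suc k) \<omega> $ c = Y \<omega> $ c + h * (At *v Y \<omega>) $ c + (\<Sum>j\<in>UNIV. (B j *v Y \<omega>) $ c * dW j n k \<omega>)" for c
        by (simp add: ito_step_def Y_def h_def mult.commute)
      have UV: "U * V = (\<Sum>i\<in>UNIV. \<Sum>j\<in>UNIV. (B i *v Y \<omega>) $ a * (B j *v Y \<omega>) $ b * dWW i j n k \<omega>)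
         + h * (\<Sum>j\<in>UNIV. (B j *v Y \<omega>) $ a * (B j *v Y \<omega>) $ b)"
      proof -
        have "U * V = (\<Sum>i\<in>UNIV. \<Sum>j\<in>UNIV. (B i *v Y \<omega>) $ a * (B j *v Y \<omega>) $ b * (dW i n k \<omega> * dW j n k \<omega>))"
          unfolding U_def V_def sum_product by (simp add: mult_ac)
        also have "\<dots> = (\<Sum>i\<in>UNIV. \<Sum>j\<in>UNIV. (B i *v Y \<omega>) $ a * (B j *v Y \<omega>) $ b * dWW i j n k \<omega>
            + (if i = j then (B i *v Y \<omega>) $ a * (B j *v Y \<omega>) $ b * h else 0))"
          by (intro sum.cong refl) (simp add: dWW_def h_def algebra_simps)
        also have "\<dots> = (\<Sum>i\<in>UNIV. \<Sum>j\<in>UNIV. (B i *v Y \<omega>) $ a * (B j *v Y \<omega>) $ b * dWW i j n k \<omega>)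
          + (\<Sum>i\<in>UNIV. (B i *v Y \<omega>) $ a * (B i *v Y \<omega>) $ b * h)"
          unfolding sum.distrib by simp
        finally show ?thesis by (simp add: sum_distrib_left mult_ac)
      qed
      have "euler n (Suc k) \<omega> $ a * euler n (Suc k) \<omega> $ b =
         Y \<omega> $ a * Y \<omega> $ b + h * ((At *v Y \<omega>) $ a * Y \<omega> $ b) + h * (Y \<omega> $ a * (At *v Y \<omega>) $ b)
         + h\<^sup>2 * ((At *v Y \<omega>) $ a * (At *v Y \<omega>) $ b)
         + Y \<omega> $ a * V + U * Y \<omega> $ b + h * ((At *v Y \<omega>) $ a * V) + h * (U * (At *v Y \<omega>) $ b) + U * V"
        unfolding comp U_def[symmetric] V_def[symmetric] by (simp add: algebra_simps power2_eq_square)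
      then show ?thesis
        unfolding UV unfolding U_def V_def by (simp add: sum_distrib_left sum_distrib_right mult_ac)
    qed
    have i1: "integrable M (\<lambda>\<omega>. \<Sum>j\<in>UNIV. (P *v Y \<omega>) $ a * (B j *v Y \<omega>) $ b * dW j n k \<omega>)"
      "expectation (\<lambda>\<omega>. \<Sum>j\<in>UNIV. (P *v Y \<omega>) $ a * (B j *v Y \<omega>) $ b * dW j n k \<omega>) = 0" for P :: "real^'n^'n"
      using d1 by (auto intro!: Bochner_Integration.integrable_sum simp: Bochner_Integration.integral_sum)
    have i2: "integrable M (\<lambda>\<omega>. \<Sum>j\<in>UNIV. (B j *v Y \<omega>) $ a * (P *v Y \<omega>) $ b * dW j n k \<omega>)"
      "expectation (\<lambda>\<omega>. \<Sum>j\<in>UNIV. (B j *v Y \<omega>) $ a * (P *v Y \<omega>) $ b * dW j n k \<omega>) = 0" for P :: "real^'n^'n"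
      using d1 by (auto intro!: Bochner_Integration.integrable_sum simp: Bochner_Integration.integral_sum)
    have i3: "integrable M (\<lambda>\<omega>. \<Sum>i\<in>UNIV. \<Sum>j\<in>UNIV. (B i *v Y \<omega>) $ a * (B j *v Y \<omega>) $ b * dWW i j n k \<omega>)"
      "expectation (\<lambda>\<omega>. \<Sum>i\<in>UNIV. \<Sum>j\<in>UNIV. (B i *v Y \<omega>) $ a * (B j *v Y \<omega>) $ b * dWW i j n k \<omega>) = 0"
      using d2 by (auto intro!: Bochner_Integration.integrable_sum simp: Bochner_Integration.integral_sum)
    define m where "m = second_moments Y"
    have "second_moments (euler n (Suc k)) $ p = expectation (\<lambda>\<omega>. euler n (Suc k) \<omega> $ a * euler n (Suc k) \<omega> $ b)"
      by (simp add: second_moments_def p)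
    also have "\<dots> = (kronecker ?I ?I *v m) $ (a, b) + h * (kronecker At ?I *v m) $ (a, b) + h * (kronecker ?I At *v m) $ (a, b)
      + h\<^sup>2 * (kronecker At At *v m) $ (a, b) + h * (\<Sum>j\<in>UNIV. (kronecker (B j) (B j) *v m) $ (a, b))"
      unfolding eq
      using i1 i2 i3 prodI by (simp add: prodE m_def del: matrix_vector_mul_lid)
    also have "\<dots> = (m + h *\<^sub>R (Delta A B *v m) + h\<^sup>2 *\<^sub>R (kronecker At At *v m)) $ p"
      unfolding kronecker_one p Delta_def matrix_vector_mult_add_rdistrib sum_matrix_vector_mult
      by (simp add: algebra_simps)
    finally show "second_moments (euler n (Suc k)) $ p = (second_moments (euler n k)
     + mesh n *\<^sub>R (Delta A B *v second_moments (euler n k)) + (mesh n)\<^sup>2 *\<^sub>R (kronecker At At *v second_moments (euler n k))) $ p"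
      by (simp add: m_def Y_def h_def)
  qed
qed

lemma euler_moments_limit:
  "(\<lambda>n. second_moments (euler n (2 ^ n))) \<longlonglongrightarrow> matrix_exp (T *\<^sub>R Delta A B) *v vec_of_matrix (self_outer x)"
proof (rule linear_euler_convergence[where z="\<lambda>n k. second_moments (euler n k)" and N="kronecker At At", OF T_pos])
  show "second_moments (euler n 0) = vec_of_matrix (self_outer x)" for n
    by (simp add: second_moments_def vec_of_matrix_def self_outer_def prob_space vec_eq_iff)
qed (simp only: euler_moments_step mesh_def)

lemma X_T_L2: "integrable M (\<lambda>\<omega>. (norm (X T \<omega>))\<^sup>2)"
  using X_moment_bound(1)[of 1 0] by (simp add: g_def mesh_def)

lemma X_second_moments:
  "second_moments (X T) = matrix_exp (T *\<^sub>R Delta A B) *v vec_of_matrix (self_outer x)"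
proof (rule LIMSEQ_unique[OF _ euler_moments_limit])
  have XT[measurable]: "X T \<in> borel_measurable M" using T_pos by (intro X_measurable) simp
  show "(\<lambda>n. second_moments (euler n (2 ^ n))) \<longlonglongrightarrow> second_moments (X T)"
  proof (rule vec_tendstoI)
    fix p :: "'n \<times> 'n"
    define S where "S = expectation (\<lambda>\<omega>. (norm (X T \<omega>))\<^sup>2)"
    define C where "C = 2 * C2 * exp (2 * C0 * T)"
    \<comment> \<open>Entries are compared by 2 u v <= \<alpha> u^2 + v^2 / \<alpha> with \<alpha> =
      sqrt (mesh n). As the mean square error is O(mesh n), both contributions are O(sqrt (mesh
      n)).\<close>
    define b where "b n = sqrt (mesh n) * S + (1 / sqrt (mesh n) + 1) * (C * mesh n)" for n
    have "b = (\<lambda>n. sqrt (mesh n) * S + sqrt (mesh n) * C + C * mesh n)"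
    proof
      fix n
      have "mesh n / sqrt (mesh n) = sqrt (mesh n)" using mesh_pos[of n] by (simp add: real_div_sqrt)
      then show "b n = sqrt (mesh n) * S + sqrt (mesh n) * C + C * mesh n" by (simp add: b_def field_simps)
    qed
    moreover have "(\<lambda>n. sqrt (mesh n) * S + sqrt (mesh n) * C + C * mesh n) \<longlonglongrightarrow> sqrt 0 * S + sqrt 0 * C + C * 0"
      by (intro tendsto_intros mesh_tendsto)
    ultimately have b0: "b \<longlonglongrightarrow> 0" by simp
    have le: "norm (second_moments (X T) $ p - second_moments (euler n (2 ^ n)) $ p) \<le> b n" for n
    proof -
      define Y where "Y = euler n (2 ^ n)"
      have [measurable]: "Y \<in> borel_measurable M" unfolding Y_def by measurable
      have Y2: "integrable M (\<lambda>\<omega>. (norm (Y \<omega>))\<^sup>2)" unfolding Y_def by (rule euler_L2) simp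
      have D: "integrable M (\<lambda>\<omega>. (norm (X T \<omega> - Y \<omega>))\<^sup>2)" "expectation (\<lambda>\<omega>. (norm (X T \<omega> - Y \<omega>))\<^sup>2) \<le> C * mesh n"
        unfolding Y_def using euler_error[of n] by (auto simp: C_def mult_ac)
      define \<alpha> where "\<alpha> = sqrt (mesh n)"
      have \<alpha>: "\<alpha> > 0" using mesh_pos[of n] by (simp add: \<alpha>_def)
      have XX: "integrable M (\<lambda>\<omega>. X T \<omega> $ fst p * X T \<omega> $ snd p)" by (intro L2_component_product X_T_L2 XT)
      have YY: "integrable M (\<lambda>\<omega>. Y \<omega> $ fst p * Y \<omega> $ snd p)" by (intro L2_component_product Y2) measurable
      have pt: "\<bar>X T \<omega> $ fst p * X T \<omega> $ snd p - Y \<omega> $ fst p * Y \<omega> $ snd p\<bar>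
         \<le> \<alpha> * (norm (X T \<omega>))\<^sup>2 + (1 / \<alpha> + 1) * (norm (X T \<omega> - Y \<omega>))\<^sup>2" for \<omega>
      proof -
        define u v where "u = norm (X T \<omega>)" and "v = norm (X T \<omega> - Y \<omega>)"
        define d where "d = X T \<omega> - Y \<omega>"
        have "X T \<omega> $ fst p * X T \<omega> $ snd p - Y \<omega> $ fst p * Y \<omega> $ snd p =
          X T \<omega> $ fst p * d $ snd p + d $ fst p * X T \<omega> $ snd p - d $ fst p * d $ snd p"
          by (simp add: d_def algebra_simps)
        also have "\<bar>\<dots>\<bar> \<le> \<bar>X T \<omega> $ fst p * d $ snd p\<bar> + \<bar>d $ fst p * X T \<omega> $ snd p\<bar> + \<bar>d $ fst p * d $ snd p\<bar>" by linarith
        also have "\<dots> \<le> u * v + v * u + v * v"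
          unfolding abs_mult u_def v_def d_def[symmetric] by (intro add_mono mult_mono component_le_norm_cart) auto
        also have "\<dots> \<le> \<alpha> * u\<^sup>2 + (1 / \<alpha> + 1) * v\<^sup>2"
        proof -
          have "0 \<le> (\<alpha> * u - v)\<^sup>2" by simp
          then have "2 * (u * v) * \<alpha> \<le> \<alpha> * (\<alpha> * u\<^sup>2) + v\<^sup>2" by (simp add: power2_diff power2_eq_square algebra_simps)
          then have "2 * (u * v) \<le> \<alpha> * u\<^sup>2 + v\<^sup>2 / \<alpha>" using \<alpha> by (simp add: field_simps)
          then show ?thesis by (simp add: algebra_simps power2_eq_square)
        qed
        finally show ?thesis by (simp add: u_def v_def)
      qed
      have "second_moments (X T) $ p - second_moments Y $ p = expectation (\<lambda>\<omega>. X T \<omega> $ fst p * X T \<omega> $ snd p - Y \<omega> $ fst p * Y \<omega> $ snd p)"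
        using XX YY by (simp add: second_moments_def)
      also have "\<bar>\<dots>\<bar> \<le> expectation (\<lambda>\<omega>. \<bar>X T \<omega> $ fst p * X T \<omega> $ snd p - Y \<omega> $ fst p * Y \<omega> $ snd p\<bar>)" by (rule integral_abs_bound)
      also have "\<dots> \<le> expectation (\<lambda>\<omega>. \<alpha> * (norm (X T \<omega>))\<^sup>2 + (1 / \<alpha> + 1) * (norm (X T \<omega> - Y \<omega>))\<^sup>2)"
        by (rule integral_mono) (use XX YY pt X_T_L2 D in auto)
      also have "\<dots> = \<alpha> * S + (1 / \<alpha> + 1) * expectation (\<lambda>\<omega>. (norm (X T \<omega> - Y \<omega>))\<^sup>2)"
        using X_T_L2 D by (simp add: S_def)
      also have "\<dots> \<le> \<alpha> * S + (1 / \<alpha> + 1) * (C * mesh n)"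
        using D(2) \<alpha> by (intro add_left_mono mult_left_mono) auto
      finally show ?thesis by (simp add: b_def \<alpha>_def Y_def)
    qed
    have "(\<lambda>n. second_moments (X T) $ p - second_moments (euler n (2 ^ n)) $ p) \<longlonglongrightarrow> 0"
      by (rule Lim_null_comparison[OF _ b0]) (use le in auto)
    then have "(\<lambda>n. second_moments (X T) $ p - (second_moments (X T) $ p - second_moments (euler n (2 ^ n)) $ p)) \<longlonglongrightarrow> second_moments (X T) $ p - 0"
      by (intro tendsto_intros)
    then show "(\<lambda>n. second_moments (euler n (2 ^ n)) $ p) \<longlonglongrightarrow> second_moments (X T) $ p" by simp
  qed
qed

end

section \<open>Asymptotics\<close>

lemma norm_complex_vec: "norm (complex_vec v) = norm v"
  by (simp add: complex_vec_def norm_vec_def L2_set_def)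

lemma norm_vector_scalar_mult_complex: "norm (c *s v) = cmod c * norm v" for v :: "complex^'k"
  by (simp add: norm_vec_def L2_set_def norm_mult power_mult_distrib sum_distrib_left[symmetric] real_sqrt_mult)

lemma asymptotic_exponents_bounds:
  assumes "asymptotic_exponents D y q l"
  obtains K0 K1 where "K0 > 0" "K1 > 0"
    "\<forall>\<^sub>F t in at_top. K0 * (t ^ (l - 1) * exp (- q * t)) \<le> norm (matrix_exp (t *\<^sub>R D) *v y) \<and>
       norm (matrix_exp (t *\<^sub>R D) *v y) \<le> K1 * (t ^ (l - 1) * exp (- q * t))"
proof -
  obtain m and \<theta> :: "nat \<Rightarrow> real" and v :: "nat \<Rightarrow> complex^'a" and K0 K1 :: real where
    lim: "((\<lambda>t::real. norm (complex_of_real (exp (q * t) / t ^ (l - 1)) *s complex_vec (matrix_exp (t *\<^sub>R D) *v y)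
          - (\<Sum>k=1..m. exp (\<i> * complex_of_real (t * \<theta> k)) *s v k))) \<longlongrightarrow> 0) at_top"
    and K: "K0 > 0" "K1 > 0"
    and inf: "ereal K0 \<le> Liminf at_top (\<lambda>t::real. ereal (norm (\<Sum>k=1..m. exp (\<i> * complex_of_real (t * \<theta> k)) *s v k)))"
    and sup: "Limsup at_top (\<lambda>t::real. ereal (norm (\<Sum>k=1..m. exp (\<i> * complex_of_real (t * \<theta> k)) *s v k))) \<le> ereal K1"
    using assms unfolding asymptotic_exponents_def by (elim conjE bexE exE)
  define osc where "osc t = (\<Sum>k=1..m. exp (\<i> * complex_of_real (t * \<theta> k)) *s v k)" for t
  \<comment> \<open>Half of K0 is lost in passing from the lower limit to an eventual strict bound,
    and a quarter more to the approximation error; on the upper side the same two losses turn K1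
    into 3 K1.\<close>
  have e1: "\<forall>\<^sub>F t in at_top. K0 / 2 < norm (osc t)"
  proof -
    have "ereal (K0 / 2) < Liminf at_top (\<lambda>t. ereal (norm (osc t)))"
      by (rule less_le_trans[OF _ inf[folded osc_def]]) (use K in simp)
    from less_LiminfD[OF this] show ?thesis by (simp only: less_ereal.simps)
  qed
  have e2: "\<forall>\<^sub>F t in at_top. norm (osc t) < 2 * K1"
  proof -
    have "Limsup at_top (\<lambda>t. ereal (norm (osc t))) < ereal (2 * K1)"
      by (rule le_less_trans[OF sup[folded osc_def]]) (use K in simp)
    from Limsup_lessD[OF this] show ?thesis by (simp only: less_ereal.simps)
  qed
  have e3: "\<forall>\<^sub>F t in at_top. norm (complex_of_real (exp (q * t) / t ^ (l - 1)) *s complex_vec (matrix_exp (t *\<^sub>R D) *v y) - osc t) < min (K0 / 4) K1"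
    by (rule order_tendstoD(2)[OF lim[folded osc_def]]) (use K in auto)
  have "\<forall>\<^sub>F t in at_top. K0 / 4 * (t ^ (l - 1) * exp (- q * t)) \<le> norm (matrix_exp (t *\<^sub>R D) *v y) \<and>
       norm (matrix_exp (t *\<^sub>R D) *v y) \<le> 3 * K1 * (t ^ (l - 1) * exp (- q * t))"
    using e1 e2 e3 eventually_gt_at_top[of 0]
  proof eventually_elim
    case (elim t)
    define \<phi> where "\<phi> = exp (q * t) / t ^ (l - 1)"
    define u where "u = complex_of_real \<phi> *s complex_vec (matrix_exp (t *\<^sub>R D) *v y)"
    have \<phi>: "\<phi> > 0" using elim by (simp add: \<phi>_def)
    have nu: "norm u = \<phi> * norm (matrix_exp (t *\<^sub>R D) *v y)"
      using \<phi> by (simp add: u_def norm_vector_scalar_mult_complex norm_complex_vec)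
    have "norm (u - osc t) < K0 / 4" "norm (u - osc t) < K1" using elim by (auto simp: u_def \<phi>_def)
    then have "K0 / 4 \<le> norm u" "norm u \<le> 3 * K1"
      using elim norm_triangle_ineq2[of "osc t" u] norm_triangle_ineq2[of u "osc t"] by (auto simp: norm_minus_commute)
    moreover have profile: "t ^ (l - 1) * exp (- q * t) = 1 / \<phi>" using elim by (simp add: \<phi>_def exp_minus field_simps)
    ultimately show ?case unfolding profile using \<phi> by (simp add: nu field_simps)
  qed
  then show ?thesis using K by (intro that[of "K0 / 4" "3 * K1"]) auto
qed

text \<open>The trace of the matrix of second moments is the mean of |G|^2, and every entry is
  dominated by it since |G_a G_b| <= |G|^2 pointwise. The dimension factors come from counting
  entries.\<close>

lemma (in prob_space) second_moments_trace_bounds: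
  fixes G :: "'a \<Rightarrow> real^'n"
  assumes [measurable]: "G \<in> borel_measurable M" and G: "integrable M (\<lambda>\<omega>. (norm (G \<omega>))\<^sup>2)"
  shows "expectation (\<lambda>\<omega>. (norm (G \<omega>))\<^sup>2) \<le> real CARD('n) * norm (second_moments G)"
    and "norm (second_moments G) \<le> real CARD('n \<times> 'n) * expectation (\<lambda>\<omega>. (norm (G \<omega>))\<^sup>2)"
proof -
  note int = L2_component_product[OF assms(1) assms(1) G G]
  have "(norm (G \<omega>))\<^sup>2 = (\<Sum>a\<in>UNIV. G \<omega> $ a * G \<omega> $ a)" for \<omega>
    by (simp add: norm_vec_def L2_set_def sum_nonneg power2_eq_square)
  then have "expectation (\<lambda>\<omega>. (norm (G \<omega>))\<^sup>2) = (\<Sum>a\<in>UNIV. second_moments G $ (a, a))"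
    using int by (simp add: second_moments_def)
  also have "\<dots> \<le> (\<Sum>a\<in>(UNIV :: 'n set). norm (second_moments G))"
    by (intro sum_mono order_trans[OF abs_ge_self component_le_norm_cart])
  finally show "expectation (\<lambda>\<omega>. (norm (G \<omega>))\<^sup>2) \<le> real CARD('n) * norm (second_moments G)" by simp
  have "norm (second_moments G) \<le> (\<Sum>p\<in>UNIV. \<bar>second_moments G $ p\<bar>)" by (rule norm_le_l1_cart)
  also have "\<dots> \<le> (\<Sum>p\<in>(UNIV :: ('n \<times> 'n) set). expectation (\<lambda>\<omega>. (norm (G \<omega>))\<^sup>2))"
  proof (rule sum_mono)
    fix p :: "'n \<times> 'n"
    have "\<bar>second_moments G $ p\<bar> \<le> expectation (\<lambda>\<omega>. \<bar>G \<omega> $ fst p * G \<omega> $ snd p\<bar>)"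
      unfolding second_moments_def by simp
    also have "\<dots> \<le> expectation (\<lambda>\<omega>. (norm (G \<omega>))\<^sup>2)"
    proof (rule integral_mono)
      show "\<bar>G \<omega> $ fst p * G \<omega> $ snd p\<bar> \<le> (norm (G \<omega>))\<^sup>2" for \<omega>
        unfolding abs_mult power2_eq_square by (intro mult_mono component_le_norm_cart) auto
    qed (use int G in auto)
    finally show "\<bar>second_moments G $ p\<bar> \<le> expectation (\<lambda>\<omega>. (norm (G \<omega>))\<^sup>2)" .
  qed
  finally show "norm (second_moments G) \<le> real CARD('n \<times> 'n) * expectation (\<lambda>\<omega>. (norm (G \<omega>))\<^sup>2)" by simp
qed

text \<open>The log-log term and the shift are both of lower order than ln (1 / \<epsilon>). This
  leading order is all that the polynomial factor of the profile can see.\<close>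

lemma cutoff_time_ratio_tendsto:
  fixes w :: "real \<Rightarrow> real"
  assumes q: "q > 0" and w: "(w \<longlongrightarrow> w0) (at_right 0)"
  shows "((\<lambda>\<epsilon>. (cutoff_time q l \<epsilon> + r * w \<epsilon>) / ln (1 / \<epsilon>)) \<longlongrightarrow> 1 / q) (at_right 0)"
proof -
  have u: "filterlim (\<lambda>\<epsilon>::real. ln (1 / \<epsilon>)) at_top (at_right 0)" by real_asymp
  have "((\<lambda>u::real. ln u / u) \<longlongrightarrow> 0) at_top" by real_asymp
  from filterlim_compose[OF this u] have l0: "((\<lambda>\<epsilon>::real. ln (ln (1 / \<epsilon>)) / ln (1 / \<epsilon>)) \<longlongrightarrow> 0) (at_right 0)" .
  have w0: "((\<lambda>\<epsilon>. w \<epsilon> / ln (1 / \<epsilon>)) \<longlongrightarrow> 0) (at_right 0)"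
    by (rule tendsto_divide_0[OF w filterlim_at_top_imp_at_infinity[OF u]])
  have "((\<lambda>\<epsilon>. 1 / q + (real l - 1) / q * (ln (ln (1 / \<epsilon>)) / ln (1 / \<epsilon>)) + r * (w \<epsilon> / ln (1 / \<epsilon>))) \<longlongrightarrow> 1 / q + (real l - 1) / q * 0 + r * 0) (at_right 0)"
    by (intro tendsto_intros l0 w0)
  moreover have "\<forall>\<^sub>F \<epsilon> in at_right 0. 1 / q + (real l - 1) / q * (ln (ln (1 / \<epsilon>)) / ln (1 / \<epsilon>)) + r * (w \<epsilon> / ln (1 / \<epsilon>)) =
    (cutoff_time q l \<epsilon> + r * w \<epsilon>) / ln (1 / \<epsilon>)"
    using filterlim_at_top_dense[THEN iffD1, OF u, rule_format, of 0]
  proof eventually_elim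
    case (elim \<epsilon>)
    define u where "u = ln (1 / \<epsilon>)"
    have "u > 0" using elim by (simp add: u_def)
    then show ?case unfolding cutoff_time_def u_def[symmetric] using q by (simp add: field_simps)
  qed
  ultimately show ?thesis by (simp add: tendsto_cong)
qed

text \<open>The log-log term of the cutoff time contributes to exp (- q \<tau>) the factor 1 / ln (1
  / \<epsilon>)^(l - 1), which cancels the growth of \<tau>^(l - 1). Only the limit of \<tau> / ln
  (1 / \<epsilon>) and the shift r w survive.\<close>

lemma cutoff_profile_tendsto:
  fixes w :: "real \<Rightarrow> real"
  assumes q: "q > 0" and l: "l \<ge> 1" and w: "(w \<longlongrightarrow> w0) (at_right 0)"
  defines "\<tau> \<equiv> \<lambda>r \<epsilon>. cutoff_time q l \<epsilon> + r * w \<epsilon>"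
  shows "filterlim (\<tau> r) at_top (at_right 0)"
    and "((\<lambda>\<epsilon>. \<tau> r \<epsilon> ^ (l - 1) * exp (- q * \<tau> r \<epsilon>) / \<epsilon>) \<longlongrightarrow> (1 / q) ^ (l - 1) * exp (- q * w0 * r)) (at_right 0)"
proof -
  have u: "filterlim (\<lambda>\<epsilon>::real. ln (1 / \<epsilon>)) at_top (at_right 0)" by real_asymp
  have upos: "\<forall>\<^sub>F \<epsilon> in at_right (0::real). 0 < ln (1 / \<epsilon>)" using filterlim_at_top_dense[THEN iffD1, OF u] by blast
  have ratio: "((\<lambda>\<epsilon>. \<tau> r \<epsilon> / ln (1 / \<epsilon>)) \<longlongrightarrow> 1 / q) (at_right 0)"
    unfolding \<tau>_def by (rule cutoff_time_ratio_tendsto[OF q w])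
  have "filterlim (\<lambda>\<epsilon>. (\<tau> r \<epsilon> / ln (1 / \<epsilon>)) * ln (1 / \<epsilon>)) at_top (at_right 0)"
    by (rule filterlim_tendsto_pos_mult_at_top[OF ratio _ u]) (use q in simp)
  moreover have "\<forall>\<^sub>F \<epsilon> in at_right 0. (\<tau> r \<epsilon> / ln (1 / \<epsilon>)) * ln (1 / \<epsilon>) = \<tau> r \<epsilon>"
    using upos by eventually_elim (metis less_irrefl nonzero_eq_divide_eq)
  ultimately show "filterlim (\<tau> r) at_top (at_right 0)" by (rule filterlim_mono_eventually[OF _ order_refl order_refl])
  have "((\<lambda>\<epsilon>. (\<tau> r \<epsilon> / ln (1 / \<epsilon>)) ^ (l - 1) * exp (- q * w \<epsilon> * r)) \<longlongrightarrow> (1 / q) ^ (l - 1) * exp (- q * w0 * r)) (at_right 0)"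
    by (intro tendsto_intros ratio w)
  moreover have "\<forall>\<^sub>F \<epsilon> in at_right 0. (\<tau> r \<epsilon> / ln (1 / \<epsilon>)) ^ (l - 1) * exp (- q * w \<epsilon> * r) = \<tau> r \<epsilon> ^ (l - 1) * exp (- q * \<tau> r \<epsilon>) / \<epsilon>"
    using upos eventually_at_right_less[of 0]
  proof eventually_elim
    case (elim \<epsilon>)
    define u where "u = ln (1 / \<epsilon>)"
    have u0: "u > 0" and \<epsilon>: "\<epsilon> > 0" using elim by (auto simp: u_def)
    have eu: "exp (- u) = \<epsilon>" using \<epsilon> by (simp add: u_def ln_div)
    have "- q * \<tau> r \<epsilon> = - u + - (real (l - 1) * ln u) + - q * w \<epsilon> * r"
      unfolding \<tau>_def cutoff_time_def u_def[symmetric] using q l by (simp add: of_nat_diff field_simps)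
    then have "exp (- q * \<tau> r \<epsilon>) = exp (- u) * exp (- (real (l - 1) * ln u)) * exp (- q * w \<epsilon> * r)"
      by (simp add: exp_add[symmetric])
    also have "exp (- (real (l - 1) * ln u)) = 1 / u ^ (l - 1)"
      using u0 by (simp add: exp_minus exp_of_nat_mult inverse_eq_divide)
    finally have "exp (- q * \<tau> r \<epsilon>) = \<epsilon> * (1 / u ^ (l - 1)) * exp (- q * w \<epsilon> * r)" unfolding eu .
    then show ?case unfolding u_def[symmetric] using \<epsilon> u0 by (simp add: power_divide)
  qed
  ultimately show "((\<lambda>\<epsilon>. \<tau> r \<epsilon> ^ (l - 1) * exp (- q * \<tau> r \<epsilon>) / \<epsilon>) \<longlongrightarrow> (1 / q) ^ (l - 1) * exp (- q * w0 * r)) (at_right 0)"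
    by (rule Lim_transform_eventually)
qed

text \<open>At the cutoff scale the profile divided by \<epsilon> converges to a multiple of exp (-
  q w0 r), which tends to 0 and to infinity at the two ends of the r-axis; the two-sided comparison
  transfers these limits to S.\<close>

lemma profile_cutoff:
  fixes S :: "real \<Rightarrow> ennreal" and w :: "real \<Rightarrow> real"
  assumes q: "q > 0" and l: "l \<ge> 1" and w: "(w \<longlongrightarrow> w0) (at_right 0)" and w0: "w0 > 0" and c0: "c0 > 0"
    and S: "\<forall>\<^sub>F t in at_top. ennreal (c0 * (t ^ (l - 1) * exp (- q * t))) \<le> S t \<and> S t \<le> ennreal (c1 * (t ^ (l - 1) * exp (- q * t)))"
  shows "((\<lambda>r. Limsup (at_right 0) (\<lambda>\<epsilon>. S (cutoff_time q l \<epsilon> + r * w \<epsilon>) / ennreal \<epsilon>)) \<longlongrightarrow> 0) at_top"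
    and "((\<lambda>r. Liminf (at_right 0) (\<lambda>\<epsilon>. S (cutoff_time q l \<epsilon> + r * w \<epsilon>) / ennreal \<epsilon>)) \<longlongrightarrow> \<infinity>) at_bot"
proof -
  define \<tau> where "\<tau> r \<epsilon> = cutoff_time q l \<epsilon> + r * w \<epsilon>" for r \<epsilon>
  define \<Lambda> where "\<Lambda> r = (1 / q) ^ (l - 1) * exp (- q * w0 * r)" for r
  have top: "filterlim (\<tau> r) at_top (at_right 0)"
    and lim: "((\<lambda>\<epsilon>. \<tau> r \<epsilon> ^ (l - 1) * exp (- q * \<tau> r \<epsilon>) / \<epsilon>) \<longlongrightarrow> \<Lambda> r) (at_right 0)" for r
    using cutoff_profile_tendsto[OF q l w, of r] by (simp_all add: \<tau>_def[abs_def] \<Lambda>_def)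
  have limc: "((\<lambda>\<epsilon>. ennreal (c * (\<tau> r \<epsilon> ^ (l - 1) * exp (- q * \<tau> r \<epsilon>)) / \<epsilon>)) \<longlongrightarrow> ennreal (c * \<Lambda> r)) (at_right 0)" for c r
    using tendsto_mult[OF tendsto_const[of c] lim[of r]] by (intro tendsto_ennrealI) simp
  have ev: "\<forall>\<^sub>F \<epsilon> in at_right 0. ennreal (c0 * (\<tau> r \<epsilon> ^ (l - 1) * exp (- q * \<tau> r \<epsilon>)) / \<epsilon>) \<le> S (\<tau> r \<epsilon>) / ennreal \<epsilon> \<and>
    S (\<tau> r \<epsilon>) / ennreal \<epsilon> \<le> ennreal (c1 * (\<tau> r \<epsilon> ^ (l - 1) * exp (- q * \<tau> r \<epsilon>)) / \<epsilon>)" for r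
    using eventually_compose_filterlim[OF S top[of r]] eventually_compose_filterlim[OF eventually_gt_at_top[of 0] top[of r]]
      eventually_at_right_less[of 0]
  proof eventually_elim
    case (elim \<epsilon>)
    define p where "p = \<tau> r \<epsilon> ^ (l - 1) * exp (- q * \<tau> r \<epsilon>)"
    have p: "p > 0" using elim by (simp add: p_def)
    have b: "ennreal (c0 * p) \<le> S (\<tau> r \<epsilon>)" "S (\<tau> r \<epsilon>) \<le> ennreal (c1 * p)" using elim by (auto simp: p_def)
    \<comment> \<open>The sign of c1 follows from the two-sided bound. It is required to identify
      the real quotient with the extended one, since \<open>ennreal\<close> sends negative numbers
      to 0.\<close>
    have c1: "0 \<le> c1 * p"
    proof (rule ccontr)
      assume "\<not> 0 \<le> c1 * p"
      then have "ennreal (c0 * p) \<le> 0" using b by (simp add: ennreal_neg)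
      moreover have "0 < ennreal (c0 * p)" using c0 p by (simp add: ennreal_less_zero_iff)
      ultimately show False by simp
    qed
    show ?case
      unfolding p_def[symmetric]
      using divide_right_mono_ennreal[OF b(1), of "ennreal \<epsilon>"] divide_right_mono_ennreal[OF b(2), of "ennreal \<epsilon>"] elim c0 p c1
      by (simp add: divide_ennreal)
  qed
  have upper: "Limsup (at_right 0) (\<lambda>\<epsilon>. S (\<tau> r \<epsilon>) / ennreal \<epsilon>) \<le> ennreal (c1 * \<Lambda> r)" for r
  proof -
    have "Limsup (at_right 0) (\<lambda>\<epsilon>. S (\<tau> r \<epsilon>) / ennreal \<epsilon>) \<le> Limsup (at_right 0) (\<lambda>\<epsilon>. ennreal (c1 * (\<tau> r \<epsilon> ^ (l - 1) * exp (- q * \<tau> r \<epsilon>)) / \<epsilon>))"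
      by (rule Limsup_mono) (use ev[of r] in \<open>auto elim: eventually_mono\<close>)
    also have "\<dots> = ennreal (c1 * \<Lambda> r)" by (rule lim_imp_Limsup[OF _ limc]) simp
    finally show ?thesis .
  qed
  have lower: "ennreal (c0 * \<Lambda> r) \<le> Liminf (at_right 0) (\<lambda>\<epsilon>. S (\<tau> r \<epsilon>) / ennreal \<epsilon>)" for r
  proof -
    have "ennreal (c0 * \<Lambda> r) = Liminf (at_right 0) (\<lambda>\<epsilon>. ennreal (c0 * (\<tau> r \<epsilon> ^ (l - 1) * exp (- q * \<tau> r \<epsilon>)) / \<epsilon>))"
      by (rule lim_imp_Liminf[OF _ limc, symmetric]) simp
    also have "\<dots> \<le> Liminf (at_right 0) (\<lambda>\<epsilon>. S (\<tau> r \<epsilon>) / ennreal \<epsilon>)"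
      by (rule Liminf_mono) (use ev[of r] in \<open>auto elim: eventually_mono\<close>)
    finally show ?thesis .
  qed
  have "(\<Lambda> \<longlongrightarrow> 0) at_top" unfolding \<Lambda>_def[abs_def] using q w0 by real_asymp
  then have "((\<lambda>r. ennreal (c1 * \<Lambda> r)) \<longlongrightarrow> ennreal (c1 * 0)) at_top" by (intro tendsto_ennrealI tendsto_intros)
  then have z: "((\<lambda>r. ennreal (c1 * \<Lambda> r)) \<longlongrightarrow> 0) at_top" by simp
  show "((\<lambda>r. Limsup (at_right 0) (\<lambda>\<epsilon>. S (cutoff_time q l \<epsilon> + r * w \<epsilon>) / ennreal \<epsilon>)) \<longlongrightarrow> 0) at_top"
    by (rule tendsto_sandwich[OF _ _ tendsto_const z]) (use upper in \<open>auto simp: \<tau>_def\<close>)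
  have "filterlim (\<lambda>r. c0 * \<Lambda> r) at_top at_bot" unfolding \<Lambda>_def[abs_def] using q w0 c0 by real_asymp
  then have z: "((\<lambda>r. ennreal (c0 * \<Lambda> r)) \<longlongrightarrow> top) at_bot" by (simp add: ennreal_tendsto_top_eq_at_top)
  show "((\<lambda>r. Liminf (at_right 0) (\<lambda>\<epsilon>. S (cutoff_time q l \<epsilon> + r * w \<epsilon>) / ennreal \<epsilon>)) \<longlongrightarrow> \<infinity>) at_bot"
    unfolding infinity_ennreal_def
    by (rule tendsto_sandwich[OF _ _ z tendsto_const]) (use lower in \<open>auto simp: \<tau>_def\<close>)
qed

theorem corollary2p7:
  fixes M :: "'a measure" and F :: "real \<Rightarrow> 'a measure"
    and W :: "'l::finite \<Rightarrow> real \<Rightarrow> 'a \<Rightarrow> real"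
    and A :: "real^'n^'n" and B :: "'l \<Rightarrow> real^'n^'n"
    and x :: "real^'n" and X :: "real \<Rightarrow> 'a \<Rightarrow> real^'n"
    and q :: real and l :: nat and w :: "real \<Rightarrow> real" and w0 :: real
  assumes "usual_filtered_prob_space M F"
    and "independent_brownian_motions M F W"
    and "x \<noteq> 0"
    and "stratonovich_solution M F W A B x X"
    and "hurwitz_stable (Delta A B)"
    and "asymptotic_exponents (Delta A B) (vec_of_matrix (self_outer x)) q l"
    and "\<And>\<epsilon>. \<epsilon> > 0 \<Longrightarrow> w \<epsilon> > 0"
    and "(w \<longlongrightarrow> w0) (at_right 0)"
    and "w0 > 0"
  shows "((\<lambda>r. Limsup (at_right 0) (\<lambda>\<epsilon>.
             second_moment M (X (cutoff_time q l \<epsilon> + r * w \<epsilon>)) / ennreal \<epsilon>)) \<longlongrightarrow> 0) at_top \<and>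
         ((\<lambda>r. Liminf (at_right 0) (\<lambda>\<epsilon>.
             second_moment M (X (cutoff_time q l \<epsilon> + r * w \<epsilon>)) / ennreal \<epsilon>)) \<longlongrightarrow> \<infinity>) at_bot"
proof -
  define f where "f t = matrix_exp (t *\<^sub>R Delta A B) *v vec_of_matrix (self_outer x)" for t
  obtain K0 K1 where K: "K0 > 0" "K1 > 0"
    and ev: "\<forall>\<^sub>F t in at_top. K0 * (t ^ (l - 1) * exp (- q * t)) \<le> norm (f t) \<and> norm (f t) \<le> K1 * (t ^ (l - 1) * exp (- q * t))"
    unfolding f_def using asymptotic_exponents_bounds[OF assms(6)] .
  have ql: "q > 0" "l \<ge> 1" using assms(6) by (auto simp: asymptotic_exponents_def)
  define d where "d = real CARD('n)"
  define d2 where "d2 = real CARD('n \<times> 'n)"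
  have d: "d > 0" "d2 > 0" by (auto simp: d_def d2_def)
  have "\<forall>\<^sub>F t in at_top. ennreal (K0 / d2 * (t ^ (l - 1) * exp (- q * t))) \<le> second_moment M (X t) \<and>
     second_moment M (X t) \<le> ennreal (d * K1 * (t ^ (l - 1) * exp (- q * t)))"
    using ev eventually_gt_at_top[of 0]
  proof eventually_elim
    case (elim t)
    \<comment> \<open>The horizon of the grid is the time t itself, which is positive for all large
      t.\<close>
    interpret stratonovich_setting M F W A B x X t
      by (intro stratonovich_setting.intro brownian_setting.intro brownian_setting_axioms.intro
        stratonovich_setting_axioms.intro assms elim)
    define s where "s = expectation (\<lambda>\<omega>. (norm (X t \<omega>))\<^sup>2)"
    have m: "X t \<in> borel_measurable M" using elim by (intro X_measurable) simp
    have sm: "second_moment M (X t) = ennreal s"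
      unfolding second_moment_def s_def by (rule nn_integral_eq_integral[OF X_T_L2]) simp
    have s: "s \<le> d * norm (f t)" "norm (f t) \<le> d2 * s"
      using second_moments_trace_bounds[OF m X_T_L2] unfolding X_second_moments f_def s_def d_def d2_def by auto
    have "d * norm (f t) \<le> d * (K1 * (t ^ (l - 1) * exp (- q * t)))"
      using elim d by (intro mult_left_mono) auto
    then have upper: "s \<le> d * K1 * (t ^ (l - 1) * exp (- q * t))"
      using s(1) by (simp only: mult.assoc)
    have "K0 * (t ^ (l - 1) * exp (- q * t)) \<le> d2 * s" using elim s(2) by linarith
    then have "K0 / d2 * (t ^ (l - 1) * exp (- q * t)) \<le> s" using d by (simp add: field_simps)
    note this upper
    then show ?case unfolding sm by (simp add: ennreal_leI)
  qed
  from profile_cutoff[OF ql assms(8,9) _ this] K d show ?thesis by simp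
qed

end
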